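(* Let $$\mathrm{Sol}^{\mathcal D}\hookrightarrow\mathrm{Conf}^{\mathcal D}\longrightarrow\mathrm{Fix}_0^{\mathcal D}\overset{q}{\longrightarrow}\mathrm{Fix}_1^{\mathcal D}$$ be a sequence of simplicial presheaves on $\mathrm B\mathcal D$, where $\mathrm{Conf}^{\mathcal D}$, $\mathrm{Fix}_0^{\mathcal D}$, $\mathrm{Fix}_1^{\mathcal D}$ are projectively fibrant, $\mathrm{Conf}^{\mathcal D}\to\mathrm{Fix}_0^{\mathcal D}$ and $q$ are projective fibrations, and $\mathrm{Sol}^{\mathcal D}\subset\mathrm{Conf}^{\mathcal D}$ is a solution subpresheaf. Suppose that $q$ is 0-connected, i.e. for every object $c$ of $\mathrm B\mathcal D$ it induces a bijection $\pi_0\mathrm{Fix}_0^{\mathcal D}(c)\to\pi_0\mathrm{Fix}_1^{\mathcal D}(c)$. Let $\mathcal G_0\in\mathrm{Fix}_0^{\mathcal D}(\mathbb R^0)$ and $\mathcal G_1:=q(\mathcal G_0)\in\mathrm{Fix}_1^{\mathcal D}(\mathbb R^0)$ (so that $\mathrm{Diff}_{[\mathcal G_0]}(M)=\mathrm{Diff}_{[\mathcal G_1]}(M)$). Then, for each smooth $\infty$-group action $\Phi\colon\Gamma\to\mathrm{Diff}_{[\mathcal G_0]}(M)$ there is a canonical equivalence in $\mathcal P(N\mathrm{Cart})$ between moduli $\infty$-prestacks $$\mathrm{Mdl}_\Phi(\mathcal G_0)\simeq\mathrm{Mdl}_\Phi(\mathcal G_1).$$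
   Context: $\mathrm{Cart}$ is the category of smooth manifolds diffeomorphic to some $\mathbb R^m$, $m\ge 0$, and smooth maps; $M$ is a fixed smooth manifold. $\mathrm{Diff}(M)$ is the presheaf of groups on $\mathrm{Cart}$ with $\mathrm{Diff}(M)(c)$ the group of families $\varphi=(\varphi_x)_{x\in c}$ of diffeomorphisms of $M$ such that $(x,z)\mapsto (x,\varphi_x(z))$ is a diffeomorphism of $c\times M$. $\mathrm B\mathcal D$ has the objects of $\mathrm{Cart}$ and morphisms $c\to d$ the pairs $(f,\varphi)$, $f\colon c\to d$ smooth, $\varphi\in \mathrm{Diff}(M)(c)$, composed like the maps $c\times M\to d\times M$, $(x,z)\mapsto (f(x),\varphi_x(z))$; $\pi_M\colon \mathrm B\mathcal D\to \mathrm{Cart}$ is the projection. Projectively fibrant: Kan-complex-valued; projective fibration: objectwise Kan fibration. A solution subpresheaf $\mathrm{Sol}^{\mathcal D}\subset\mathrm{Conf}^{\mathcal D}$ is a simplicial subpresheaf such that each $\mathrm{Sol}^{\mathcal D}(c)$ is a disjoint union of connected components of $\mathrm{Conf}^{\mathcal D}(c)$. For a projectively fibrant $\mathrm{Fix}^{\mathcal D}$ (here $\mathrm{Fix}_0^{\mathcal D}$ or $\mathrm{Fix}_1^{\mathcal D}$) and $\mathcal G\in \mathrm{Fix}^{\mathcal D}(\mathbb R^0)$ write $\mathcal G_c$ for its pullback along $(c\to\mathbb R^0,1_M)$. $\mathrm{Diff}_{[\mathcal G]}(M)\subset\mathrm{Diff}(M)$ consists of the $\varphi$ for which $(1_c,\varphi)^*\mathcal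 G_c$ and $\mathcal G_c$ lie in the same component of $\mathrm{Fix}^{\mathcal D}(c)$; $\mathrm B\mathcal D[\mathcal G]\subset\mathrm B\mathcal D$ is the subcategory with all objects and morphisms $(f,\varphi)$ with $\varphi\in\mathrm{Diff}_{[\mathcal G]}(M)(c)$; a superscript $\mathcal D[\mathcal G]$ denotes restriction to it. $\mathcal S$ is the $\infty$-category of spaces, $\mathcal P(N\mathrm{Cart})=\mathrm{Fun}(N\mathrm{Cart}^{\mathrm{op}},\mathcal S)$; a smooth $\infty$-group is a group object in $\mathcal P(N\mathrm{Cart})$; $\mathrm B$ denotes classifying object, $(-)^{\mathrm{rev}}$ the opposite group. For Kan-complex-valued $F\colon\mathcal C\to\mathrm{sSet}$, $\int F\to N\mathcal C$ is the associated left fibration (unstraightening), with vertices the pairs $(c,x)$, $x\in F(c)_0$. $\mathrm{BSYM}^{\mathrm{rev}}(\mathcal G)$ is the full simplicial subset of $\int\mathrm{Fix}^{\mathcal D[\mathcal G]}$ on the vertices $(c,\mathcal G_c)$; it is a left fibration over $N\mathrm B\mathcal D[\mathcal G]^{\mathrm{op}}$. The left fibration $N\mathrm B\mathcal D[\mathcal G]^{\mathrm{op}}\to N\mathrm{Cart}^{\mathrm{op}}$ classifies $\mathrm B\mathrm{Diff}_{[\mathcal G]}(M)^{\mathrm{rev}}$. Present $\Phi$ by a left fibration $Q\to N\mathrm{Cart}^{\mathrm{op}}$ with reduced fibres classifying $\mathrm B\Gamma^{\mathrm{rev}}$ together with a map $\phi\colon Q\to N\mathrm B\mathcal D[\mathcal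 G]^{\mathrm{op}}$ over $N\mathrm{Cart}^{\mathrm{op}}$ presenting $\mathrm B\Phi^{\mathrm{rev}}$. Put $\mathrm{BSYM}^{\mathrm{rev}}_\phi(\mathcal G):=Q\times_{N\mathrm B\mathcal D[\mathcal G]^{\mathrm{op}}}\mathrm{BSYM}^{\mathrm{rev}}(\mathcal G)$. The moduli $\infty$-prestack $\mathrm{Mdl}_\Phi(\mathcal G)\in\mathcal P(N\mathrm{Cart})$ of solutions on $\mathcal G$, formed with respect to the given (composite) morphism $\mathrm{Sol}^{\mathcal D}\subset\mathrm{Conf}^{\mathcal D}\to\mathrm{Fix}^{\mathcal D}$, is the presheaf classified by the composite left fibration $$\mathrm{BSYM}^{\mathrm{rev}}_\phi(\mathcal G)\times_{\int\mathrm{Fix}^{\mathcal D[\mathcal G]}}\int\mathrm{Sol}^{\mathcal D[\mathcal G]}\to \mathrm{BSYM}^{\mathrm{rev}}_\phi(\mathcal G)\to N\mathrm{Cart}^{\mathrm{op}}.$$ It is the $\infty$-categorical quotient of the presheaf of solutions on $\mathcal G$ by the smooth $\infty$-group of symmetries of $\mathcal G$ covering the $\Gamma$-action. $\mathrm{Mdl}_\Phi(\mathcal G_0)$ uses $\mathrm{Fix}_0^{\mathcal D}$, and $\mathrm{Mdl}_\Phi(\mathcal G_1)$ uses $\mathrm{Fix}_1^{\mathcal D}$ with the same $\mathrm{Sol}^{\mathcal D}\subset \mathrm{Conf}^{\mathcal D}$. *)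

theory Defs
  imports "HOL-Analysis.Analysis"
begin

section \<open>Smooth manifolds\<close>

text \<open>
  \<open>ck k n U f\<close>: \<open>f\<close> is \<open>k\<close> times continuously differentiable on the open subset \<open>U\<close> of
  \<open>Euclidean_space n\<close>, i.e. all partial derivatives of order at most \<open>k\<close> exist and are
  continuous on \<open>U\<close>. The library models n-dimensional space as the functions \<open>nat \<Rightarrow> real\<close>
  vanishing from index n on.
\<close>

primrec ck :: "nat \<Rightarrow> nat \<Rightarrow> (nat \<Rightarrow> real) set \<Rightarrow> ((nat \<Rightarrow> real) \<Rightarrow> real) \<Rightarrow> bool" where
  "ck 0 n U f \<longleftrightarrow> continuous_map (subtopology (Euclidean_space n) U) euclideanreal f"
| "ck (Suc k) n U f \<longleftrightarrow>
     continuous_map (subtopology (Euclidean_space n) U) euclideanreal f \<and>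
     (\<forall>i<n. \<exists>g. (\<forall>x\<in>U. ((\<lambda>t. f (x(i := t))) has_real_derivative g x) (at (x i))) \<and> ck k n U g)"

definition smooth_eucl ::
    "nat \<Rightarrow> nat \<Rightarrow> (nat \<Rightarrow> real) set \<Rightarrow> ((nat \<Rightarrow> real) \<Rightarrow> nat \<Rightarrow> real) \<Rightarrow> bool" where
  "smooth_eucl m n U f \<longleftrightarrow> (\<forall>j<n. \<forall>k. ck k m U (\<lambda>x. f x j))"

text \<open>A manifold is given by its topology, its dimension and a smooth atlas; charts are pairs of a
  domain and a coordinate map. Atlases are not required to be maximal.\<close>

record 'a mfd =
  mtop :: "'a topology"
  mdim :: nat
  matlas :: "('a set \<times> ('a \<Rightarrow> nat \<Rightarrow> real)) set"

abbreviation pts :: "'a mfd \<Rightarrow> 'a set" where "pts M \<equiv> topspace (mtop M)"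

definition is_chart :: "'a topology \<Rightarrow> nat \<Rightarrow> 'a set \<times> ('a \<Rightarrow> nat \<Rightarrow> real) \<Rightarrow> bool" where
  "is_chart X n c \<longleftrightarrow> (case c of (U, h) \<Rightarrow>
     openin X U \<and> openin (Euclidean_space n) (h ` U) \<and>
     homeomorphic_map (subtopology X U) (subtopology (Euclidean_space n) (h ` U)) h)"

definition smooth_manifold :: "'a mfd \<Rightarrow> bool" where
  "smooth_manifold M \<longleftrightarrow>
     Hausdorff_space (mtop M) \<and> second_countable (mtop M) \<and>
     (\<forall>c\<in>matlas M. is_chart (mtop M) (mdim M) c) \<and>
     (\<Union>(U, h)\<in>matlas M. U) = pts M \<and>
     (\<forall>(U, h)\<in>matlas M. \<forall>(V, k)\<in>matlas M.
        smooth_eucl (mdim M) (mdim M) (h ` (U \<inter> V)) (\<lambda>y. k (inv_into U h y)))"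

definition smooth_map :: "'a mfd \<Rightarrow> 'b mfd \<Rightarrow> ('a \<Rightarrow> 'b) \<Rightarrow> bool" where
  "smooth_map M N f \<longleftrightarrow>
     continuous_map (mtop M) (mtop N) f \<and>
     (\<forall>(U, h)\<in>matlas M. \<forall>(V, k)\<in>matlas N.
        smooth_eucl (mdim M) (mdim N) (h ` (U \<inter> f -` V)) (\<lambda>y. k (f (inv_into U h y))))"

definition diffeo :: "'a mfd \<Rightarrow> 'b mfd \<Rightarrow> ('a \<Rightarrow> 'b) \<Rightarrow> bool" where
  "diffeo M N f \<longleftrightarrow>
     bij_betw f (pts M) (pts N) \<and> smooth_map M N f \<and> smooth_map N M (inv_into (pts M) f)"

definition diffeomorphic :: "'a mfd \<Rightarrow> 'b mfd \<Rightarrow> bool" where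
  "diffeomorphic M N \<longleftrightarrow> (\<exists>f. diffeo M N f)"

definition eucl_mfd :: "nat \<Rightarrow> (nat \<Rightarrow> real) mfd" where
  "eucl_mfd n = \<lparr>mtop = Euclidean_space n, mdim = n,
     matlas = {(topspace (Euclidean_space n), \<lambda>x. x)}\<rparr>"

definition prod_mfd :: "'a mfd \<Rightarrow> 'b mfd \<Rightarrow> ('a \<times> 'b) mfd" where
  "prod_mfd M N = \<lparr>mtop = prod_topology (mtop M) (mtop N), mdim = mdim M + mdim N,
     matlas = {(U \<times> V, \<lambda>(x, y) i. if i < mdim M then h x i else k y (i - mdim M)) | U h V k.
                (U, h) \<in> matlas M \<and> (V, k) \<in> matlas N}\<rparr>"

section \<open>Categories, Cart, and families of diffeomorphisms\<close>

record ('o, 'a) cat =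
  cObj :: "'o set"
  cArr :: "'a set"
  cDom :: "'a \<Rightarrow> 'o"
  cCod :: "'a \<Rightarrow> 'o"
  cId :: "'o \<Rightarrow> 'a"
  cComp :: "'a \<Rightarrow> 'a \<Rightarrow> 'a"

definition op_cat :: "('o, 'a) cat \<Rightarrow> ('o, 'a) cat" where
  "op_cat C = \<lparr>cObj = cObj C, cArr = cArr C, cDom = cCod C, cCod = cDom C, cId = cId C,
     cComp = (\<lambda>g f. cComp C f g)\<rparr>"

text \<open>The objects of Cart are the manifolds with points in a fixed but arbitrary type \<open>'u\<close>. Maps are
  extensional functions, so that arrows are equal iff they agree on their domain.\<close>

type_synonym 'u cart_arr = "'u mfd \<times> ('u \<Rightarrow> 'u) \<times> 'u mfd"

definition cart_obj :: "'u mfd set" where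
  "cart_obj = {c. smooth_manifold c \<and> (\<exists>m. diffeomorphic c (eucl_mfd m))}"

definition cart :: "('u mfd, 'u cart_arr) cat" where
  "cart = \<lparr>cObj = cart_obj,
     cArr = {(c, f, d). c \<in> cart_obj \<and> d \<in> cart_obj \<and> f \<in> extensional (pts c) \<and> smooth_map c d f},
     cDom = fst, cCod = (\<lambda>(c, f, d). d), cId = (\<lambda>c. (c, \<lambda>x\<in>pts c. x, c)),
     cComp = (\<lambda>(d', g, e) (c, f, d). (c, compose (pts c) g f, e))\<rparr>"

type_synonym ('u, 'm) fam = "'u \<Rightarrow> 'm \<Rightarrow> 'm"

definition diff_fam :: "'m mfd \<Rightarrow> 'u mfd \<Rightarrow> ('u, 'm) fam set" where
  "diff_fam M c = {\<phi>. \<phi> \<in> extensional (pts c) \<and>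
     (\<forall>x\<in>pts c. \<phi> x \<in> extensional (pts M) \<and> diffeo M M (\<phi> x)) \<and>
     diffeo (prod_mfd c M) (prod_mfd c M) (\<lambda>(x, z). (x, \<phi> x z))}"

definition fam_id :: "'m mfd \<Rightarrow> 'u mfd \<Rightarrow> ('u, 'm) fam" where
  "fam_id M c = (\<lambda>x\<in>pts c. \<lambda>z\<in>pts M. z)"

definition fam_comp :: "'m mfd \<Rightarrow> 'u mfd \<Rightarrow> ('u, 'm) fam \<Rightarrow> ('u, 'm) fam \<Rightarrow> ('u, 'm) fam" where
  "fam_comp M c \<psi> \<phi> = (\<lambda>x\<in>pts c. compose (pts M) (\<psi> x) (\<phi> x))"

definition fam_pull :: "'u cart_arr \<Rightarrow> ('u, 'm) fam \<Rightarrow> ('u, 'm) fam" where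
  "fam_pull = (\<lambda>(c, f, d) \<phi>. \<lambda>x\<in>pts c. \<phi> (f x))"

text \<open>\<open>bdiff M D\<close> for \<open>D c\<close> a set of families over \<open>c\<close>; the full category \<open>B\<D>\<close> is the case
  \<open>D = diff_fam M\<close>.\<close>

type_synonym ('u, 'm) bd_arr = "'u mfd \<times> (('u \<Rightarrow> 'u) \<times> ('u, 'm) fam) \<times> 'u mfd"

definition bdiff :: "'m mfd \<Rightarrow> ('u mfd \<Rightarrow> ('u, 'm) fam set) \<Rightarrow> ('u mfd, ('u, 'm) bd_arr) cat" where
  "bdiff M D = \<lparr>cObj = cart_obj,
     cArr = {(c, (f, \<phi>), d). (c, f, d) \<in> cArr cart \<and> \<phi> \<in> D c},
     cDom = fst, cCod = (\<lambda>(c, f, d). d),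
     cId = (\<lambda>c. (c, (\<lambda>x\<in>pts c. x, fam_id M c), c)),
     cComp = (\<lambda>(d', (g, \<psi>), e) (c, (f, \<phi>), d).
       (c, (compose (pts c) g f, \<lambda>x\<in>pts c. compose (pts M) (\<psi> (f x)) (\<phi> x)), e))\<rparr>"

definition bd_proj :: "('u, 'm) bd_arr \<Rightarrow> 'u cart_arr" where
  "bd_proj = (\<lambda>(c, (f, \<phi>), d). (c, f, d))"

section \<open>Simplicial sets\<close>

text \<open>A monotone map from [m] to [n] is the list of its m+1 values.\<close>

definition dmaps :: "nat \<Rightarrow> nat \<Rightarrow> nat list set" where
  "dmaps m n = {\<alpha>. length \<alpha> = Suc m \<and> sorted \<alpha> \<and> set \<alpha> \<subseteq> {..n}}"

definition dcomp :: "nat list \<Rightarrow> nat list \<Rightarrow> nat list" where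
  "dcomp \<alpha> \<beta> = map (\<lambda>i. \<alpha> ! i) \<beta>"

definition did :: "nat \<Rightarrow> nat list" where "did n = [0..<Suc n]"

abbreviation cst :: "nat \<Rightarrow> nat \<Rightarrow> nat list" where "cst n k \<equiv> replicate (Suc n) k"

text \<open>\<open>sact X n \<alpha>\<close> is the operator from \<open>sx X n\<close> to \<open>sx X m\<close> induced by \<open>\<alpha> \<in> dmaps m n\<close>.\<close>

record 'a sset =
  sx :: "nat \<Rightarrow> 'a set"
  sact :: "nat \<Rightarrow> nat list \<Rightarrow> 'a \<Rightarrow> 'a"

definition is_sset :: "'a sset \<Rightarrow> bool" where
  "is_sset X \<longleftrightarrow>
     (\<forall>m n. \<forall>\<alpha>\<in>dmaps m n. \<forall>x\<in>sx X n. sact X n \<alpha> x \<in> sx X m) \<and>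
     (\<forall>n. \<forall>x\<in>sx X n. sact X n (did n) x = x) \<and>
     (\<forall>k m n. \<forall>\<alpha>\<in>dmaps m n. \<forall>\<beta>\<in>dmaps k m. \<forall>x\<in>sx X n.
        sact X m \<beta> (sact X n \<alpha> x) = sact X n (dcomp \<alpha> \<beta>) x)"

definition simp_map :: "'a sset \<Rightarrow> 'b sset \<Rightarrow> (nat \<Rightarrow> 'a \<Rightarrow> 'b) \<Rightarrow> bool" where
  "simp_map X Y f \<longleftrightarrow>
     (\<forall>n. \<forall>x\<in>sx X n. f n x \<in> sx Y n) \<and>
     (\<forall>m n. \<forall>\<alpha>\<in>dmaps m n. \<forall>x\<in>sx X n. f m (sact X n \<alpha> x) = sact Y n \<alpha> (f n x))"

definition std_simplex :: "nat \<Rightarrow> nat list sset" where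
  "std_simplex n = \<lparr>sx = (\<lambda>m. dmaps m n), sact = (\<lambda>m \<alpha> \<beta>. dcomp \<beta> \<alpha>)\<rparr>"

definition horn :: "nat \<Rightarrow> nat \<Rightarrow> nat list sset" where
  "horn n k = \<lparr>sx = (\<lambda>m. {\<beta>\<in>dmaps m n. \<exists>j\<le>n. j \<noteq> k \<and> j \<notin> set \<beta>}), sact = (\<lambda>m \<alpha> \<beta>. dcomp \<beta> \<alpha>)\<rparr>"

definition bdry :: "nat \<Rightarrow> nat list sset" where
  "bdry n = \<lparr>sx = (\<lambda>m. {\<beta>\<in>dmaps m n. \<exists>j\<le>n. j \<notin> set \<beta>}), sact = (\<lambda>m \<alpha> \<beta>. dcomp \<beta> \<alpha>)\<rparr>"

definition prod_sset :: "'a sset \<Rightarrow> 'b sset \<Rightarrow> ('a \<times> 'b) sset" where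
  "prod_sset X Y = \<lparr>sx = (\<lambda>n. sx X n \<times> sx Y n), sact = (\<lambda>n \<alpha> (x, y). (sact X n \<alpha> x, sact Y n \<alpha> y))\<rparr>"

definition pullback ::
    "'a sset \<Rightarrow> 'b sset \<Rightarrow> (nat \<Rightarrow> 'a \<Rightarrow> 'c) \<Rightarrow> (nat \<Rightarrow> 'b \<Rightarrow> 'c) \<Rightarrow> ('a \<times> 'b) sset" where
  "pullback X Y f g = \<lparr>sx = (\<lambda>n. {(x, y). x \<in> sx X n \<and> y \<in> sx Y n \<and> f n x = g n y}),
     sact = sact (prod_sset X Y)\<rparr>"

text \<open>The full simplicial subset spanned by a set \<open>V\<close> of vertices.\<close>

definition full_sub :: "'a sset \<Rightarrow> 'a set \<Rightarrow> 'a sset" where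
  "full_sub X V = \<lparr>sx = (\<lambda>n. {x\<in>sx X n. \<forall>i\<le>n. sact X n [i] x \<in> V}), sact = sact X\<rparr>"

text \<open>Right lifting against a horn inclusion; the base simplex \<open>y\<close> stands for a map out of
  \<open>std_simplex n\<close>.\<close>

definition horn_lift :: "nat \<Rightarrow> nat \<Rightarrow> 'a sset \<Rightarrow> 'b sset \<Rightarrow> (nat \<Rightarrow> 'a \<Rightarrow> 'b) \<Rightarrow> bool" where
  "horn_lift n k X Y p \<longleftrightarrow>
     (\<forall>u. \<forall>y\<in>sx Y n.
        simp_map (horn n k) X u \<and> (\<forall>m. \<forall>\<beta>\<in>sx (horn n k) m. p m (u m \<beta>) = sact Y n \<beta> y) \<longrightarrow>
        (\<exists>x\<in>sx X n. p n x = y \<and> (\<forall>m. \<forall>\<beta>\<in>sx (horn n k) m. sact X n \<beta> x = u m \<beta>)))"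

definition left_fibration :: "'a sset \<Rightarrow> 'b sset \<Rightarrow> (nat \<Rightarrow> 'a \<Rightarrow> 'b) \<Rightarrow> bool" where
  "left_fibration X Y p \<longleftrightarrow> is_sset X \<and> is_sset Y \<and> simp_map X Y p \<and>
     (\<forall>n k. k < n \<longrightarrow> horn_lift n k X Y p)"

definition kan_fibration :: "'a sset \<Rightarrow> 'b sset \<Rightarrow> (nat \<Rightarrow> 'a \<Rightarrow> 'b) \<Rightarrow> bool" where
  "kan_fibration X Y p \<longleftrightarrow> is_sset X \<and> is_sset Y \<and> simp_map X Y p \<and>
     (\<forall>n k. 1 \<le> n \<and> k \<le> n \<longrightarrow> horn_lift n k X Y p)"

definition kan_complex :: "'a sset \<Rightarrow> bool" where
  "kan_complex X \<longleftrightarrow> kan_fibration X (std_simplex 0) (\<lambda>n x. cst n 0)"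

text \<open>\<open>conn X\<close>: lying in the same connected component, the equivalence relation on vertices
  generated by the edges.\<close>

definition edge_rel :: "'a sset \<Rightarrow> ('a \<times> 'a) set" where
  "edge_rel X = {(sact X 1 [0] e, sact X 1 [1] e) | e. e \<in> sx X 1}"

definition conn :: "'a sset \<Rightarrow> ('a \<times> 'a) set" where
  "conn X = (edge_rel X \<union> (edge_rel X)\<inverse>)\<^sup>* \<inter> sx X 0 \<times> sx X 0"

definition pi0 :: "'a sset \<Rightarrow> 'a set set" where
  "pi0 X = sx X 0 // conn X"

definition pi0_map :: "'b sset \<Rightarrow> (nat \<Rightarrow> 'a \<Rightarrow> 'b) \<Rightarrow> 'a set \<Rightarrow> 'b set" where
  "pi0_map Y f A = conn Y `` (f 0 ` A)"

definition union_of_components :: "'a sset \<Rightarrow> 'a sset \<Rightarrow> bool" where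
  "union_of_components S X \<longleftrightarrow>
     (\<exists>\<C> \<subseteq> pi0 X. \<forall>n. sx S n = {x\<in>sx X n. \<exists>A\<in>\<C>. \<forall>i\<le>n. sact X n [i] x \<in> A}) \<and>
     (\<forall>m n. \<forall>\<alpha>\<in>dmaps m n. \<forall>x\<in>sx S n. sact S n \<alpha> x = sact X n \<alpha> x)"

section \<open>Simplicial presheaves\<close>

record ('o, 'a, 'x) psh =
  pob :: "'o \<Rightarrow> 'x sset"
  pmap :: "'a \<Rightarrow> nat \<Rightarrow> 'x \<Rightarrow> 'x"

definition simplicial_presheaf :: "('o, 'a) cat \<Rightarrow> ('o, 'a, 'x) psh \<Rightarrow> bool" where
  "simplicial_presheaf C F \<longleftrightarrow>
     (\<forall>c\<in>cObj C. is_sset (pob F c)) \<and>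
     (\<forall>u\<in>cArr C. simp_map (pob F (cCod C u)) (pob F (cDom C u)) (pmap F u)) \<and>
     (\<forall>c\<in>cObj C. \<forall>n. \<forall>x\<in>sx (pob F c) n. pmap F (cId C c) n x = x) \<and>
     (\<forall>u\<in>cArr C. \<forall>v\<in>cArr C. cCod C u = cDom C v \<longrightarrow>
        (\<forall>n. \<forall>x\<in>sx (pob F (cCod C v)) n.
           pmap F (cComp C v u) n x = pmap F u n (pmap F v n x)))"

definition presheaf_map ::
    "('o, 'a) cat \<Rightarrow> ('o, 'a, 'x) psh \<Rightarrow> ('o, 'a, 'y) psh \<Rightarrow> ('o \<Rightarrow> nat \<Rightarrow> 'x \<Rightarrow> 'y) \<Rightarrow> bool" where
  "presheaf_map C F G t \<longleftrightarrow>
     (\<forall>c\<in>cObj C. simp_map (pob F c) (pob G c) (t c)) \<and>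
     (\<forall>u\<in>cArr C. \<forall>n. \<forall>x\<in>sx (pob F (cCod C u)) n.
        t (cDom C u) n (pmap F u n x) = pmap G u n (t (cCod C u) n x))"

definition proj_fibrant :: "('o, 'a) cat \<Rightarrow> ('o, 'a, 'x) psh \<Rightarrow> bool" where
  "proj_fibrant C F \<longleftrightarrow> simplicial_presheaf C F \<and> (\<forall>c\<in>cObj C. kan_complex (pob F c))"

definition proj_fibration ::
    "('o, 'a) cat \<Rightarrow> ('o, 'a, 'x) psh \<Rightarrow> ('o, 'a, 'y) psh \<Rightarrow> ('o \<Rightarrow> nat \<Rightarrow> 'x \<Rightarrow> 'y) \<Rightarrow> bool" where
  "proj_fibration C F G t \<longleftrightarrow> presheaf_map C F G t \<and>
     (\<forall>c\<in>cObj C. kan_fibration (pob F c) (pob G c) (t c))"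

definition zero_connected ::
    "('o, 'a) cat \<Rightarrow> ('o, 'a, 'x) psh \<Rightarrow> ('o, 'a, 'y) psh \<Rightarrow> ('o \<Rightarrow> nat \<Rightarrow> 'x \<Rightarrow> 'y) \<Rightarrow> bool" where
  "zero_connected C F G t \<longleftrightarrow>
     (\<forall>c\<in>cObj C. bij_betw (pi0_map (pob G c) (t c)) (pi0 (pob F c)) (pi0 (pob G c)))"

definition solution_subpresheaf ::
    "('o, 'a) cat \<Rightarrow> ('o, 'a, 'x) psh \<Rightarrow> ('o, 'a, 'x) psh \<Rightarrow> bool" where
  "solution_subpresheaf C S F \<longleftrightarrow> simplicial_presheaf C S \<and>
     (\<forall>c\<in>cObj C. union_of_components (pob S c) (pob F c)) \<and>
     (\<forall>u\<in>cArr C. \<forall>n. \<forall>x\<in>sx (pob S (cCod C u)) n. pmap S u n x = pmap F u n x)"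

section \<open>Nerves and unstraightening\<close>

text \<open>An n-simplex of the nerve is a functor from the poset [n], given by its arrows
  \<open>\<sigma> i j\<close> for \<open>i \<le> j \<le> n\<close>, and undefined elsewhere.\<close>

definition ob :: "('o, 'a) cat \<Rightarrow> (nat \<Rightarrow> nat \<Rightarrow> 'a) \<Rightarrow> nat \<Rightarrow> 'o" where
  "ob C \<sigma> i = cDom C (\<sigma> i i)"

definition tri :: "nat \<Rightarrow> (nat \<Rightarrow> nat \<Rightarrow> 'a) \<Rightarrow> nat \<Rightarrow> nat \<Rightarrow> 'a" where
  "tri n s = (\<lambda>i j. if i \<le> j \<and> j \<le> n then s i j else undefined)"

definition nerve_act :: "nat list \<Rightarrow> (nat \<Rightarrow> nat \<Rightarrow> 'a) \<Rightarrow> nat \<Rightarrow> nat \<Rightarrow> 'a" where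
  "nerve_act \<alpha> \<sigma> = tri (length \<alpha> - 1) (\<lambda>i j. \<sigma> (\<alpha> ! i) (\<alpha> ! j))"

definition nerve :: "('o, 'a) cat \<Rightarrow> (nat \<Rightarrow> nat \<Rightarrow> 'a) sset" where
  "nerve C = \<lparr>sx = (\<lambda>n. {\<sigma>.
       tri n \<sigma> = \<sigma> \<and>
       (\<forall>i\<le>n. ob C \<sigma> i \<in> cObj C \<and> \<sigma> i i = cId C (ob C \<sigma> i)) \<and>
       (\<forall>i j. i \<le> j \<and> j \<le> n \<longrightarrow>
          \<sigma> i j \<in> cArr C \<and> cDom C (\<sigma> i j) = ob C \<sigma> i \<and> cCod C (\<sigma> i j) = ob C \<sigma> j) \<and>
       (\<forall>i j k. i \<le> j \<and> j \<le> k \<and> k \<le> n \<longrightarrow> \<sigma> i k = cComp C (\<sigma> j k) (\<sigma> i j))}),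
     sact = (\<lambda>n. nerve_act)\<rparr>"

definition nerve_map :: "('a \<Rightarrow> 'b) \<Rightarrow> nat \<Rightarrow> (nat \<Rightarrow> nat \<Rightarrow> 'a) \<Rightarrow> nat \<Rightarrow> nat \<Rightarrow> 'b" where
  "nerve_map g n \<sigma> = tri n (\<lambda>i j. g (\<sigma> i j))"

text \<open>
  \<open>unstr C F\<close> is the left fibration over the nerve of the \<^emph>\<open>opposite\<close> of \<open>C\<close> associated with the
  presheaf \<open>F\<close>, in the form of the relative nerve (Lurie, HTT 3.2.5; the right adjoint of
  Heuts and Moerdijk's rectification functor). An n-simplex over
  \<open>c\<^sub>0 \<rightarrow> \<dots> \<rightarrow> c\<^sub>n\<close> in the opposite category is a list of simplices \<open>x\<^sub>j \<in> F(c\<^sub>j)\<^sub>j\<close>, such that the face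
  of \<open>x\<^sub>j\<close> on the vertices 0,...,i is the image of \<open>x\<^sub>i\<close> for all \<open>i \<le> j\<close>; the simplices
  \<open>\<tau>\<^sub>J\<close> of HTT for other subsets J are determined as faces of these.
\<close>

type_synonym ('a, 'x) un = "(nat \<Rightarrow> nat \<Rightarrow> 'a) \<times> 'x list"

definition unstr :: "('o, 'a) cat \<Rightarrow> ('o, 'a, 'x) psh \<Rightarrow> ('a, 'x) un sset" where
  "unstr C F = \<lparr>sx = (\<lambda>n. {(\<sigma>, xs).
       \<sigma> \<in> sx (nerve (op_cat C)) n \<and> length xs = Suc n \<and>
       (\<forall>i\<le>n. xs ! i \<in> sx (pob F (ob (op_cat C) \<sigma> i)) i) \<and>
       (\<forall>i j. i \<le> j \<and> j \<le> n \<longrightarrow>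
          sact (pob F (ob (op_cat C) \<sigma> j)) j (did i) (xs ! j) = pmap F (\<sigma> i j) i (xs ! i))}),
     sact = (\<lambda>n \<alpha> (\<sigma>, xs). (nerve_act \<alpha> \<sigma>,
       map (\<lambda>k. sact (pob F (ob (op_cat C) \<sigma> (\<alpha> ! k))) (\<alpha> ! k) (take (Suc k) \<alpha>) (xs ! (\<alpha> ! k)))
           [0..<length \<alpha>]))\<rparr>"

definition unstr_map ::
    "('o, 'a) cat \<Rightarrow> ('o \<Rightarrow> nat \<Rightarrow> 'x \<Rightarrow> 'y) \<Rightarrow> nat \<Rightarrow> ('a, 'x) un \<Rightarrow> ('a, 'y) un" where
  "unstr_map C t n = (\<lambda>(\<sigma>, xs).
     (\<sigma>, map (\<lambda>i. t (ob (op_cat C) \<sigma> i) i (xs ! i)) [0..<length xs]))"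

section \<open>Quasi-categories: functors, joins, limits, colimits, equivalences\<close>

definition Fun :: "'k sset \<Rightarrow> 'x sset \<Rightarrow> (nat \<Rightarrow> nat list \<times> 'k \<Rightarrow> 'x) sset" where
  "Fun K X = \<lparr>sx = (\<lambda>n. {h. simp_map (prod_sset (std_simplex n) K) X h \<and>
       (\<forall>m z. z \<notin> sx (prod_sset (std_simplex n) K) m \<longrightarrow> h m z = undefined)}),
     sact = (\<lambda>n \<alpha> h m z. if z \<in> sx (prod_sset (std_simplex (length \<alpha> - 1)) K) m
       then h m (dcomp \<alpha> (fst z), snd z) else undefined)\<rparr>"

text \<open>The map from \<open>K\<close> to \<open>X\<close> corresponding to a vertex of \<open>Fun K X\<close>.\<close>

definition vmap :: "(nat \<Rightarrow> nat list \<times> 'k \<Rightarrow> 'x) \<Rightarrow> nat \<Rightarrow> 'k \<Rightarrow> 'x" where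
  "vmap h n k = h n (cst n 0, k)"

definition equivalence :: "'x sset \<Rightarrow> 'x \<Rightarrow> bool" where
  "equivalence X f \<longleftrightarrow> f \<in> sx X 1 \<and>
     (\<exists>g\<in>sx X 1. \<exists>s\<in>sx X 2. \<exists>t\<in>sx X 2.
        sact X 2 [0,1] s = f \<and> sact X 2 [1,2] s = g \<and> sact X 2 [0,2] s = sact X 1 [0,0] f \<and>
        sact X 2 [0,1] t = g \<and> sact X 2 [1,2] t = f \<and> sact X 2 [0,2] t = sact X 1 [1,1] f)"

text \<open>\<open>JLR i x y\<close> is the join of an i-simplex \<open>x\<close> of the left factor with a simplex \<open>y\<close> of
  the right factor.\<close>

datatype ('a, 'b) join = JL 'a | JR 'b | JLR nat 'a 'b

definition join_sset :: "'a sset \<Rightarrow> 'b sset \<Rightarrow> ('a, 'b) join sset" where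
  "join_sset K L = \<lparr>sx = (\<lambda>n. JL ` sx K n \<union> JR ` sx L n \<union>
       {JLR i x y | i x y. i < n \<and> x \<in> sx K i \<and> y \<in> sx L (n - Suc i)}),
     sact = (\<lambda>n \<alpha> t. case t of
         JL x \<Rightarrow> JL (sact K n \<alpha> x)
       | JR y \<Rightarrow> JR (sact L n \<alpha> y)
       | JLR i x y \<Rightarrow>
           (let a = filter (\<lambda>j. j \<le> i) \<alpha>; b = map (\<lambda>j. j - Suc i) (filter (\<lambda>j. i < j) \<alpha>) in
            if b = [] then JL (sact K i a x)
            else if a = [] then JR (sact L (n - Suc i) b y)
            else JLR (length a - 1) (sact K i a x) (sact L (n - Suc i) b y)))\<rparr>"

definition final_obj :: "'x sset \<Rightarrow> 'x \<Rightarrow> bool" where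
  "final_obj X x \<longleftrightarrow> x \<in> sx X 0 \<and>
     (\<forall>n\<ge>1. \<forall>u. simp_map (bdry n) X u \<and> u 0 [n] = x \<longrightarrow>
        (\<exists>y\<in>sx X n. \<forall>m. \<forall>\<beta>\<in>sx (bdry n) m. sact X n \<beta> y = u m \<beta>))"

text \<open>Limit cones are final objects of the slice over the diagram, colimit cocones initial
  objects of the slice under it, spelled out by adjunction between joins and slices.\<close>

definition limit_cone :: "'k sset \<Rightarrow> 'x sset \<Rightarrow> (nat \<Rightarrow> (nat list, 'k) join \<Rightarrow> 'x) \<Rightarrow> bool" where
  "limit_cone K X p \<longleftrightarrow> simp_map (join_sset (std_simplex 0) K) X p \<and>
     (\<forall>n\<ge>1. \<forall>u. simp_map (join_sset (bdry n) K) X u \<and>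
        (\<forall>m. \<forall>t\<in>sx (join_sset (std_simplex 0) K) m.
           u m (map_join (map (\<lambda>_. n)) (\<lambda>k. k) t) = p m t) \<longrightarrow>
        (\<exists>v. simp_map (join_sset (std_simplex n) K) X v \<and>
           (\<forall>m. \<forall>t\<in>sx (join_sset (bdry n) K) m. v m t = u m t)))"

definition colimit_cocone :: "'k sset \<Rightarrow> 'x sset \<Rightarrow> (nat \<Rightarrow> ('k, nat list) join \<Rightarrow> 'x) \<Rightarrow> bool" where
  "colimit_cocone K X p \<longleftrightarrow> simp_map (join_sset K (std_simplex 0)) X p \<and>
     (\<forall>n\<ge>1. \<forall>u. simp_map (join_sset K (bdry n)) X u \<and>
        (\<forall>m. \<forall>t\<in>sx (join_sset K (std_simplex 0)) m. u m t = p m t) \<longrightarrow>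
        (\<exists>v. simp_map (join_sset K (std_simplex n)) X v \<and>
           (\<forall>m. \<forall>t\<in>sx (join_sset K (bdry n)) m. v m t = u m t)))"

section \<open>Group objects\<close>

type_synonym delta_arr = "nat \<times> nat list \<times> nat"

definition delta :: "(nat, delta_arr) cat" where
  "delta = \<lparr>cObj = UNIV, cArr = {(m, \<alpha>, n). \<alpha> \<in> dmaps m n}, cDom = fst, cCod = (\<lambda>(m, \<alpha>, n). n),
     cId = (\<lambda>n. (n, did n, n)), cComp = (\<lambda>(n', \<beta>, p) (m, \<alpha>, n). (m, dcomp \<beta> \<alpha>, p))\<rparr>"

type_synonym delta_nerve = "nat \<Rightarrow> nat \<Rightarrow> delta_arr"

abbreviation NDop :: "delta_nerve sset" where "NDop \<equiv> nerve (op_cat delta)"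

text \<open>The inclusion of \<open>B\<close> into \<open>A\<close>, for nonempty finite \<open>B \<subseteq> A\<close>, as an arrow of \<open>delta\<close>.\<close>

definition incl_arr :: "nat set \<Rightarrow> nat set \<Rightarrow> delta_arr" where
  "incl_arr A B = (card B - 1, map (\<lambda>b. card {a\<in>A. a < b}) (sorted_list_of_set B), card A - 1)"

text \<open>The cone over the cospan \<open>horn 2 2\<close> in the opposite of \<open>delta\<close> with cone point \<open>A\<close> and with
  the sets \<open>S\<close>, \<open>T\<close>, \<open>S \<inter> T\<close> at the vertices 0, 1, 2 of the cospan.\<close>

definition segal_cone ::
    "nat set \<Rightarrow> nat set \<Rightarrow> nat set \<Rightarrow> nat \<Rightarrow> (nat list, nat list) join \<Rightarrow> delta_nerve" where
  "segal_cone A S T m t =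
     (let f = (\<lambda>i::nat. if i = 0 then S else if i = 1 then T else S \<inter> T);
          vs = (case t of JL \<beta> \<Rightarrow> map (\<lambda>_. A) \<beta> | JR \<gamma> \<Rightarrow> map f \<gamma>
                | JLR i \<beta> \<gamma> \<Rightarrow> map (\<lambda>_. A) \<beta> @ map f \<gamma>)
      in tri m (\<lambda>i j. incl_arr (vs ! i) (vs ! j)))"

text \<open>HTT 6.1.2.7 with condition 6.1.2.6 (4''), and HTT 7.2.2.1.\<close>

definition group_object :: "'x sset \<Rightarrow> (nat \<Rightarrow> delta_nerve \<Rightarrow> 'x) \<Rightarrow> bool" where
  "group_object X U \<longleftrightarrow> simp_map NDop X U \<and>
     final_obj X (U 0 (tri 0 (\<lambda>i j. cId delta 0))) \<and>
     (\<forall>n S T s. S \<union> T = {..n} \<and> S \<inter> T = {s} \<longrightarrow>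
        limit_cone (horn 2 2) X (\<lambda>m t. U m (segal_cone {..n} S T m t)))"

definition delta_rev :: "delta_arr \<Rightarrow> delta_arr" where
  "delta_rev = (\<lambda>(m, \<alpha>, n). (m, map (\<lambda>i. n - i) (rev \<alpha>), n))"

section \<open>Spaces, presheaves of spaces, and classified left fibrations\<close>

text \<open>
  The quasi-category of spaces in the form of Cisinski (Higher Categories and Homotopical Algebra,
  5.2.3): an n-simplex is a left fibration over \<open>std_simplex n\<close> with fibres in the universe \<open>'s\<close> and
  with chosen pullbacks along all simplices \<open>\<alpha>\<close> of \<open>std_simplex n\<close>. The choice of pullbacks is
  encoded by giving, for each such \<open>\<alpha>\<close>, the set \<open>fst F \<alpha>\<close> of simplices over \<open>\<alpha>\<close>, and their
  restriction \<open>snd F \<alpha> \<beta>\<close> along \<open>\<beta>\<close>, landing in \<open>fst F (dcomp \<alpha> \<beta>)\<close>.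
\<close>

type_synonym 's spc = "(nat list \<Rightarrow> 's set) \<times> (nat list \<Rightarrow> nat list \<Rightarrow> 's \<Rightarrow> 's)"

definition dinto :: "nat \<Rightarrow> nat list set" where "dinto n = (\<Union>m. dmaps m n)"

definition spc_total :: "nat \<Rightarrow> 's spc \<Rightarrow> (nat list \<times> 's) sset" where
  "spc_total n F = \<lparr>sx = (\<lambda>m. {(\<alpha>, x). \<alpha> \<in> dmaps m n \<and> x \<in> fst F \<alpha>}),
     sact = (\<lambda>m \<beta> (\<alpha>, x). (dcomp \<alpha> \<beta>, snd F \<alpha> \<beta> x))\<rparr>"

definition spc_norm :: "nat \<Rightarrow> 's spc \<Rightarrow> 's spc" where
  "spc_norm n F = (\<lambda>\<alpha>. if \<alpha> \<in> dinto n then fst F \<alpha> else {},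
     \<lambda>\<alpha> \<beta> x. if \<alpha> \<in> dinto n \<and> x \<in> fst F \<alpha> \<and> \<beta> \<in> dinto (length \<alpha> - 1) then snd F \<alpha> \<beta> x
             else undefined)"

definition spaces :: "'s spc sset" where
  "spaces = \<lparr>sx = (\<lambda>n. {F. spc_norm n F = F \<and>
       left_fibration (spc_total n F) (std_simplex n) (\<lambda>m. fst)}),
     sact = (\<lambda>n \<gamma> F. spc_norm (length \<gamma> - 1)
       (\<lambda>\<alpha>. fst F (dcomp \<gamma> \<alpha>), \<lambda>\<alpha>. snd F (dcomp \<gamma> \<alpha>)))\<rparr>"

text \<open>The pullback of the universal left fibration along a map \<open>F\<close> from \<open>B\<close> to \<open>spaces\<close>.\<close>

definition el :: "'b sset \<Rightarrow> (nat \<Rightarrow> 'b \<Rightarrow> 's spc) \<Rightarrow> ('b \<times> 's) sset" where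
  "el B F = \<lparr>sx = (\<lambda>n. {(b, x). b \<in> sx B n \<and> x \<in> fst (F n b) (did n)}),
     sact = (\<lambda>n \<beta> (b, x). (sact B n \<beta> b, snd (F n b) (did n) \<beta> x))\<rparr>"

text \<open>\<open>F\<close> classifies the left fibration \<open>p\<close> from \<open>E\<close> to \<open>B\<close>, by means of the isomorphism \<open>e\<close> over \<open>B\<close>
  with the pullback of the universal left fibration.\<close>

definition classifies ::
    "'b sset \<Rightarrow> (nat \<Rightarrow> 'b \<Rightarrow> 's spc) \<Rightarrow> 'e sset \<Rightarrow> (nat \<Rightarrow> 'e \<Rightarrow> 'b) \<Rightarrow>
     (nat \<Rightarrow> 'e \<Rightarrow> 'b \<times> 's) \<Rightarrow> bool" where
  "classifies B F E p e \<longleftrightarrow> simp_map B spaces F \<and> left_fibration E B p \<and>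
     simp_map E (el B F) e \<and> (\<forall>n. bij_betw (e n) (sx E n) (sx (el B F) n)) \<and>
     (\<forall>n. \<forall>x\<in>sx E n. fst (e n x) = p n x)"

text \<open>An edge \<open>w\<close> of \<open>Fun B spaces\<close> classifies a left fibration over the product of \<open>std_simplex 1\<close>
  with \<open>B\<close>. It is presented by the map \<open>\<phi>\<close> from \<open>E0\<close> to \<open>E1\<close> over \<open>B\<close>, relative to identifications
  \<open>e0\<close> and \<open>e1\<close> of these with its ends, if \<open>\<phi>\<close> is a covariant transport: some map \<open>h\<close> out of
  the cylinder on \<open>E0\<close>, over the base, begins with \<open>e0\<close> and ends with \<open>e1 \<circ> \<phi>\<close>.\<close>

definition presents ::
    "'b sset \<Rightarrow> 'e sset \<Rightarrow> (nat \<Rightarrow> 'e \<Rightarrow> 'b) \<Rightarrow> (nat \<Rightarrow> 'e \<Rightarrow> 'b \<times> 's) \<Rightarrow>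
     'f sset \<Rightarrow> (nat \<Rightarrow> 'f \<Rightarrow> 'b) \<Rightarrow> (nat \<Rightarrow> 'f \<Rightarrow> 'b \<times> 's) \<Rightarrow>
     (nat \<Rightarrow> 'e \<Rightarrow> 'f) \<Rightarrow> (nat \<Rightarrow> nat list \<times> 'b \<Rightarrow> 's spc) \<Rightarrow> bool" where
  "presents B E0 p0 e0 E1 p1 e1 \<phi> w \<longleftrightarrow>
     simp_map E0 E1 \<phi> \<and> (\<forall>n. \<forall>x\<in>sx E0 n. p1 n (\<phi> n x) = p0 n x) \<and>
     (\<exists>h. simp_map (prod_sset (std_simplex 1) E0) (el (prod_sset (std_simplex 1) B) w) h \<and>
       (\<forall>n. \<forall>\<alpha>\<in>dmaps n 1. \<forall>x\<in>sx E0 n. fst (h n (\<alpha>, x)) = (\<alpha>, p0 n x)) \<and>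
       (\<forall>n. \<forall>x\<in>sx E0 n. snd (h n (cst n 0, x)) = snd (e0 n x) \<and>
                            snd (h n (cst n 1, x)) = snd (e1 n (\<phi> n x))))"

abbreviation NCop :: "(nat \<Rightarrow> nat \<Rightarrow> 'u cart_arr) sset" where "NCop \<equiv> nerve (op_cat cart)"

type_synonym 'u cart_nerve = "nat \<Rightarrow> nat \<Rightarrow> 'u cart_arr"
type_synonym ('u, 's) prestack = "nat \<Rightarrow> nat list \<times> 'u cart_nerve \<Rightarrow> 's spc"

text \<open>The quasi-category of presheaves of spaces on Cart.\<close>

abbreviation PCart :: "('u, 's) prestack sset" where "PCart \<equiv> Fun NCop spaces"

section \<open>Presheaves of diffeomorphism groups as smooth infinity-groups\<close>

text \<open>\<open>G\<^sub>c\<close>, the pullback of the vertex \<open>G\<close> of \<open>Fix(R\<^sup>0)\<close> to \<open>c\<close>, and the subpresheaf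
  \<open>Diff\<^bsub>[G]\<^esub>(M)\<close>; \<open>R0\<close> is a one-point manifold.\<close>

definition pull_const ::
    "'m mfd \<Rightarrow> 'u mfd \<Rightarrow> ('u mfd, ('u, 'm) bd_arr, 'x) psh \<Rightarrow> 'x \<Rightarrow> 'u mfd \<Rightarrow> 'x" where
  "pull_const M R0 Fix G c =
     pmap Fix (c, (\<lambda>x\<in>pts c. the_elem (pts R0), fam_id M c), R0) 0 G"

definition diff_stab ::
    "'m mfd \<Rightarrow> 'u mfd \<Rightarrow> ('u mfd, ('u, 'm) bd_arr, 'x) psh \<Rightarrow> 'x \<Rightarrow> 'u mfd \<Rightarrow> ('u, 'm) fam set" where
  "diff_stab M R0 Fix G c = {\<phi>\<in>diff_fam M c.
     (pmap Fix (c, (\<lambda>x\<in>pts c. x, \<phi>), c) 0 (pull_const M R0 Fix G c), pull_const M R0 Fix G c)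
       \<in> conn (pob Fix c)}"

text \<open>The one-object category of the group \<open>D c\<close>.\<close>

definition fam_cat :: "'m mfd \<Rightarrow> ('u mfd \<Rightarrow> ('u, 'm) fam set) \<Rightarrow> 'u mfd \<Rightarrow> ('u mfd, ('u, 'm) fam) cat" where
  "fam_cat M D c = \<lparr>cObj = {c}, cArr = D c, cDom = (\<lambda>_. c), cCod = (\<lambda>_. c),
     cId = (\<lambda>_. fam_id M c), cComp = fam_comp M c\<rparr>"

text \<open>A presheaf of groups \<open>D\<close> gives the presheaf of sets sending \<open>([k], c)\<close> to the k-simplices of the
  nerve of the one-object category of \<open>D c\<close>. \<open>bar M D r\<close> is the corresponding left
  fibration with discrete fibres over \<open>NDop \<times> NCop\<close>: an n-simplex is one of the base together with
  an element over its initial vertex. With \<open>r = id\<close> it is the group object \<open>D\<close>; with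
  \<open>r = delta_rev\<close> the operators are precomposed with order reversal and it is the opposite group.\<close>

type_synonym ('u, 'm) bar_simplex = "(delta_nerve \<times> 'u cart_nerve) \<times> (nat \<Rightarrow> nat \<Rightarrow> ('u, 'm) fam)"

definition bar ::
    "'m mfd \<Rightarrow> ('u mfd \<Rightarrow> ('u, 'm) fam set) \<Rightarrow> (delta_arr \<Rightarrow> delta_arr) \<Rightarrow> ('u, 'm) bar_simplex sset" where
  "bar M D r = \<lparr>sx = (\<lambda>n. {((\<delta>, \<kappa>), d). \<delta> \<in> sx NDop n \<and> \<kappa> \<in> sx NCop n \<and>
       d \<in> sx (nerve (fam_cat M D (ob (op_cat cart) \<kappa> 0))) (ob (op_cat delta) \<delta> 0)}),
     sact = (\<lambda>n \<alpha> ((\<delta>, \<kappa>), d). ((nerve_act \<alpha> \<delta>, nerve_act \<alpha> \<kappa>),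
       nerve_map (fam_pull (\<kappa> 0 (\<alpha> ! 0))) (ob (op_cat delta) \<delta> (\<alpha> ! 0))
         (nerve_act (fst (snd (r (\<delta> 0 (\<alpha> ! 0))))) d)))\<rparr>"

text \<open>The functor from the opposite of \<open>delta\<close> to \<open>PCart\<close>, uncurried, and the statement that it is the smooth
  infinity-group given by \<open>D\<close>.\<close>

definition uncurry_map ::
    "(nat \<Rightarrow> 'k \<Rightarrow> nat \<Rightarrow> nat list \<times> 'b \<Rightarrow> 'x) \<Rightarrow> nat \<Rightarrow> 'k \<times> 'b \<Rightarrow> 'x" where
  "uncurry_map U n = (\<lambda>(k, b). U n k n (did n, b))"

type_synonym ('u, 's) smooth_group = "nat \<Rightarrow> nat list \<times> delta_nerve \<Rightarrow> ('u, 's) prestack"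

definition represents_group ::
    "'m mfd \<Rightarrow> ('u mfd \<Rightarrow> ('u, 'm) fam set) \<Rightarrow> ('u, 's) smooth_group \<Rightarrow>
     (nat \<Rightarrow> ('u, 'm) bar_simplex \<Rightarrow> (delta_nerve \<times> 'u cart_nerve) \<times> 's) \<Rightarrow> bool" where
  "represents_group M D H e \<longleftrightarrow> H \<in> sx (Fun NDop PCart) 0 \<and>
     classifies (prod_sset NDop NCop) (uncurry_map (vmap H)) (bar M D id) (\<lambda>n. fst) e"

text \<open>\<open>\<Phi>\<close> is a morphism of smooth infinity-groups from \<open>\<Gamma>\<close> to \<open>H\<close>, i.e. an edge of the full
  subcategory of group objects of \<open>Fun NDop PCart\<close>.\<close>

definition smooth_group_hom ::
    "('u, 's) smooth_group \<Rightarrow> ('u, 's) smooth_group \<Rightarrow> ('u, 's) smooth_group \<Rightarrow> bool" where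
  "smooth_group_hom \<Gamma> H \<Phi> \<longleftrightarrow>
     \<Gamma> \<in> sx (Fun NDop PCart) 0 \<and> group_object PCart (vmap \<Gamma>) \<and>
     H \<in> sx (Fun NDop PCart) 0 \<and> group_object PCart (vmap H) \<and>
     \<Phi> \<in> sx (Fun NDop PCart) 1 \<and>
     sact (Fun NDop PCart) 1 [0] \<Phi> = \<Gamma> \<and> sact (Fun NDop PCart) 1 [1] \<Phi> = H"

section \<open>Presentations of smooth infinity-group actions\<close>

text \<open>The map from the cylinder \<open>std_simplex 1 \<times> K\<close> to the cone on \<open>K\<close> which collapses the end at 1,
  and the natural transformation from a diagram to the constant one underlying a cocone, as an
  edge of \<open>Fun (K \<times> B) spaces\<close>.\<close>

definition cyl_to_cone :: "'k sset \<Rightarrow> nat \<Rightarrow> nat list \<times> 'k \<Rightarrow> ('k, nat list) join" where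
  "cyl_to_cone K n = (\<lambda>(\<alpha>, k).
     let z = length (filter (\<lambda>i. i = 0) \<alpha>) in
       if z = Suc n then JL k else if z = 0 then JR (cst n 0)
       else JLR (z - 1) (sact K n [0..<z] k) (cst (n - z) 0))"

definition cocone_edge ::
    "'k sset \<Rightarrow> (nat \<Rightarrow> ('k, nat list) join \<Rightarrow> nat \<Rightarrow> nat list \<times> 'b \<Rightarrow> 's spc) \<Rightarrow>
     nat \<Rightarrow> nat list \<times> ('k \<times> 'b) \<Rightarrow> 's spc" where
  "cocone_edge K l n = (\<lambda>(\<alpha>, (k, b)). l n (cyl_to_cone K n (\<alpha>, k)) n (did n, b))"

text \<open>The canonical cocone of the simplicial presheaf of sets \<open>bar M D delta_rev\<close> with tip the nerve of
  the opposite of \<open>bdiff M D\<close>: the first vertex map. Over \<open>c\<close> the latter nerve consists of chains of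
  diffeomorphisms composed in the opposite order, whence the reversal of indices in \<open>d\<close>.\<close>

definition first_vertex ::
    "nat \<Rightarrow> ('u, 'm) bar_simplex \<Rightarrow> nat \<Rightarrow> nat \<Rightarrow> ('u, 'm) bd_arr" where
  "first_vertex n = (\<lambda>((\<delta>, \<kappa>), d).
     let k = ob (op_cat delta) \<delta> 0; v = (\<lambda>i. hd (fst (snd (\<delta> 0 i)))) in
     tri n (\<lambda>i j. case \<kappa> i j of (c, f, c') \<Rightarrow>
       (c, (f, fam_pull (\<kappa> 0 j) (d (k - v j) (k - v i))), c')))"

text \<open>
  \<open>(Q, pQ, \<phi>)\<close> presents the action \<open>\<Phi>\<close> from \<open>\<Gamma>\<close> to the smooth infinity-group \<open>H\<close> represented by \<open>D\<close>. Here \<open>bb\<close> is a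
  natural transformation extending the reversal of \<open>\<Phi>\<close> from a colimit cocone of the reversal of
  \<open>\<Gamma>\<close>, with tip its classifying object, to a colimit cocone of the reversal of \<open>H\<close>, so that its
  component \<open>w\<close> at the tip is the induced morphism of classifying objects. \<open>Q\<close> and the nerve of the
  opposite of \<open>bdiff M D\<close> are classified by the ends of \<open>w\<close>, the latter compatibly with the
  canonical cocone, and \<open>w\<close> is presented by \<open>\<phi>\<close>.
\<close>

definition presents_action ::
    "'m mfd \<Rightarrow> ('u mfd \<Rightarrow> ('u, 'm) fam set) \<Rightarrow> ('u, 's) smooth_group \<Rightarrow>
     (nat \<Rightarrow> ('u, 'm) bar_simplex \<Rightarrow> (delta_nerve \<times> 'u cart_nerve) \<times> 's) \<Rightarrow>
     'q sset \<Rightarrow> (nat \<Rightarrow> 'q \<Rightarrow> 'u cart_nerve) \<Rightarrow> (nat \<Rightarrow> 'q \<Rightarrow> nat \<Rightarrow> nat \<Rightarrow> ('u, 'm) bd_arr) \<Rightarrow> bool" where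
  "presents_action M D \<Phi> eH Q pQ \<phi> \<longleftrightarrow>
     left_fibration Q NCop pQ \<and>
     (\<forall>b\<in>sx NCop 0. \<exists>!x. x \<in> sx Q 0 \<and> pQ 0 x = b) \<and>
     (\<exists>bb e0 e1.
        let w = bb 1 (did 1, JR (cst 1 0)); N = nerve (op_cat (bdiff M D)) in
        simp_map (prod_sset (std_simplex 1) (join_sset NDop (std_simplex 0))) PCart bb \<and>
        (\<forall>n. \<forall>\<alpha>\<in>dmaps n 1. \<forall>\<delta>\<in>sx NDop n. bb n (\<alpha>, JL \<delta>) = \<Phi> n (\<alpha>, nerve_map delta_rev n \<delta>)) \<and>
        colimit_cocone NDop PCart (\<lambda>n t. bb n (cst n 0, t)) \<and>
        colimit_cocone NDop PCart (\<lambda>n t. bb n (cst n 1, t)) \<and>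
        classifies NCop (vmap (sact PCart 1 [0] w)) Q pQ e0 \<and>
        classifies NCop (vmap (sact PCart 1 [1] w)) N (nerve_map bd_proj) e1 \<and>
        presents (prod_sset NDop NCop)
          (bar M D delta_rev) (\<lambda>n. fst)
            (\<lambda>n ((\<delta>, \<kappa>), d). ((\<delta>, \<kappa>), snd (eH n ((nerve_map delta_rev n \<delta>, \<kappa>), d))))
          (prod_sset NDop N) (\<lambda>n (\<delta>, \<tau>). (\<delta>, nerve_map bd_proj n \<tau>))
            (\<lambda>n (\<delta>, \<tau>). ((\<delta>, fst (e1 n \<tau>)), snd (e1 n \<tau>)))
          (\<lambda>n z. (fst (fst z), first_vertex n z))
          (cocone_edge NDop (\<lambda>n t. bb n (cst n 1, t))) \<and>
        presents NCop Q pQ e0 N (nerve_map bd_proj) e1 \<phi> w)"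

section \<open>Moduli prestacks\<close>

abbreviation bd_stab where
  "bd_stab M R0 Fix G \<equiv> bdiff M (diff_stab M R0 Fix G)"

definition bsym_rev ::
    "'m mfd \<Rightarrow> 'u mfd \<Rightarrow> ('u mfd, ('u, 'm) bd_arr, 'x) psh \<Rightarrow> 'x \<Rightarrow> (('u, 'm) bd_arr, 'x) un sset" where
  "bsym_rev M R0 Fix G = full_sub (unstr (bd_stab M R0 Fix G) Fix)
     {(tri 0 (\<lambda>i j. cId (bd_stab M R0 Fix G) c), [pull_const M R0 Fix G c]) | c. c \<in> cart_obj}"

text \<open>The total space of the left fibration over \<open>NCop\<close> classified by the moduli prestack of
  solutions, for the composite \<open>r\<close> from \<open>Sol\<close> to \<open>Fix\<close>, and its projection. A simplex has the form
  \<open>((a, b), s)\<close> with \<open>a\<close> in \<open>Q\<close>, \<open>b\<close> in \<open>bsym_rev\<close> and \<open>s\<close> in the unstraightening of \<open>Sol\<close>.\<close>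

type_synonym ('u, 'm, 'q, 'x, 'y) mdl_simplex =
  "('q \<times> (('u, 'm) bd_arr, 'x) un) \<times> (('u, 'm) bd_arr, 'y) un"

definition mdl_total ::
    "'m mfd \<Rightarrow> 'u mfd \<Rightarrow> ('u mfd, ('u, 'm) bd_arr, 'y) psh \<Rightarrow> ('u mfd, ('u, 'm) bd_arr, 'x) psh \<Rightarrow>
     ('u mfd \<Rightarrow> nat \<Rightarrow> 'y \<Rightarrow> 'x) \<Rightarrow> 'x \<Rightarrow> 'q sset \<Rightarrow>
     (nat \<Rightarrow> 'q \<Rightarrow> nat \<Rightarrow> nat \<Rightarrow> ('u, 'm) bd_arr) \<Rightarrow> ('u, 'm, 'q, 'x, 'y) mdl_simplex sset" where
  "mdl_total M R0 Sol Fix r G Q \<phi> =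
     pullback (pullback Q (bsym_rev M R0 Fix G) \<phi> (\<lambda>n. fst))
       (unstr (bd_stab M R0 Fix G) Sol) (\<lambda>n. snd) (unstr_map (bd_stab M R0 Fix G) r)"

definition mdl_proj ::
    "(nat \<Rightarrow> 'q \<Rightarrow> 'u cart_nerve) \<Rightarrow> nat \<Rightarrow> ('u, 'm, 'q, 'x, 'y) mdl_simplex \<Rightarrow> 'u cart_nerve" where
  "mdl_proj pQ n = (\<lambda>((a, b), s). pQ n a)"

definition is_mdl ::
    "'m mfd \<Rightarrow> 'u mfd \<Rightarrow> ('u mfd, ('u, 'm) bd_arr, 'y) psh \<Rightarrow> ('u mfd, ('u, 'm) bd_arr, 'x) psh \<Rightarrow>
     ('u mfd \<Rightarrow> nat \<Rightarrow> 'y \<Rightarrow> 'x) \<Rightarrow> 'x \<Rightarrow> 'q sset \<Rightarrow> (nat \<Rightarrow> 'q \<Rightarrow> 'u cart_nerve) \<Rightarrow>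
     (nat \<Rightarrow> 'q \<Rightarrow> nat \<Rightarrow> nat \<Rightarrow> ('u, 'm) bd_arr) \<Rightarrow> ('u, 's) prestack \<Rightarrow>
     (nat \<Rightarrow> ('u, 'm, 'q, 'x, 'y) mdl_simplex \<Rightarrow> 'u cart_nerve \<times> 's) \<Rightarrow> bool" where
  "is_mdl M R0 Sol Fix r G Q pQ \<phi> F e \<longleftrightarrow> F \<in> sx PCart 0 \<and>
     classifies NCop (vmap F) (mdl_total M R0 Sol Fix r G Q \<phi>) (mdl_proj pQ) e"

text \<open>The map of total spaces induced by \<open>q\<close>.\<close>

definition mdl_map ::
    "('u mfd, ('u, 'm) bd_arr) cat \<Rightarrow> ('u mfd \<Rightarrow> nat \<Rightarrow> 'x \<Rightarrow> 'z) \<Rightarrow> nat \<Rightarrow>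
     ('u, 'm, 'q, 'x, 'y) mdl_simplex \<Rightarrow> ('u, 'm, 'q, 'z, 'y) mdl_simplex" where
  "mdl_map C q n = (\<lambda>((a, b), s). ((a, unstr_map C q n b), s))"

end

theory Submission
  imports Defs
begin

text \<open>
  Let \<open>P\<close> be the pullback to \<open>Q\<close> of the unstraightening of \<open>Sol\<close>. In a simplex of one of the
  total spaces \<open>mdl_total\<close> the component in \<open>BSYM\<close> is the image of the component in \<open>Sol\<close>, and \<open>BSYM\<close> is a full
  simplicial subset of the unstraightening of \<open>Fix\<close>. Hence the total space over \<open>G\<^sub>0\<close> is the full simplicial
  subset of \<open>P\<close> on the solutions \<open>x\<close> with \<open>p x = G\<^sub>0\<close>, the one over \<open>G\<^sub>1\<close> is that on the solutions with
  \<open>q (p x) = G\<^sub>1\<close>, and \<open>mdl_map\<close> is the inclusion of the first into the second.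

  This inclusion is essentially surjective on fibres. If \<open>q (p x) = G\<^sub>1 = q G\<^sub>0\<close>, then \<open>p x\<close> and \<open>G\<^sub>0\<close> lie in
  the same component of \<open>Fix\<^sub>0\<close>, because \<open>q\<close> is injective on components; they are joined by an edge, as
  \<open>Fix\<^sub>0\<close> takes values in Kan complexes; and this edge lifts along the fibration \<open>p\<close> to an edge from \<open>x\<close>, which stays
  in \<open>Sol\<close> since \<open>Sol\<close> is a union of components. Injectivity on components also shows that \<open>G\<^sub>0\<close> and \<open>G\<^sub>1\<close> have the
  same stabiliser.

  It remains to turn a full and essentially surjective inclusion \<open>E0 \<subseteq> E1\<close> of left fibrations into an
  equivalence of the presheaves that they classify. This can be done without choosing an inverse:
  all data are cut out of the constant families \<open>std_simplex n \<times> E1\<close>. Requiring the vertices over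
  certain vertices of \<open>std_simplex n\<close> to lie in \<open>E0\<close> leaves a left fibration
  (\<open>left_fibration_full_sub_dense\<close>); over the 1-simplex one obtains the edge and its inverse, over
  the 2-simplex the two witnesses of invertibility (\<open>full_dense_map_presents_equivalence\<close>).

  That the total spaces are left fibrations rests on the relative nerve of a presheaf of Kan complexes
  being one (\<open>left_fibration_unstr\<close>) and, for full simplicial subsets, on the lifting of edges
  (\<open>left_fibration_mdl\<close>). The input from differential topology is that identities and
  constant maps are smooth, which makes \<open>(c \<rightarrow> R\<^sup>0, 1)\<close> and \<open>(f, 1)\<close> arrows of \<open>B\<D>\<close>.
\<close>

(* The index 1 of edges is kept as a numeral, the form in which it occurs in the definitions. *)
declare One_nat_def [simp del]

section \<open>Simplicial operators and simplicial sets\<close>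

lemma dmaps_length: "\<alpha> \<in> dmaps m n \<Longrightarrow> length \<alpha> = Suc m"
  by (simp add: dmaps_def)

lemma dmaps_nth_le: "\<alpha> \<in> dmaps m n \<Longrightarrow> i \<le> m \<Longrightarrow> \<alpha> ! i \<le> n"
  unfolding dmaps_def by (metis (mono_tags, lifting) atMost_iff less_Suc_eq_le mem_Collect_eq nth_mem subsetD)

lemma dmaps_mono: "\<alpha> \<in> dmaps m n \<Longrightarrow> i \<le> j \<Longrightarrow> j \<le> m \<Longrightarrow> \<alpha> ! i \<le> \<alpha> ! j"
  by (simp add: dmaps_def sorted_nth_mono)

lemma dmapsI:
  assumes "length \<alpha> = Suc m" "\<And>i j. i \<le> j \<Longrightarrow> j \<le> m \<Longrightarrow> \<alpha> ! i \<le> \<alpha> ! j" "\<And>i. i \<le> m \<Longrightarrow> \<alpha> ! i \<le> n"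
  shows "\<alpha> \<in> dmaps m n"
  using assms unfolding dmaps_def by (auto simp: sorted_iff_nth_mono in_set_conv_nth less_Suc_eq_le)

lemma dmaps_set_le: "\<alpha> \<in> dmaps m n \<Longrightarrow> i \<in> set \<alpha> \<Longrightarrow> i \<le> n"
  by (auto simp: dmaps_def)

lemma dcomp_nth: "i < length \<beta> \<Longrightarrow> dcomp \<alpha> \<beta> ! i = \<alpha> ! (\<beta> ! i)"
  by (simp add: dcomp_def)

lemma dcomp_length [simp]: "length (dcomp \<alpha> \<beta>) = length \<beta>"
  by (simp add: dcomp_def)

lemma dcomp_in:
  assumes a: "\<alpha> \<in> dmaps m n" and b: "\<beta> \<in> dmaps k m"
  shows "dcomp \<alpha> \<beta> \<in> dmaps k n"
proof (rule dmapsI)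
  show "length (dcomp \<alpha> \<beta>) = Suc k" using dmaps_length[OF b] by simp
  show "dcomp \<alpha> \<beta> ! i \<le> dcomp \<alpha> \<beta> ! j" if "i \<le> j" "j \<le> k" for i j
    using dmaps_mono[OF a dmaps_mono[OF b that] dmaps_nth_le[OF b that(2)]] that dmaps_length[OF b]
    by (simp add: dcomp_nth)
  show "dcomp \<alpha> \<beta> ! i \<le> n" if "i \<le> k" for i
    using dmaps_nth_le[OF a dmaps_nth_le[OF b that]] that dmaps_length[OF b] by (simp add: dcomp_nth)
qed

lemma dcomp_assoc:
  "\<beta> \<in> dmaps k m \<Longrightarrow> \<gamma> \<in> dmaps l k \<Longrightarrow> dcomp (dcomp \<alpha> \<beta>) \<gamma> = dcomp \<alpha> (dcomp \<beta> \<gamma>)"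
  by (rule nth_equalityI) (auto simp: dcomp_nth dmaps_length dmaps_nth_le less_Suc_eq_le)

lemma dcomp_set: "\<beta> \<in> dmaps k m \<Longrightarrow> \<alpha> \<in> dmaps m n \<Longrightarrow> set (dcomp \<alpha> \<beta>) \<subseteq> set \<alpha>"
  by (auto simp: dcomp_def dmaps_length dest: dmaps_set_le)

lemma did_length [simp]: "length (did n) = Suc n"
  by (simp add: did_def)

lemma did_nth: "i \<le> n \<Longrightarrow> did n ! i = i"
  unfolding did_def by (simp del: upt_Suc)

lemma did_sub: "i \<le> n \<Longrightarrow> did i \<in> dmaps i n"
  by (rule dmapsI) (auto simp: did_nth)

lemma did_in: "did n \<in> dmaps n n"
  by (rule did_sub) simp

lemma did_1: "did 1 = [0, 1]"
  by (simp add: did_def One_nat_def)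

lemma did_0: "did 0 = [0]"
  by (simp add: did_def)

lemma all_le_1: "(\<forall>i\<le>(1::nat). P i) \<longleftrightarrow> P 0 \<and> P 1"
  by (auto simp: One_nat_def le_Suc_eq)

lemma set_did [simp]: "set (did n) = {..n}"
  unfolding did_def by (auto simp del: upt_Suc)

lemma dcomp_did: "length \<alpha> = Suc n \<Longrightarrow> dcomp \<alpha> (did n) = \<alpha>"
  by (rule nth_equalityI) (auto simp: dcomp_nth did_nth)

lemma did_dcomp: "\<beta> \<in> dmaps m n \<Longrightarrow> dcomp (did n) \<beta> = \<beta>"
  by (rule nth_equalityI) (auto simp: dcomp_nth did_nth dmaps_length dmaps_nth_le)

lemma sing_in: "i \<le> n \<Longrightarrow> [i] \<in> dmaps 0 n"
  by (simp add: dmaps_def)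

lemma pair_in: "i \<le> j \<Longrightarrow> j \<le> n \<Longrightarrow> [i, j] \<in> dmaps 1 n"
  by (simp add: dmaps_def)

lemma cst_in: "i \<le> n \<Longrightarrow> cst m i \<in> dmaps m n"
  by (rule dmapsI) (auto simp del: replicate_Suc)

lemma dmaps_0: "dmaps m 0 = {cst m 0}"
proof -
  have "\<alpha> = cst m 0" if a: "\<alpha> \<in> dmaps m 0" for \<alpha>
    using dmaps_length[OF a] dmaps_set_le[OF a] by (intro replicate_eqI) auto
  then show ?thesis using cst_in[of 0 0 m] by blast
qed

lemma dcomp_sing: "dcomp \<alpha> [i] = [\<alpha> ! i]"
  by (simp add: dcomp_def)

lemma dcomp_pair: "dcomp \<alpha> [i, j] = [\<alpha> ! i, \<alpha> ! j]"
  by (simp add: dcomp_def)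

lemma take_in: "\<beta> \<in> dmaps m n \<Longrightarrow> k \<le> m \<Longrightarrow> take (Suc k) \<beta> \<in> dmaps k (\<beta> ! k)"
  by (rule dmapsI) (auto simp: dmaps_length dmaps_mono)

lemma take_dcomp: "\<beta> \<in> dmaps m n \<Longrightarrow> k \<le> m \<Longrightarrow> dcomp \<beta> (did k) = take (Suc k) \<beta>"
  by (rule nth_equalityI) (auto simp: dmaps_length dcomp_nth did_nth)

lemma sset_act: "is_sset X \<Longrightarrow> \<alpha> \<in> dmaps m n \<Longrightarrow> x \<in> sx X n \<Longrightarrow> sact X n \<alpha> x \<in> sx X m"
  unfolding is_sset_def by blast

lemma sset_id: "is_sset X \<Longrightarrow> x \<in> sx X n \<Longrightarrow> sact X n (did n) x = x"
  unfolding is_sset_def by blast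

lemma sset_comp:
  "is_sset X \<Longrightarrow> \<alpha> \<in> dmaps m n \<Longrightarrow> \<beta> \<in> dmaps k m \<Longrightarrow> x \<in> sx X n \<Longrightarrow>
   sact X m \<beta> (sact X n \<alpha> x) = sact X n (dcomp \<alpha> \<beta>) x"
  unfolding is_sset_def by blast

lemma is_ssetI:
  assumes "\<And>m n \<alpha> x. \<alpha> \<in> dmaps m n \<Longrightarrow> x \<in> sx X n \<Longrightarrow> sact X n \<alpha> x \<in> sx X m"
    and "\<And>n x. x \<in> sx X n \<Longrightarrow> sact X n (did n) x = x"
    and "\<And>k m n \<alpha> \<beta> x. \<alpha> \<in> dmaps m n \<Longrightarrow> \<beta> \<in> dmaps k m \<Longrightarrow> x \<in> sx X n \<Longrightarrow>
      sact X m \<beta> (sact X n \<alpha> x) = sact X n (dcomp \<alpha> \<beta>) x"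
  shows "is_sset X"
  using assms unfolding is_sset_def by blast

lemma simp_map_in: "simp_map X Y f \<Longrightarrow> x \<in> sx X n \<Longrightarrow> f n x \<in> sx Y n"
  unfolding simp_map_def by blast

lemma simp_map_nat:
  "simp_map X Y f \<Longrightarrow> \<alpha> \<in> dmaps m n \<Longrightarrow> x \<in> sx X n \<Longrightarrow> f m (sact X n \<alpha> x) = sact Y n \<alpha> (f n x)"
  unfolding simp_map_def by blast

lemma simp_mapI:
  assumes "\<And>n x. x \<in> sx X n \<Longrightarrow> f n x \<in> sx Y n"
    and "\<And>m n \<alpha> x. \<alpha> \<in> dmaps m n \<Longrightarrow> x \<in> sx X n \<Longrightarrow> f m (sact X n \<alpha> x) = sact Y n \<alpha> (f n x)"
  shows "simp_map X Y f"
  using assms unfolding simp_map_def by blast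

lemma simp_map_comp: "simp_map X Y f \<Longrightarrow> simp_map Y Z g \<Longrightarrow> simp_map X Z (\<lambda>n x. g n (f n x))"
  unfolding simp_map_def by metis

lemma std_simplex_sx [simp]: "sx (std_simplex n) m = dmaps m n"
  and std_simplex_sact [simp]: "sact (std_simplex n) m \<alpha> \<beta> = dcomp \<beta> \<alpha>"
  by (simp_all add: std_simplex_def)

lemma is_sset_std_simplex: "is_sset (std_simplex n)"
  by (rule is_ssetI) (auto simp: dcomp_in dcomp_did dmaps_length dcomp_assoc)

lemma horn_sx: "\<beta> \<in> sx (horn n k) m \<longleftrightarrow> \<beta> \<in> dmaps m n \<and> (\<exists>j\<le>n. j \<noteq> k \<and> j \<notin> set \<beta>)"
  by (simp add: horn_def)

lemma horn_sact [simp]: "sact (horn n k) m \<alpha> \<beta> = dcomp \<beta> \<alpha>"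
  by (simp add: horn_def)

lemma horn_dmaps: "\<beta> \<in> sx (horn n k) m \<Longrightarrow> \<beta> \<in> dmaps m n"
  by (simp add: horn_sx)

lemma horn_act: "\<beta> \<in> sx (horn n k) m \<Longrightarrow> \<alpha> \<in> dmaps l m \<Longrightarrow> dcomp \<beta> \<alpha> \<in> sx (horn n k) l"
  unfolding horn_sx using dcomp_in dcomp_set by blast

lemma horn_sxI: "\<beta> \<in> dmaps m n \<Longrightarrow> j \<le> n \<Longrightarrow> j \<noteq> k \<Longrightarrow> j \<notin> set \<beta> \<Longrightarrow> \<beta> \<in> sx (horn n k) m"
  unfolding horn_sx by blast

lemma horn_sxE:
  assumes "\<beta> \<in> sx (horn n k) m"
  obtains j where "j \<le> n" "j \<noteq> k" "j \<notin> set \<beta>"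
  using assms unfolding horn_sx by blast

lemma horn_vertex_ge2:
  assumes "2 \<le> n" "i \<le> n"
  shows "[i] \<in> sx (horn n k) 0"
proof -
  define j :: nat where "j = (if k \<noteq> 0 \<and> i \<noteq> 0 then 0 else if k \<noteq> 1 \<and> i \<noteq> 1 then 1 else 2)"
  have "j \<le> n" "j \<noteq> k" "j \<notin> set [i]" using assms unfolding j_def by auto
  then show ?thesis by (rule horn_sxI[OF sing_in[OF assms(2)]])
qed

text \<open>In dimension 1 the apex is the only vertex of a horn, so it is the one by which horns are tested for
  membership in a union of components.\<close>

lemma horn_vertex_apex:
  assumes "1 \<le> n" "k \<le> n"
  shows "[k] \<in> sx (horn n k) 0"
proof -
  define j :: nat where "j = (if k = 0 then 1 else 0)"
  have "j \<le> n" "j \<noteq> k" "j \<notin> set [k]" using assms unfolding j_def by auto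
  then show ?thesis by (rule horn_sxI[OF sing_in[OF assms(2)]])
qed

lemma horn_1_0: "\<beta> \<in> sx (horn 1 0) m \<longleftrightarrow> \<beta> = cst m 0"
proof
  assume "\<beta> \<in> sx (horn 1 0) m"
  then obtain j where b: "\<beta> \<in> dmaps m 1" "j \<le> 1" "j \<noteq> 0" "j \<notin> set \<beta>"
    unfolding horn_sx by blast
  have "i = 0" if "i \<in> set \<beta>" for i
  proof -
    have "i \<le> 1" "j = 1" "i \<noteq> j" using dmaps_set_le[OF b(1) that] b that by auto
    then show ?thesis by simp
  qed
  then show "\<beta> = cst m 0"
    using dmaps_length[OF b(1)] by (intro replicate_eqI) auto
next
  assume "\<beta> = cst m 0"
  then show "\<beta> \<in> sx (horn 1 0) m" using cst_in[of 0 1 m] horn_sxI[of \<beta> m 1 1 0] by simp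
qed

lemma is_sset_bij:
  assumes X: "is_sset X" and bij: "\<And>n. bij_betw (f n) (sx X' n) (sx X n)"
    and cl: "\<And>m n \<alpha> x. \<alpha> \<in> dmaps m n \<Longrightarrow> x \<in> sx X' n \<Longrightarrow> sact X' n \<alpha> x \<in> sx X' m"
    and nat: "\<And>m n \<alpha> x. \<alpha> \<in> dmaps m n \<Longrightarrow> x \<in> sx X' n \<Longrightarrow> f m (sact X' n \<alpha> x) = sact X n \<alpha> (f n x)"
  shows "is_sset X'"
proof (rule is_ssetI)
  have inj: "x = y" if "f n x = f n y" "x \<in> sx X' n" "y \<in> sx X' n" for n x y
    using bij[of n] that by (meson bij_betw_def inj_onD)
  have im: "f n x \<in> sx X n" if "x \<in> sx X' n" for n x
    using bij[of n] that by (meson bij_betw_apply)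
  show "sact X' n \<alpha> x \<in> sx X' m" if "\<alpha> \<in> dmaps m n" "x \<in> sx X' n" for m n \<alpha> x
    using cl that .
  show "sact X' n (did n) x = x" if "x \<in> sx X' n" for n x
    by (rule inj[of n]) (use that in \<open>auto simp: cl[OF did_in] nat[OF did_in] sset_id[OF X] im\<close>)
  show "sact X' m \<beta> (sact X' n \<alpha> x) = sact X' n (dcomp \<alpha> \<beta>) x"
    if h: "\<alpha> \<in> dmaps m n" "\<beta> \<in> dmaps k m" "x \<in> sx X' n" for k m n \<alpha> \<beta> x
  proof (rule inj[of k])
    show "f k (sact X' m \<beta> (sact X' n \<alpha> x)) = f k (sact X' n (dcomp \<alpha> \<beta>) x)"
      using nat[OF h(2) cl[OF h(1,3)]] nat[OF h(1,3)] sset_comp[OF X h(1,2) im[OF h(3)]]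
        nat[OF dcomp_in[OF h(1,2)] h(3)] by simp
  qed (use cl h dcomp_in in blast)+
qed

lemma prod_sx [simp]: "sx (prod_sset X Y) n = sx X n \<times> sx Y n"
  and prod_sact [simp]: "sact (prod_sset X Y) n \<alpha> (x, y) = (sact X n \<alpha> x, sact Y n \<alpha> y)"
  by (simp_all add: prod_sset_def)

lemma pullback_sx: "(x, y) \<in> sx (pullback X Y f g) n \<longleftrightarrow> x \<in> sx X n \<and> y \<in> sx Y n \<and> f n x = g n y"
  and pullback_sact [simp]: "sact (pullback X Y f g) n \<alpha> (x, y) = (sact X n \<alpha> x, sact Y n \<alpha> y)"
  by (simp_all add: pullback_def)

lemma is_sset_pullback:
  assumes "is_sset X" "is_sset Y" "simp_map X Z f" "simp_map Y Z g"
  shows "is_sset (pullback X Y f g)"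
proof (rule is_ssetI)
  show "sact (pullback X Y f g) n \<alpha> x \<in> sx (pullback X Y f g) m"
    if "\<alpha> \<in> dmaps m n" "x \<in> sx (pullback X Y f g) n" for m n \<alpha> x
    using that assms by (cases x) (auto simp: pullback_sx sset_act simp_map_nat)
  show "sact (pullback X Y f g) n (did n) x = x" if "x \<in> sx (pullback X Y f g) n" for n x
    using that assms by (cases x) (auto simp: pullback_sx sset_id)
  show "sact (pullback X Y f g) m \<beta> (sact (pullback X Y f g) n \<alpha> x) = sact (pullback X Y f g) n (dcomp \<alpha> \<beta>) x"
    if "\<alpha> \<in> dmaps m n" "\<beta> \<in> dmaps k m" "x \<in> sx (pullback X Y f g) n" for k m n \<alpha> \<beta> x
    using that assms by (cases x) (auto simp: pullback_sx sset_comp)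
qed

lemma full_sub_sx: "x \<in> sx (full_sub X V) n \<longleftrightarrow> x \<in> sx X n \<and> (\<forall>i\<le>n. sact X n [i] x \<in> V)"
  and full_sub_sact [simp]: "sact (full_sub X V) = sact X"
  by (simp_all add: full_sub_def)

lemma sact_vertex:
  assumes "is_sset X" "\<alpha> \<in> dmaps m n" "x \<in> sx X n" "i \<le> m"
  shows "sact X m [i] (sact X n \<alpha> x) = sact X n [\<alpha> ! i] x"
  using sset_comp[OF assms(1,2) sing_in[OF assms(4)] assms(3)] by (simp add: dcomp_sing)

lemma full_sub_act:
  assumes X: "is_sset X" and a: "\<alpha> \<in> dmaps m n" "x \<in> sx (full_sub X V) n"
  shows "sact X n \<alpha> x \<in> sx (full_sub X V) m"
  using a sset_act[OF X a(1)] unfolding full_sub_sx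
  by (auto simp: sact_vertex[OF X a(1)] dmaps_nth_le)

lemma is_sset_full_sub: "is_sset X \<Longrightarrow> is_sset (full_sub X V)"
proof (rule is_ssetI)
  assume X: "is_sset X"
  show "sact (full_sub X V) n \<alpha> x \<in> sx (full_sub X V) m" if "\<alpha> \<in> dmaps m n" "x \<in> sx (full_sub X V) n" for m n \<alpha> x
    using full_sub_act[OF X that] by simp
  show "sact (full_sub X V) n (did n) x = x" if "x \<in> sx (full_sub X V) n" for n x
    using that sset_id[OF X] unfolding full_sub_sx by simp
  show "sact (full_sub X V) m \<beta> (sact (full_sub X V) n \<alpha> x) = sact (full_sub X V) n (dcomp \<alpha> \<beta>) x"
    if "\<alpha> \<in> dmaps m n" "\<beta> \<in> dmaps k m" "x \<in> sx (full_sub X V) n" for k m n \<alpha> \<beta> x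
    using that sset_comp[OF X] unfolding full_sub_sx by simp
qed

section \<open>Left fibrations\<close>

lemma left_fibrationD:
  assumes "left_fibration X Y p"
  shows "is_sset X" "is_sset Y" "simp_map X Y p" "k < n \<Longrightarrow> horn_lift n k X Y p"
  using assms unfolding left_fibration_def by blast+

lemma kan_fibrationD:
  assumes "kan_fibration X Y p"
  shows "is_sset X" "is_sset Y" "simp_map X Y p" "1 \<le> n \<Longrightarrow> k \<le> n \<Longrightarrow> horn_lift n k X Y p"
  using assms unfolding kan_fibration_def by blast+

lemma left_fibrationI:
  assumes "is_sset X" "is_sset Y" "simp_map X Y p"
    and "\<And>n k u y. k < n \<Longrightarrow> y \<in> sx Y n \<Longrightarrow> simp_map (horn n k) X u \<Longrightarrow>
      (\<And>m \<beta>. \<beta> \<in> sx (horn n k) m \<Longrightarrow> p m (u m \<beta>) = sact Y n \<beta> y) \<Longrightarrow>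
      \<exists>x\<in>sx X n. p n x = y \<and> (\<forall>m. \<forall>\<beta>\<in>sx (horn n k) m. sact X n \<beta> x = u m \<beta>)"
  shows "left_fibration X Y p"
  unfolding left_fibration_def horn_lift_def using assms by blast

lemma horn_liftD:
  assumes "horn_lift n k X Y p" "y \<in> sx Y n" "simp_map (horn n k) X u"
    and "\<And>m \<beta>. \<beta> \<in> sx (horn n k) m \<Longrightarrow> p m (u m \<beta>) = sact Y n \<beta> y"
  shows "\<exists>x\<in>sx X n. p n x = y \<and> (\<forall>m. \<forall>\<beta>\<in>sx (horn n k) m. sact X n \<beta> x = u m \<beta>)"
  using assms unfolding horn_lift_def by blast

lemma edge_lift:
  assumes hl: "horn_lift 1 0 X Y p" and X: "is_sset X" and Y: "is_sset Y" and p: "simp_map X Y p"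
    and x: "x \<in> sx X 0" and y: "y \<in> sx Y 1" "sact Y 1 [0] y = p 0 x"
  obtains e where "e \<in> sx X 1" "p 1 e = y" "sact X 1 [0] e = x"
proof -
  define u where "u = (\<lambda>m (\<beta>::nat list). sact X 0 (cst m 0) x)"
  have c: "cst m 0 \<in> dmaps m 0" for m by (rule cst_in) simp
  have "simp_map (horn 1 0) X u"
  proof (rule simp_mapI)
    show "u m \<beta> \<in> sx X m" for m \<beta> unfolding u_def by (rule sset_act[OF X c x])
    show "u l (sact (horn 1 0) m \<alpha> \<beta>) = sact X m \<alpha> (u m \<beta>)" if a: "\<alpha> \<in> dmaps l m" for l m \<alpha> \<beta>
      unfolding u_def using sset_comp[OF X c a x] dcomp_in[OF c a] unfolding dmaps_0 by simp
  qed
  moreover have "p m (u m \<beta>) = sact Y 1 \<beta> y" if "\<beta> \<in> sx (horn 1 0) m" for m \<beta>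
  proof -
    have "p m (u m \<beta>) = sact Y 0 (cst m 0) (sact Y 1 [0] y)"
      unfolding u_def using simp_map_nat[OF p c x] y by simp
    also have "\<dots> = sact Y 1 (dcomp [0] (cst m 0)) y"
      by (rule sset_comp[OF Y sing_in c y(1)]) simp
    also have "dcomp [0] (cst m 0) = \<beta>" using that unfolding horn_1_0 by (simp add: dcomp_def map_replicate_const)
    finally show ?thesis .
  qed
  ultimately obtain e where e: "e \<in> sx X 1" "p 1 e = y" "\<And>m \<beta>. \<beta> \<in> sx (horn 1 0) m \<Longrightarrow> sact X 1 \<beta> e = u m \<beta>"
    using horn_liftD[OF hl y(1)] by meson
  have "sact X 1 [0] e = u 0 [0]" using e(3)[of "[0]" 0] horn_1_0[of "[0]" 0] by simp
  also have "\<dots> = x" unfolding u_def using sset_id[OF X x] by (simp add: did_def)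
  finally show thesis using that e by blast
qed

text \<open>Two edges that meet in the vertex \<open>k\<close> of a 2-simplex form the horn with apex \<open>k\<close>; they are
  given by the vertices \<open>l < h\<close> of the 2-simplex that they join.\<close>

lemma fill_two_edges:
  assumes hl: "horn_lift 2 k X Y p" and X: "is_sset X" and Y: "is_sset Y" and p: "simp_map X Y p"
    and lh: "l < h" "l' < h'" "k \<in> {l, h}" "k \<in> {l', h'}" "{l, h, l', h'} = {0, 1, 2}"
    and e: "e \<in> sx X 1" "e' \<in> sx X 1"
    and eq: "sact X 1 [if k = h then 1 else 0] e = sact X 1 [if k = h' then 1 else 0] e'"
    and y: "y \<in> sx Y 2" "sact Y 2 [l, h] y = p 1 e" "sact Y 2 [l', h'] y = p 1 e'"
  obtains x where "x \<in> sx X 2" "p 2 x = y" "sact X 2 [l, h] x = e" "sact X 2 [l', h'] x = e'"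
proof -
  define pos where "pos = (\<lambda>c. map (\<lambda>i::nat. if i = c then 1 else 0 :: nat))"
  define u where "u = (\<lambda>(m::nat) \<beta>. if set \<beta> \<subseteq> {l, h} then sact X 1 (pos h \<beta>) e else sact X 1 (pos h' \<beta>) e')"
  have bnd: "l \<le> 2" "h \<le> 2" "l' \<le> 2" "h' \<le> 2"
  proof -
    have "\<forall>i\<in>{l, h, l', h'}. i \<le> 2" unfolding lh(5) by simp
    then show "l \<le> 2" "h \<le> 2" "l' \<le> 2" "h' \<le> 2" by simp_all
  qed
  have pos_in: "pos c \<beta> \<in> dmaps m 1" if b: "\<beta> \<in> dmaps m 2" "set \<beta> \<subseteq> {a, c}" "a < c" for a c m \<beta>
  proof (rule dmapsI)
    show "length (pos c \<beta>) = Suc m" using b by (simp add: pos_def dmaps_length)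
    show "pos c \<beta> ! i \<le> pos c \<beta> ! j" if "i \<le> j" "j \<le> m" for i j
    proof -
      have "\<beta> ! i \<le> \<beta> ! j" using dmaps_mono[OF b(1) that] .
      moreover have "\<beta> ! i \<in> {a, c}" "\<beta> ! j \<in> {a, c}"
        using that dmaps_length[OF b(1)] by (intro subsetD[OF b(2)] nth_mem; simp)+
      ultimately show ?thesis using that b dmaps_length[OF b(1)] by (auto simp: pos_def)
    qed
    show "pos c \<beta> ! i \<le> 1" if "i \<le> m" for i
      using that dmaps_length[OF b(1)] by (auto simp: pos_def)
  qed
  have pos_comp: "dcomp (pos c \<beta>) \<alpha> = pos c (dcomp \<beta> \<alpha>)" if "\<beta> \<in> dmaps m 2" "\<alpha> \<in> dmaps j m" for c \<beta> \<alpha> m j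
    by (rule nth_equalityI)
      (use that in \<open>simp_all add: pos_def dcomp_nth dmaps_length dmaps_nth_le less_Suc_eq_le\<close>)
  have pos_inv: "dcomp [a, c] (pos c \<beta>) = \<beta>" if "set \<beta> \<subseteq> {a, c}" "a < c" for a c \<beta>
  proof (rule nth_equalityI)
    fix i assume "i < length (dcomp [a, c] (pos c \<beta>))"
    then have i: "i < length \<beta>" by (simp add: pos_def)
    have "\<beta> ! i = a \<or> \<beta> ! i = c" using subsetD[OF that(1) nth_mem[OF i]] by simp
    moreover have "dcomp [a, c] (pos c \<beta>) ! i = (if \<beta> ! i = c then c else a)"
      using i by (simp add: pos_def dcomp_def)
    ultimately show "dcomp [a, c] (pos c \<beta>) ! i = \<beta> ! i" by (elim disjE) simp_all
  qed (simp add: pos_def)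
  have cover: "set \<beta> \<subseteq> {l, h} \<or> set \<beta> \<subseteq> {l', h'}" if bh: "\<beta> \<in> sx (horn 2 k) m" for m \<beta>
  proof -
    obtain j where j: "j \<le> 2" "j \<noteq> k" "j \<notin> set \<beta>" using bh by (rule horn_sxE)
    note b = horn_dmaps[OF bh]
    have s: "set \<beta> \<subseteq> {l, h, l', h'}"
    proof
      fix i assume "i \<in> set \<beta>"
      then have "i \<le> 2" by (rule dmaps_set_le[OF b])
      then show "i \<in> {l, h, l', h'}" unfolding lh(5) by auto
    qed
    have "j \<in> {l, h, l', h'}" unfolding lh(5) using j(1) by auto
    then have "j \<in> {l, h} \<or> j \<in> {l', h'}" by blast
    then show ?thesis using s j(2,3) lh(3,4) by blast
  qed
  have const: "\<beta> = cst m k" if "\<beta> \<in> dmaps m 2" "set \<beta> \<subseteq> {l, h}" "set \<beta> \<subseteq> {l', h'}" for m \<beta>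
  proof -
    have c3: "card {l, h, l', h'} = 3" unfolding lh(5) by simp
    have "a = k" if "a \<in> {l, h}" "a \<in> {l', h'}" for a
    proof (rule ccontr)
      assume "a \<noteq> k"
      then have "{l, h} = {a, k}" "{l', h'} = {a, k}" using that lh(1-4) by auto
      then have "{l, h, l', h'} = {a, k}" by blast
      then show False using c3 \<open>a \<noteq> k\<close> by simp
    qed
    then show ?thesis using that by (metis dmaps_length replicate_eqI subsetD)
  qed
  have u2: "u m \<beta> = sact X 1 (pos h' \<beta>) e'" if b: "\<beta> \<in> dmaps m 2" "set \<beta> \<subseteq> {l', h'}" for m \<beta>
  proof (cases "set \<beta> \<subseteq> {l, h}")
    case True
    have bk: "\<beta> = cst m k" using const b True by blast
    have *: "pos c \<beta> = dcomp [if k = c then 1 else 0] (cst m 0)" for c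
      unfolding bk pos_def dcomp_def by (simp add: map_replicate_const)
    have c: "cst m 0 \<in> dmaps m 0" by (rule cst_in) simp
    have "sact X 1 (pos h \<beta>) e = sact X 0 (cst m 0) (sact X 1 [if k = h then 1 else 0] e)"
      unfolding * by (rule sset_comp[OF X sing_in c e(1), symmetric]) simp
    also have "\<dots> = sact X 1 (pos h' \<beta>) e'"
      unfolding * eq by (rule sset_comp[OF X sing_in c e(2)]) simp
    finally show ?thesis unfolding u_def using True by simp
  qed (simp add: u_def)
  have "simp_map (horn 2 k) X u"
  proof (rule simp_mapI)
    show "u m \<beta> \<in> sx X m" if b: "\<beta> \<in> sx (horn 2 k) m" for m \<beta>
    proof (cases "set \<beta> \<subseteq> {l, h}")
      case True
      then show ?thesis using sset_act[OF X pos_in[OF horn_dmaps[OF b] _ lh(1)] e(1)] unfolding u_def by simp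
    next
      case False
      then have "set \<beta> \<subseteq> {l', h'}" using cover[OF b] by blast
      then show ?thesis using False sset_act[OF X pos_in[OF horn_dmaps[OF b] _ lh(2)] e(2)] unfolding u_def by simp
    qed
    show "u j (sact (horn 2 k) m \<alpha> \<beta>) = sact X m \<alpha> (u m \<beta>)" if a: "\<alpha> \<in> dmaps j m" and b: "\<beta> \<in> sx (horn 2 k) m" for j m \<alpha> \<beta>
    proof -
      note bd = horn_dmaps[OF b]
      have sub: "set (dcomp \<beta> \<alpha>) \<subseteq> set \<beta>" by (rule dcomp_set[OF a bd])
      show ?thesis
      proof (cases "set \<beta> \<subseteq> {l, h}")
        case True
        then have "set (dcomp \<beta> \<alpha>) \<subseteq> {l, h}" using sub by blast
        with True show ?thesis unfolding u_def horn_sact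
          by (simp add: sset_comp[OF X pos_in[OF bd _ lh(1)] a e(1)] pos_comp[OF bd a])
      next
        case False
        then have s: "set \<beta> \<subseteq> {l', h'}" using cover[OF b] by blast
        then have "set (dcomp \<beta> \<alpha>) \<subseteq> {l', h'}" using sub by blast
        then show ?thesis using s u2[OF bd s] u2[OF dcomp_in[OF bd a]] unfolding horn_sact
          by (simp add: sset_comp[OF X pos_in[OF bd _ lh(2)] a e(2)] pos_comp[OF bd a])
      qed
    qed
  qed
  moreover have "p m (u m \<beta>) = sact Y 2 \<beta> y" if b: "\<beta> \<in> sx (horn 2 k) m" for m \<beta>
  proof -
    note bd = horn_dmaps[OF b]
    have *: "p m (sact X 1 (pos c \<beta>) e0) = sact Y 2 \<beta> y"
      if h: "set \<beta> \<subseteq> {a, c}" "a < c" "c \<le> 2" "e0 \<in> sx X 1" "sact Y 2 [a, c] y = p 1 e0" for a c e0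
    proof -
      have "p m (sact X 1 (pos c \<beta>) e0) = sact Y 1 (pos c \<beta>) (sact Y 2 [a, c] y)"
        using simp_map_nat[OF p pos_in[OF bd h(1,2)] h(4)] h(5) by simp
      also have "\<dots> = sact Y 2 (dcomp [a, c] (pos c \<beta>)) y"
        by (rule sset_comp[OF Y pair_in pos_in[OF bd h(1,2)] y(1)]) (use h in auto)
      finally show ?thesis unfolding pos_inv[OF h(1,2)] .
    qed
    show ?thesis
    proof (cases "set \<beta> \<subseteq> {l, h}")
      case True
      then show ?thesis using *[OF True lh(1) bnd(2) e(1) y(2)] by (simp add: u_def)
    next
      case False
      then show ?thesis using cover[OF b] *[OF _ lh(2) bnd(4) e(2) y(3)] by (simp add: u_def)
    qed
  qed
  ultimately obtain x where x: "x \<in> sx X 2" "p 2 x = y" "\<And>m \<beta>. \<beta> \<in> sx (horn 2 k) m \<Longrightarrow> sact X 2 \<beta> x = u m \<beta>"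
    using horn_liftD[OF hl y(1)] by meson
  have horn2: "[a, c] \<in> sx (horn 2 k) 1" if ac: "a < c" "c \<le> 2" "k \<in> {a, c}" for a c
  proof -
    define j :: nat where "j = (if a \<noteq> 0 then 0 else if c \<noteq> 1 then 1 else 2)"
    have "j \<le> 2" "j \<noteq> k" "j \<notin> set [a, c]" using ac unfolding j_def by auto
    then show ?thesis using ac pair_in[of a c 2] horn_sxI[of "[a, c]" 1 2 j k] by simp
  qed
  have dd: "pos c [a, c] = did 1" if "a < c" for a c using that by (simp add: pos_def did_1)
  have "sact X 2 [l, h] x = e"
    using x(3)[OF horn2[OF lh(1) bnd(2) lh(3)]] sset_id[OF X e(1)] by (simp add: u_def dd[OF lh(1)])
  moreover have "sact X 2 [l', h'] x = e'"
    using x(3)[OF horn2[OF lh(2) bnd(4) lh(4)]] u2[OF pair_in[of l' h' 2]] lh(2) bnd sset_id[OF X e(2)] by (simp add: dd[OF lh(2)])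
  ultimately show thesis using that x(1,2) by blast
qed

lemma left_fibration_bij:
  assumes lf: "left_fibration X Y p" and X': "is_sset X'" and f: "simp_map X' X f"
    and bij: "\<And>n. bij_betw (f n) (sx X' n) (sx X n)"
    and pf: "\<And>n x. x \<in> sx X' n \<Longrightarrow> p n (f n x) = p' n x"
  shows "left_fibration X' Y p'"
proof (rule left_fibrationI[OF X' left_fibrationD(2)[OF lf]])
  note p = left_fibrationD(3)[OF lf]
  show "simp_map X' Y p'"
  proof (rule simp_mapI)
    show "p' n x \<in> sx Y n" if "x \<in> sx X' n" for n x
      using simp_map_in[OF p simp_map_in[OF f that]] pf[OF that] by simp
    show "p' m (sact X' n \<alpha> x) = sact Y n \<alpha> (p' n x)" if "\<alpha> \<in> dmaps m n" "x \<in> sx X' n" for m n \<alpha> x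
      using simp_map_nat[OF p that(1) simp_map_in[OF f that(2)]] simp_map_nat[OF f that] pf[OF that(2)]
        pf[OF sset_act[OF X' that]] by simp
  qed
next
  fix n k u y
  assume h: "k < n" "y \<in> sx Y n" "simp_map (horn n k) X' u"
    "\<And>m \<beta>. \<beta> \<in> sx (horn n k) m \<Longrightarrow> p' m (u m \<beta>) = sact Y n \<beta> y"
  have pu: "p m (f m (u m \<beta>)) = sact Y n \<beta> y" if "\<beta> \<in> sx (horn n k) m" for m \<beta>
    using h(4)[OF that] pf[OF simp_map_in[OF h(3) that]] by simp
  obtain x where x: "x \<in> sx X n" "p n x = y" "\<And>m \<beta>. \<beta> \<in> sx (horn n k) m \<Longrightarrow> sact X n \<beta> x = f m (u m \<beta>)"
    using horn_liftD[OF left_fibrationD(4)[OF lf h(1)] h(2) simp_map_comp[OF h(3) f] pu] by blast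
  obtain x' where x': "x' \<in> sx X' n" "f n x' = x" using x(1) unfolding bij_betw_imp_surj_on[OF bij[of n], symmetric] by blast
  have "sact X' n \<beta> x' = u m \<beta>" if b: "\<beta> \<in> sx (horn n k) m" for m \<beta>
  proof (rule inj_onD[OF bij_betw_imp_inj_on[OF bij[of m]]])
    show "f m (sact X' n \<beta> x') = f m (u m \<beta>)" using simp_map_nat[OF f horn_dmaps[OF b] x'(1)] x'(2) x(3)[OF b] by simp
  qed (use sset_act[OF X' horn_dmaps[OF b] x'(1)] simp_map_in[OF h(3) b] in auto)
  then show "\<exists>x\<in>sx X' n. p' n x = y \<and> (\<forall>m. \<forall>\<beta>\<in>sx (horn n k) m. sact X' n \<beta> x = u m \<beta>)"
    using x' x(2) pf[OF x'(1)] by auto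
qed

lemma left_fibration_comp:
  assumes p: "left_fibration X Y p" and q: "left_fibration Y Z q"
  shows "left_fibration X Z (\<lambda>n x. q n (p n x))"
proof (rule left_fibrationI[OF left_fibrationD(1)[OF p] left_fibrationD(2)[OF q]])
  note ps = left_fibrationD(3)[OF p] and qs = left_fibrationD(3)[OF q]
  show "simp_map X Z (\<lambda>n x. q n (p n x))" by (rule simp_map_comp[OF ps qs])
  fix n k u y
  assume h: "k < n" "y \<in> sx Z n" "simp_map (horn n k) X u"
    "\<And>m \<beta>. \<beta> \<in> sx (horn n k) m \<Longrightarrow> q m (p m (u m \<beta>)) = sact Z n \<beta> y"
  obtain z where z: "z \<in> sx Y n" "q n z = y" "\<And>m \<beta>. \<beta> \<in> sx (horn n k) m \<Longrightarrow> sact Y n \<beta> z = p m (u m \<beta>)"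
    using horn_liftD[OF left_fibrationD(4)[OF q h(1)] h(2) simp_map_comp[OF h(3) ps] h(4)] by blast
  obtain x where "x \<in> sx X n" "p n x = z" "\<And>m \<beta>. \<beta> \<in> sx (horn n k) m \<Longrightarrow> sact X n \<beta> x = u m \<beta>"
    using horn_liftD[OF left_fibrationD(4)[OF p h(1)] z(1) h(3) z(3)[symmetric]] by blast
  then show "\<exists>x\<in>sx X n. q n (p n x) = y \<and> (\<forall>m. \<forall>\<beta>\<in>sx (horn n k) m. sact X n \<beta> x = u m \<beta>)"
    using z by blast
qed

lemma left_fibration_pullback:
  assumes g: "left_fibration Y Z g" and X: "is_sset X" and f: "simp_map X Z f"
  shows "left_fibration (pullback X Y f g) X (\<lambda>n. fst)"
proof (rule left_fibrationI)
  note Y = left_fibrationD(1)[OF g] and gs = left_fibrationD(3)[OF g]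
  show P: "is_sset (pullback X Y f g)" by (rule is_sset_pullback[OF X Y f gs])
  show "is_sset X" by fact
  show "simp_map (pullback X Y f g) X (\<lambda>n. fst)"
    by (rule simp_mapI) (auto simp: pullback_sx)
  fix n k u x
  assume h: "k < n" "x \<in> sx X n" "simp_map (horn n k) (pullback X Y f g) u"
    "\<And>m \<beta>. \<beta> \<in> sx (horn n k) m \<Longrightarrow> fst (u m \<beta>) = sact X n \<beta> x"
  have uin: "snd (u m \<beta>) \<in> sx Y m \<and> f m (fst (u m \<beta>)) = g m (snd (u m \<beta>))" if "\<beta> \<in> sx (horn n k) m" for m \<beta>
    using simp_map_in[OF h(3) that] by (cases "u m \<beta>") (auto simp: pullback_sx)
  have u2: "simp_map (horn n k) Y (\<lambda>m \<beta>. snd (u m \<beta>))"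
  proof (rule simp_mapI)
    show "snd (u l (sact (horn n k) m \<alpha> \<beta>)) = sact Y m \<alpha> (snd (u m \<beta>))"
      if "\<alpha> \<in> dmaps l m" "\<beta> \<in> sx (horn n k) m" for l m \<alpha> \<beta>
      using simp_map_nat[OF h(3) that] by (cases "u m \<beta>") auto
  qed (use uin in blast)
  have gu: "g m (snd (u m \<beta>)) = sact Z n \<beta> (f n x)" if "\<beta> \<in> sx (horn n k) m" for m \<beta>
    using uin[OF that] h(4)[OF that] simp_map_nat[OF f horn_dmaps[OF that] h(2)] by simp
  obtain y where y: "y \<in> sx Y n" "g n y = f n x" "\<And>m \<beta>. \<beta> \<in> sx (horn n k) m \<Longrightarrow> sact Y n \<beta> y = snd (u m \<beta>)"
    using horn_liftD[OF left_fibrationD(4)[OF g h(1)] simp_map_in[OF f h(2)] u2 gu] by blast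
  show "\<exists>z\<in>sx (pullback X Y f g) n. fst z = x \<and> (\<forall>m. \<forall>\<beta>\<in>sx (horn n k) m. sact (pullback X Y f g) n \<beta> z = u m \<beta>)"
    by (rule bexI[of _ "(x, y)"]) (use h y in \<open>auto simp: pullback_sx prod_eq_iff\<close>)
qed

text \<open>A horn of dimension at least 2 contains all vertices of the simplex, so its fillers do not leave
  a full simplicial subset. Only edges with a given initial vertex need attention.\<close>

lemma left_fibration_full_sub:
  assumes lf: "left_fibration X Y p"
    and edge: "\<And>x y. x \<in> sx X 0 \<Longrightarrow> x \<in> V \<Longrightarrow> y \<in> sx Y 1 \<Longrightarrow> sact Y 1 [0] y = p 0 x \<Longrightarrow>
      \<exists>e\<in>sx X 1. p 1 e = y \<and> sact X 1 [0] e = x \<and> sact X 1 [1] e \<in> V"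
  shows "left_fibration (full_sub X V) Y p"
proof (rule left_fibrationI)
  note X = left_fibrationD(1)[OF lf] and p = left_fibrationD(3)[OF lf]
  show "is_sset (full_sub X V)" by (rule is_sset_full_sub[OF X])
  show "is_sset Y" by (rule left_fibrationD(2)[OF lf])
  show "simp_map (full_sub X V) Y p"
    by (rule simp_mapI) (use simp_map_in[OF p] simp_map_nat[OF p] in \<open>auto simp: full_sub_sx\<close>)
  fix n k u y
  assume h: "k < n" "y \<in> sx Y n" "simp_map (horn n k) (full_sub X V) u"
    "\<And>m \<beta>. \<beta> \<in> sx (horn n k) m \<Longrightarrow> p m (u m \<beta>) = sact Y n \<beta> y"
  have uX: "simp_map (horn n k) X u"
    using h(3) unfolding simp_map_def by (auto simp: full_sub_sx)
  have vert: "u 0 [i] \<in> sx X 0 \<and> u 0 [i] \<in> V" if "[i] \<in> sx (horn n k) 0" for i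
    using simp_map_in[OF h(3) that] sset_id[OF X, of _ 0] by (auto simp: full_sub_sx did_def)
  show "\<exists>x\<in>sx (full_sub X V) n. p n x = y \<and> (\<forall>m. \<forall>\<beta>\<in>sx (horn n k) m. sact (full_sub X V) n \<beta> x = u m \<beta>)"
  proof (cases "n = 1")
    case True
    then have k: "k = 0" using h(1) by simp
    have b0: "[0] \<in> sx (horn n k) 0" unfolding True k horn_1_0 by simp
    obtain e where e: "e \<in> sx X 1" "p 1 e = y" "sact X 1 [0] e = u 0 [0]" "sact X 1 [1] e \<in> V"
      using edge[of "u 0 [0]" y] vert[OF b0] h(2) h(4)[OF b0] True by auto
    have "sact X 1 \<beta> e = u m \<beta>" if b: "\<beta> \<in> sx (horn n k) m" for m \<beta>
    proof -
      have b': "\<beta> = dcomp [0] (cst m 0)" using b unfolding True k horn_1_0 by (simp add: dcomp_def map_replicate_const)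
      have c: "cst m 0 \<in> dmaps m 0" by (rule cst_in) simp
      show ?thesis unfolding b' using sset_comp[OF X sing_in c e(1), of 0] simp_map_nat[OF uX c b0] e(3) by simp
    qed
    moreover have "e \<in> sx (full_sub X V) 1" using e vert[OF b0] unfolding full_sub_sx by (simp add: all_le_1)
    ultimately show ?thesis using e True by auto
  next
    case False
    then have n2: "2 \<le> n" using h(1) by simp
    obtain x where x: "x \<in> sx X n" "p n x = y" "\<And>m \<beta>. \<beta> \<in> sx (horn n k) m \<Longrightarrow> sact X n \<beta> x = u m \<beta>"
      using horn_liftD[OF left_fibrationD(4)[OF lf h(1)] h(2) uX h(4)] by blast
    have "x \<in> sx (full_sub X V) n"
      unfolding full_sub_sx using x(1,3) vert horn_vertex_ge2[OF n2] by metis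
    then show ?thesis using x by auto
  qed
qed

text \<open>If every vertex is joined to \<open>V\<close> by an edge in its fibre, then the final vertex of any lift
  can be moved into \<open>V\<close> by composing with such an edge.\<close>

lemma left_fibration_full_sub_dense:
  assumes lf: "left_fibration X Y p"
    and dense: "\<And>x. x \<in> sx X 0 \<Longrightarrow> \<exists>e\<in>sx X 1. p 1 e = sact Y 0 [0, 0] (p 0 x) \<and> sact X 1 [0] e = x \<and> sact X 1 [1] e \<in> V"
  shows "left_fibration (full_sub X V) Y p"
proof (rule left_fibration_full_sub[OF lf])
  note X = left_fibrationD(1)[OF lf] and Y = left_fibrationD(2)[OF lf] and p = left_fibrationD(3)[OF lf]
  fix x y assume x: "x \<in> sx X 0" and y: "y \<in> sx Y 1" "sact Y 1 [0] y = p 0 x"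
  obtain e where e: "e \<in> sx X 1" "p 1 e = y" "sact X 1 [0] e = x"
    using edge_lift[OF left_fibrationD(4)[OF lf] X Y p x y] by auto
  have v1: "sact X 1 [1] e \<in> sx X 0" by (rule sset_act[OF X sing_in e(1)]) simp
  obtain e' where e': "e' \<in> sx X 1" "p 1 e' = sact Y 0 [0, 0] (p 0 (sact X 1 [1] e))"
      "sact X 1 [0] e' = sact X 1 [1] e" "sact X 1 [1] e' \<in> V"
    using dense[OF v1] by blast
  have d: "[0, 1, 1] \<in> dmaps 2 1" by (simp add: dmaps_def)
  have y2: "sact Y 1 [0, 1, 1] y \<in> sx Y 2" by (rule sset_act[OF Y d y(1)])
  have a: "sact Y 2 [0, 1] (sact Y 1 [0, 1, 1] y) = p 1 e"
    using sset_comp[OF Y d pair_in[of 0 1 2] y(1)] e(2) sset_id[OF Y y(1)] by (simp add: dcomp_pair did_1)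
  have "p 1 e' = sact Y 0 [0, 0] (sact Y 1 [1] y)" using e'(2) simp_map_nat[OF p sing_in[of 1 1] e(1)] e(2) by simp
  also have "\<dots> = sact Y 1 [1, 1] y" using sset_comp[OF Y sing_in[of 1 1] pair_in[of 0 0 0] y(1)] by (simp add: dcomp_pair)
  finally have b: "sact Y 2 [1, 2] (sact Y 1 [0, 1, 1] y) = p 1 e'"
    using sset_comp[OF Y d pair_in[of 1 2 2] y(1)] by (simp add: dcomp_pair)
  obtain t where t: "t \<in> sx X 2" "p 2 t = sact Y 1 [0, 1, 1] y" "sact X 2 [0, 1] t = e" "sact X 2 [1, 2] t = e'"
    by (rule fill_two_edges[OF left_fibrationD(4)[OF lf, of 1 2] X Y p, of 0 1 1 2 e e' "sact Y 1 [0, 1, 1] y"])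
      (use e e' y2 a b in auto)
  have t02: "sact X 2 [0, 2] t \<in> sx X 1" by (rule sset_act[OF X pair_in t(1)]) auto
  have "p 1 (sact X 2 [0, 2] t) = y"
    using simp_map_nat[OF p pair_in[of 0 2 2] t(1)] t(2) sset_comp[OF Y d pair_in[of 0 2 2] y(1)] sset_id[OF Y y(1)]
    by (simp add: dcomp_pair did_1)
  moreover have "sact X 1 [0] (sact X 2 [0, 2] t) = x"
    using sact_vertex[OF X pair_in[of 0 2 2] t(1), of 0] sact_vertex[OF X pair_in[of 0 1 2] t(1), of 0] t(3) e(3) by simp
  moreover have "sact X 1 [1] (sact X 2 [0, 2] t) \<in> V"
    using sact_vertex[OF X pair_in[of 0 2 2] t(1), of 1] sact_vertex[OF X pair_in[of 1 2 2] t(1), of 1] t(4) e'(4) by simp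
  ultimately show "\<exists>e\<in>sx X 1. p 1 e = y \<and> sact X 1 [0] e = x \<and> sact X 1 [1] e \<in> V" using t02 by blast
qed

section \<open>Families of spaces and their total spaces\<close>

lemma dmaps_dinto: "\<alpha> \<in> dmaps m n \<Longrightarrow> \<alpha> \<in> dinto n"
  unfolding dinto_def by blast

lemma dintoE:
  assumes "\<alpha> \<in> dinto n"
  shows "\<alpha> \<in> dmaps (length \<alpha> - 1) n"
proof -
  obtain m where "\<alpha> \<in> dmaps m n" using assms unfolding dinto_def by blast
  then show ?thesis using dmaps_length by fastforce
qed

lemma spc_norm_fst: "\<alpha> \<in> dmaps m n \<Longrightarrow> fst (spc_norm n F) \<alpha> = fst F \<alpha>"
  unfolding spc_norm_def by (simp add: dmaps_dinto)

lemma spc_norm_snd: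
  "\<alpha> \<in> dmaps m n \<Longrightarrow> \<beta> \<in> dmaps k m \<Longrightarrow> x \<in> fst F \<alpha> \<Longrightarrow> snd (spc_norm n F) \<alpha> \<beta> x = snd F \<alpha> \<beta> x"
  unfolding spc_norm_def by (simp add: dmaps_dinto dmaps_length)

lemma spc_norm_cong:
  assumes "\<And>k \<alpha>. \<alpha> \<in> dmaps k n \<Longrightarrow> fst F \<alpha> = fst G \<alpha>"
    and "\<And>k l \<alpha> \<beta> x. \<alpha> \<in> dmaps k n \<Longrightarrow> \<beta> \<in> dmaps l k \<Longrightarrow> x \<in> fst F \<alpha> \<Longrightarrow> snd F \<alpha> \<beta> x = snd G \<alpha> \<beta> x"
  shows "spc_norm n F = spc_norm n G"
proof (rule prod_eqI)
  have e: "fst F \<alpha> = fst G \<alpha>" if "\<alpha> \<in> dinto n" for \<alpha> using assms(1)[OF dintoE[OF that]] .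
  show "fst (spc_norm n F) = fst (spc_norm n G)"
    unfolding spc_norm_def by (rule ext) (simp add: e)
  show "snd (spc_norm n F) = snd (spc_norm n G)"
  proof (intro ext)
    fix \<alpha> \<beta> x
    show "snd (spc_norm n F) \<alpha> \<beta> x = snd (spc_norm n G) \<alpha> \<beta> x"
    proof (cases "\<alpha> \<in> dinto n \<and> x \<in> fst F \<alpha> \<and> \<beta> \<in> dinto (length \<alpha> - 1)")
      case True
      then show ?thesis using assms(2)[OF dintoE dintoE, of \<alpha> \<beta> x] e[of \<alpha>] unfolding spc_norm_def by simp
    next
      case False
      then have "\<not> (\<alpha> \<in> dinto n \<and> x \<in> fst G \<alpha> \<and> \<beta> \<in> dinto (length \<alpha> - 1))" using e[of \<alpha>] by blast
      with False show ?thesis unfolding spc_norm_def snd_conv by (simp only: if_False)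
    qed
  qed
qed

lemma spc_norm_idem: "spc_norm n (spc_norm n F) = spc_norm n F"
  by (rule spc_norm_cong) (simp_all add: spc_norm_fst spc_norm_snd)

lemma spaces_sx: "F \<in> sx spaces n \<longleftrightarrow> spc_norm n F = F \<and> left_fibration (spc_total n F) (std_simplex n) (\<lambda>m. fst)"
  by (simp add: spaces_def)

lemma spaces_sact:
  "sact spaces n \<gamma> F = spc_norm (length \<gamma> - 1) (\<lambda>\<alpha>. fst F (dcomp \<gamma> \<alpha>), \<lambda>\<alpha>. snd F (dcomp \<gamma> \<alpha>))"
  by (simp add: spaces_def)

lemma spc_total_sx: "(\<alpha>, x) \<in> sx (spc_total n F) m \<longleftrightarrow> \<alpha> \<in> dmaps m n \<and> x \<in> fst F \<alpha>"
  and spc_total_sact [simp]: "sact (spc_total n F) m \<beta> (\<alpha>, x) = (dcomp \<alpha> \<beta>, snd F \<alpha> \<beta> x)"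
  by (simp_all add: spc_total_def)

lemma el_sx: "(b, x) \<in> sx (el B F) n \<longleftrightarrow> b \<in> sx B n \<and> x \<in> fst (F n b) (did n)"
  and el_sact [simp]: "sact (el B F) n \<beta> (b, x) = (sact B n \<beta> b, snd (F n b) (did n) \<beta> x)"
  by (simp_all add: el_def)

locale space_family =
  fixes B :: "'b sset" and F :: "nat \<Rightarrow> 'b \<Rightarrow> 's spc"
  assumes base: "is_sset B" and family: "simp_map B spaces F"
begin

lemma fibration: "b \<in> sx B m \<Longrightarrow> left_fibration (spc_total m (F m b)) (std_simplex m) (\<lambda>m. fst)"
  using simp_map_in[OF family] unfolding spaces_sx by blast

lemma normal: "b \<in> sx B m \<Longrightarrow> spc_norm m (F m b) = F m b"
  using simp_map_in[OF family] unfolding spaces_sx by blast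

lemma fib_in:
  assumes "b \<in> sx B m" "\<beta> \<in> dmaps k m" "\<gamma> \<in> dmaps l k" "y \<in> fst (F m b) \<beta>"
  shows "snd (F m b) \<beta> \<gamma> y \<in> fst (F m b) (dcomp \<beta> \<gamma>)"
  using sset_act[OF left_fibrationD(1)[OF fibration[OF assms(1)]] assms(3), of "(\<beta>, y)"] assms
  by (simp add: spc_total_sx)

lemma fib_comp:
  assumes "b \<in> sx B m" "\<beta> \<in> dmaps k m" "\<gamma> \<in> dmaps l k" "\<delta> \<in> dmaps j l" "y \<in> fst (F m b) \<beta>"
  shows "snd (F m b) (dcomp \<beta> \<gamma>) \<delta> (snd (F m b) \<beta> \<gamma> y) = snd (F m b) \<beta> (dcomp \<gamma> \<delta>) y"
  using sset_comp[OF left_fibrationD(1)[OF fibration[OF assms(1)]] assms(3,4), of "(\<beta>, y)"] assms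
  by (simp add: spc_total_sx)

lemma pull_fst:
  assumes "b \<in> sx B m" "\<beta> \<in> dmaps k m" "\<gamma> \<in> dmaps l k"
  shows "fst (F k (sact B m \<beta> b)) \<gamma> = fst (F m b) (dcomp \<beta> \<gamma>)"
  using simp_map_nat[OF family assms(2,1)] assms
  by (simp add: spaces_sact dmaps_length spc_norm_fst[OF assms(3)])

lemma pull_snd:
  assumes "b \<in> sx B m" "\<beta> \<in> dmaps k m" "\<gamma> \<in> dmaps l k" "\<delta> \<in> dmaps j l" "y \<in> fst (F m b) (dcomp \<beta> \<gamma>)"
  shows "snd (F k (sact B m \<beta> b)) \<gamma> \<delta> y = snd (F m b) (dcomp \<beta> \<gamma>) \<delta> y"
  using simp_map_nat[OF family assms(2,1)] spc_norm_snd[OF assms(3,4), of y] assms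
  by (simp add: spaces_sact dmaps_length)

text \<open>The element of \<open>el B F\<close> over a face of \<open>b\<close> and the elements of the family \<open>F m b\<close> over the
  corresponding simplex of \<open>std_simplex m\<close> are the same, because \<open>F\<close> is simplicial. All later
  computations with \<open>el B F\<close> take place inside \<open>F m b\<close> for a single \<open>b\<close>.\<close>

lemma el_slice:
  assumes "b \<in> sx B m" "\<beta> \<in> dmaps k m"
  shows "(sact B m \<beta> b, y) \<in> sx (el B F) k \<longleftrightarrow> y \<in> fst (F m b) \<beta>"
  using pull_fst[OF assms did_in] sset_act[OF base assms(2,1)] assms
  by (simp add: el_sx dcomp_did dmaps_length)

lemma el_slice_act:
  assumes "b \<in> sx B m" "\<beta> \<in> dmaps k m" "\<gamma> \<in> dmaps l k" "y \<in> fst (F m b) \<beta>"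
  shows "sact (el B F) k \<gamma> (sact B m \<beta> b, y) = (sact B m (dcomp \<beta> \<gamma>) b, snd (F m b) \<beta> \<gamma> y)"
  using pull_snd[OF assms(1,2) did_in assms(3), of y] sset_comp[OF base assms(2,3,1)] assms
  by (simp add: dcomp_did dmaps_length)

end

lemma Fun_sx: "h \<in> sx (Fun K X) n \<longleftrightarrow> simp_map (prod_sset (std_simplex n) K) X h \<and>
    (\<forall>m z. z \<notin> sx (prod_sset (std_simplex n) K) m \<longrightarrow> h m z = undefined)"
  and Fun_sact: "sact (Fun K X) n \<alpha> h = (\<lambda>m z. if z \<in> sx (prod_sset (std_simplex (length \<alpha> - 1)) K) m
       then h m (dcomp \<alpha> (fst z), snd z) else undefined)"
  by (simp_all add: Fun_def)

section \<open>Inclusions of full subspaces that are fibrewise essentially surjective\<close>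

text \<open>The map \<open>\<theta>\<close> identifies the total space of \<open>F0\<close> with the full simplicial subset of that of \<open>F1\<close>
  spanned by \<open>W\<close>, and every vertex of the latter total space is joined to \<open>W\<close> inside its fibre.

  For a set \<open>T\<close> of vertices of the n-simplex let \<open>X\<^sub>T\<close> be the full simplicial subset of
  \<open>std_simplex n \<times> el B F1\<close> on the vertices \<open>(i, v)\<close> with \<open>v \<in> W\<close> whenever \<open>i \<in> T\<close>. By density it
  is a left fibration over \<open>std_simplex n \<times> B\<close>, and pulling it back along an operator \<open>\<gamma>\<close> gives \<open>X\<^sub>S\<close>
  for \<open>S\<close> the preimage of \<open>T\<close> under \<open>\<gamma>\<close>. So \<open>X\<close> for \<open>T = {0}\<close> is an edge
  from \<open>F0\<close> to \<open>F1\<close> and for \<open>T = {1}\<close> an edge back; on the 2-simplex, \<open>T = {0, 2}\<close> and \<open>T = {1}\<close>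
  give the witnesses that these edges are mutually inverse, because the long edges of those have
  \<open>T = {0, 1}\<close> and \<open>T = {}\<close>, that is, they are constant.

  Edges and vertices of \<open>Fun B spaces\<close> are compared by equality, so the names of the elements of
  the fibres matter as well: over a simplex with all vertices in \<open>T\<close> they are taken from \<open>F0\<close>, over
  all others from \<open>F1\<close>. This rule is stable under faces and degeneracies, and it needs no room in the universe
  beyond what \<open>F0\<close> and \<open>F1\<close> already occupy.\<close>

locale dense_full_inclusion = F0: space_family B F0 + F1: space_family B F1
  for B :: "'b sset" and F0 F1 :: "nat \<Rightarrow> 'b \<Rightarrow> 's spc" +
  fixes \<theta> :: "nat \<Rightarrow> 'b \<times> 's \<Rightarrow> 'b \<times> 's" and W :: "('b \<times> 's) set"
  assumes incl: "simp_map (el B F0) (el B F1) \<theta>"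
    and incl_fst: "x \<in> sx (el B F0) n \<Longrightarrow> fst (\<theta> n x) = fst x"
    and incl_bij: "bij_betw (\<theta> n) (sx (el B F0) n) (sx (full_sub (el B F1) W) n)"
    and dense: "x \<in> sx (el B F1) 0 \<Longrightarrow> \<exists>e\<in>sx (el B F1) 1.
      fst e = sact B 0 [0, 0] (fst x) \<and> sact (el B F1) 1 [0] e = x \<and> sact (el B F1) 1 [1] e \<in> W"
begin

text \<open>The name in \<open>F1\<close> of the element with name \<open>y\<close> in \<open>F0\<close>, over the face \<open>\<beta>\<close> of \<open>b\<close>.\<close>

definition name :: "nat \<Rightarrow> 'b \<Rightarrow> nat list \<Rightarrow> 's \<Rightarrow> 's" where
  "name m b \<beta> y = snd (\<theta> (length \<beta> - 1) (sact B m \<beta> b, y))"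

text \<open>The fibre of \<open>X\<^sub>T\<close> over the face \<open>\<beta>\<close> of the simplex \<open>(\<alpha>, b)\<close>, first with all names taken from \<open>F1\<close>
  and then with the mixed names; \<open>rename\<close> translates the latter into the former, and the operators of
  \<open>blend\<close> are those of \<open>F1\<close> conjugated by it.\<close>

definition fib1 :: "nat set \<Rightarrow> nat list \<Rightarrow> nat \<Rightarrow> 'b \<Rightarrow> nat list \<Rightarrow> 's set" where
  "fib1 T \<alpha> m b \<beta> = {z \<in> fst (F1 m b) \<beta>.
     \<forall>i<length \<beta>. \<alpha> ! (\<beta> ! i) \<in> T \<longrightarrow> (sact B m [\<beta> ! i] b, snd (F1 m b) \<beta> [i] z) \<in> W}"

definition fib :: "nat set \<Rightarrow> nat list \<Rightarrow> nat \<Rightarrow> 'b \<Rightarrow> nat list \<Rightarrow> 's set" where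
  "fib T \<alpha> m b \<beta> = (if set (dcomp \<alpha> \<beta>) \<subseteq> T then fst (F0 m b) \<beta> else fib1 T \<alpha> m b \<beta>)"

definition rename :: "nat set \<Rightarrow> nat list \<Rightarrow> nat \<Rightarrow> 'b \<Rightarrow> nat list \<Rightarrow> 's \<Rightarrow> 's" where
  "rename T \<alpha> m b \<beta> y = (if set (dcomp \<alpha> \<beta>) \<subseteq> T then name m b \<beta> y else y)"

definition blend :: "nat set \<Rightarrow> nat \<Rightarrow> nat list \<times> 'b \<Rightarrow> 's spc" where
  "blend T m = (\<lambda>(\<alpha>, b). spc_norm m (fib T \<alpha> m b,
     \<lambda>\<beta> \<gamma> y. inv_into (fib T \<alpha> m b (dcomp \<beta> \<gamma>)) (rename T \<alpha> m b (dcomp \<beta> \<gamma>))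
       (snd (F1 m b) \<beta> \<gamma> (rename T \<alpha> m b \<beta> y))))"

lemma name_eq:
  assumes "b \<in> sx B m" "\<beta> \<in> dmaps k m" "y \<in> fst (F0 m b) \<beta>"
  shows "\<theta> k (sact B m \<beta> b, y) = (sact B m \<beta> b, name m b \<beta> y)"
  using incl_fst[of "(sact B m \<beta> b, y)" k] F0.el_slice[OF assms(1,2)] assms
  by (simp add: name_def dmaps_length prod_eq_iff)

lemma name_nat:
  assumes "b \<in> sx B m" "\<beta> \<in> dmaps k m" "\<gamma> \<in> dmaps l k" "y \<in> fst (F0 m b) \<beta>"
  shows "name m b (dcomp \<beta> \<gamma>) (snd (F0 m b) \<beta> \<gamma> y) = snd (F1 m b) \<beta> \<gamma> (name m b \<beta> y)"
proof -
  have x: "(sact B m \<beta> b, y) \<in> sx (el B F0) k" using F0.el_slice[OF assms(1,2)] assms(4) by simp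
  have "(sact B m \<beta> b, name m b \<beta> y) \<in> sx (el B F1) k"
    using simp_map_in[OF incl x] name_eq[OF assms(1,2,4)] by simp
  then have n1: "name m b \<beta> y \<in> fst (F1 m b) \<beta>" using F1.el_slice[OF assms(1,2)] by simp
  have "\<theta> l (sact (el B F0) k \<gamma> (sact B m \<beta> b, y)) = sact (el B F1) k \<gamma> (sact B m \<beta> b, name m b \<beta> y)"
    using simp_map_nat[OF incl assms(3) x] name_eq[OF assms(1,2,4)] by simp
  then show ?thesis
    using F0.el_slice_act[OF assms] F1.el_slice_act[OF assms(1,2,3) n1]
      name_eq[OF assms(1) dcomp_in[OF assms(2,3)] F0.fib_in[OF assms]] by simp
qed

lemma sub_slice:
  assumes b: "b \<in> sx B m" "\<beta> \<in> dmaps k m"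
  shows "(sact B m \<beta> b, z) \<in> sx (full_sub (el B F1) W) k \<longleftrightarrow>
    z \<in> fst (F1 m b) \<beta> \<and> (\<forall>i\<le>k. (sact B m [\<beta> ! i] b, snd (F1 m b) \<beta> [i] z) \<in> W)"
  unfolding full_sub_sx F1.el_slice[OF b]
  using F1.el_slice_act[OF b sing_in] by (auto simp: dcomp_sing)

lemma name_bij:
  assumes b: "b \<in> sx B m" "\<beta> \<in> dmaps k m"
  shows "bij_betw (name m b \<beta>) (fst (F0 m b) \<beta>)
    {z \<in> fst (F1 m b) \<beta>. \<forall>i\<le>k. (sact B m [\<beta> ! i] b, snd (F1 m b) \<beta> [i] z) \<in> W}"
proof (rule bij_betwI')
  fix x y assume xy: "x \<in> fst (F0 m b) \<beta>" "y \<in> fst (F0 m b) \<beta>"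
  have xe: "(sact B m \<beta> b, x) \<in> sx (el B F0) k" and ye: "(sact B m \<beta> b, y) \<in> sx (el B F0) k"
    using xy F0.el_slice[OF b] by auto
  show "(name m b \<beta> x = name m b \<beta> y) = (x = y)"
    using inj_onD[OF bij_betw_imp_inj_on[OF incl_bij[of k]] _ xe ye] name_eq[OF b xy(1)] name_eq[OF b xy(2)] by auto
next
  fix x assume x: "x \<in> fst (F0 m b) \<beta>"
  then have "(sact B m \<beta> b, x) \<in> sx (el B F0) k" using F0.el_slice[OF b] by simp
  then have "(sact B m \<beta> b, name m b \<beta> x) \<in> sx (full_sub (el B F1) W) k"
    using bij_betw_apply[OF incl_bij[of k]] name_eq[OF b x] by metis
  then show "name m b \<beta> x \<in> {z \<in> fst (F1 m b) \<beta>. \<forall>i\<le>k. (sact B m [\<beta> ! i] b, snd (F1 m b) \<beta> [i] z) \<in> W}"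
    unfolding sub_slice[OF b] by simp
next
  fix z assume "z \<in> {z \<in> fst (F1 m b) \<beta>. \<forall>i\<le>k. (sact B m [\<beta> ! i] b, snd (F1 m b) \<beta> [i] z) \<in> W}"
  then have "(sact B m \<beta> b, z) \<in> sx (full_sub (el B F1) W) k" unfolding sub_slice[OF b] by simp
  then obtain x where x: "x \<in> sx (el B F0) k" "\<theta> k x = (sact B m \<beta> b, z)"
    unfolding bij_betw_imp_surj_on[OF incl_bij, symmetric] by fastforce
  have "fst x = sact B m \<beta> b" using incl_fst[OF x(1)] x(2) by simp
  then have xx: "x = (sact B m \<beta> b, snd x)" by (simp add: prod_eq_iff)
  then have "snd x \<in> fst (F0 m b) \<beta>" using x(1) F0.el_slice[OF b, of "snd x"] by simp
  moreover have "z = name m b \<beta> (snd x)" using name_eq[OF b calculation] x(2) xx by simp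
  ultimately show "\<exists>x\<in>fst (F0 m b) \<beta>. z = name m b \<beta> x" by blast
qed

lemma rename_bij:
  assumes b: "b \<in> sx B m" "\<beta> \<in> dmaps k m"
  shows "bij_betw (rename T \<alpha> m b \<beta>) (fib T \<alpha> m b \<beta>) (fib1 T \<alpha> m b \<beta>)"
proof (cases "set (dcomp \<alpha> \<beta>) \<subseteq> T")
  case True
  have "\<alpha> ! (\<beta> ! i) \<in> T" if "i < length \<beta>" for i
    using subsetD[OF True, of "dcomp \<alpha> \<beta> ! i"] that nth_mem[of i "dcomp \<alpha> \<beta>"] by (simp add: dcomp_nth)
  then have "fib1 T \<alpha> m b \<beta> = {z \<in> fst (F1 m b) \<beta>. \<forall>i\<le>k. (sact B m [\<beta> ! i] b, snd (F1 m b) \<beta> [i] z) \<in> W}"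
    unfolding fib1_def using dmaps_length[OF b(2)] by (auto simp: less_Suc_eq_le)
  moreover have "rename T \<alpha> m b \<beta> = name m b \<beta>" using True by (auto simp: rename_def)
  moreover have "fib T \<alpha> m b \<beta> = fst (F0 m b) \<beta>" using True by (simp add: fib_def)
  ultimately show ?thesis using name_bij[OF b] by simp
next
  case False
  then have "rename T \<alpha> m b \<beta> = (\<lambda>y. y)" "fib T \<alpha> m b \<beta> = fib1 T \<alpha> m b \<beta>"
    by (simp_all add: rename_def fib_def fun_eq_iff)
  then show ?thesis by (simp add: bij_betw_def)
qed

lemma fib1_act:
  assumes b: "b \<in> sx B m" "\<beta> \<in> dmaps k m" "\<gamma> \<in> dmaps l k" and z: "z \<in> fib1 T \<alpha> m b \<beta>"
  shows "snd (F1 m b) \<beta> \<gamma> z \<in> fib1 T \<alpha> m b (dcomp \<beta> \<gamma>)"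
proof -
  have z1: "z \<in> fst (F1 m b) \<beta>" using z by (simp add: fib1_def)
  have "(sact B m [dcomp \<beta> \<gamma> ! i] b, snd (F1 m b) (dcomp \<beta> \<gamma>) [i] (snd (F1 m b) \<beta> \<gamma> z)) \<in> W"
    if i: "i < length (dcomp \<beta> \<gamma>)" "\<alpha> ! (dcomp \<beta> \<gamma> ! i) \<in> T" for i
  proof -
    have i': "i < length \<gamma>" "i \<le> l" "\<gamma> ! i < length \<beta>"
      using i(1) dmaps_length[OF b(3)] dmaps_length[OF b(2)] dmaps_nth_le[OF b(3), of i] by auto
    have "snd (F1 m b) (dcomp \<beta> \<gamma>) [i] (snd (F1 m b) \<beta> \<gamma> z) = snd (F1 m b) \<beta> [\<gamma> ! i] z"
      using F1.fib_comp[OF b sing_in[OF i'(2)] z1] by (simp add: dcomp_sing)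
    then show ?thesis using z i' i(2) by (simp add: fib1_def dcomp_nth)
  qed
  then show ?thesis using F1.fib_in[OF b z1] by (simp add: fib1_def)
qed

lemma blend_fst: "\<beta> \<in> dmaps k m \<Longrightarrow> fst (blend T m (\<alpha>, b)) \<beta> = fib T \<alpha> m b \<beta>"
  by (simp add: blend_def spc_norm_fst)

lemma blend_snd:
  assumes "\<beta> \<in> dmaps k m" "\<gamma> \<in> dmaps l k" "y \<in> fib T \<alpha> m b \<beta>"
  shows "snd (blend T m (\<alpha>, b)) \<beta> \<gamma> y = inv_into (fib T \<alpha> m b (dcomp \<beta> \<gamma>)) (rename T \<alpha> m b (dcomp \<beta> \<gamma>))
       (snd (F1 m b) \<beta> \<gamma> (rename T \<alpha> m b \<beta> y))"
  using assms by (simp add: blend_def spc_norm_snd)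

lemma blend_snd_in:
  assumes b: "b \<in> sx B m" "\<beta> \<in> dmaps k m" "\<gamma> \<in> dmaps l k" and y: "y \<in> fib T \<alpha> m b \<beta>"
  shows "snd (blend T m (\<alpha>, b)) \<beta> \<gamma> y \<in> fib T \<alpha> m b (dcomp \<beta> \<gamma>)"
    and "rename T \<alpha> m b (dcomp \<beta> \<gamma>) (snd (blend T m (\<alpha>, b)) \<beta> \<gamma> y) = snd (F1 m b) \<beta> \<gamma> (rename T \<alpha> m b \<beta> y)"
proof -
  have "snd (F1 m b) \<beta> \<gamma> (rename T \<alpha> m b \<beta> y) \<in> fib1 T \<alpha> m b (dcomp \<beta> \<gamma>)"
    by (rule fib1_act[OF b bij_betw_apply[OF rename_bij[OF b(1,2)] y]])
  then have im: "snd (F1 m b) \<beta> \<gamma> (rename T \<alpha> m b \<beta> y) \<in> rename T \<alpha> m b (dcomp \<beta> \<gamma>) ` fib T \<alpha> m b (dcomp \<beta> \<gamma>)"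
    unfolding bij_betw_imp_surj_on[OF rename_bij[OF b(1) dcomp_in[OF b(2,3)]]] .
  show "snd (blend T m (\<alpha>, b)) \<beta> \<gamma> y \<in> fib T \<alpha> m b (dcomp \<beta> \<gamma>)"
    unfolding blend_snd[OF b(2,3) y] by (rule inv_into_into[OF im])
  show "rename T \<alpha> m b (dcomp \<beta> \<gamma>) (snd (blend T m (\<alpha>, b)) \<beta> \<gamma> y) = snd (F1 m b) \<beta> \<gamma> (rename T \<alpha> m b \<beta> y)"
    unfolding blend_snd[OF b(2,3) y] by (rule f_inv_into_f[OF im])
qed

lemma blend_snd_eq:
  assumes b: "b \<in> sx B m" "\<beta> \<in> dmaps k m" "\<gamma> \<in> dmaps l k" and y: "y \<in> fib T \<alpha> m b \<beta>"
    and y': "y' \<in> fib T \<alpha> m b (dcomp \<beta> \<gamma>)"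
      "rename T \<alpha> m b (dcomp \<beta> \<gamma>) y' = snd (F1 m b) \<beta> \<gamma> (rename T \<alpha> m b \<beta> y)"
  shows "snd (blend T m (\<alpha>, b)) \<beta> \<gamma> y = y'"
  using inj_onD[OF bij_betw_imp_inj_on[OF rename_bij[OF b(1) dcomp_in[OF b(2,3)]]] _ blend_snd_in(1)[OF b y] y'(1)]
    blend_snd_in(2)[OF b y] y'(2) by simp

text \<open>Up to renaming the total space is the full simplicial subset of that of \<open>F1\<close> on the vertices that
  lie in \<open>W\<close> if \<open>\<alpha>\<close> sends them to \<open>T\<close>; the edges into \<open>W\<close> provided by density lie over degenerate
  edges, hence stay over the same vertex of the simplex.\<close>

lemma blend_fibration:
  assumes b: "b \<in> sx B m"
  shows "left_fibration (spc_total m (blend T m (\<alpha>, b))) (std_simplex m) (\<lambda>m. fst)"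
proof -
  let ?X = "spc_total m (F1 m b)" and ?X' = "spc_total m (blend T m (\<alpha>, b))"
  define U where "U = {(\<beta>, z). \<alpha> ! (\<beta> ! 0) \<in> T \<longrightarrow> (sact B m [\<beta> ! 0] b, z) \<in> W}"
  let ?S = "full_sub ?X U"
  define f where "f = (\<lambda>(k::nat) (\<beta>, y). (\<beta>, rename T \<alpha> m b \<beta> y))"
  note X = left_fibrationD(1)[OF F1.fibration[OF b]]
  have S_lf: "left_fibration ?S (std_simplex m) (\<lambda>m. fst)"
  proof (rule left_fibration_full_sub_dense[OF F1.fibration[OF b]])
    fix x assume x: "x \<in> sx ?X 0"
    obtain \<beta> y where xy: "x = (\<beta>, y)" by (cases x)
    have by': "\<beta> \<in> dmaps 0 m" "y \<in> fst (F1 m b) \<beta>" using x unfolding xy spc_total_sx by auto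
    obtain j where j: "\<beta> = [j]" using dmaps_length[OF by'(1)] by (metis length_0_conv length_Suc_conv)
    have jm: "j \<le> m" using dmaps_nth_le[OF by'(1), of 0] j by simp
    have jj: "[j, j] \<in> dmaps 1 m" using pair_in[OF _ jm] by simp
    have v: "(sact B m [j] b, y) \<in> sx (el B F1) 0"
      using F1.el_slice[OF b by'(1)] by' j by simp
    obtain e where e: "e \<in> sx (el B F1) 1" "fst e = sact B 0 [0, 0] (sact B m [j] b)"
      "sact (el B F1) 1 [0] e = (sact B m [j] b, y)" "sact (el B F1) 1 [1] e \<in> W"
      using dense[OF v] by auto
    have fe: "fst e = sact B m [j, j] b"
      using e(2) sset_comp[OF F1.base sing_in[OF jm] pair_in[of 0 0 0] b] by (simp add: dcomp_pair)
    then have ee: "e = (sact B m [j, j] b, snd e)" by (simp add: prod_eq_iff)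
    have z: "snd e \<in> fst (F1 m b) [j, j]" using F1.el_slice[OF b jj, of "snd e"] e(1) ee by simp
    have s0: "snd (F1 m b) [j, j] [0] (snd e) = y"
      using F1.el_slice_act[OF b jj sing_in[of 0 1] z] e(3) ee by (simp add: dcomp_sing)
    have s1: "(sact B m [j] b, snd (F1 m b) [j, j] [1] (snd e)) \<in> W"
      using F1.el_slice_act[OF b jj sing_in[of 1 1] z] e(4) ee by (simp add: dcomp_sing One_nat_def)
    show "\<exists>e\<in>sx ?X 1. fst e = sact (std_simplex m) 0 [0, 0] (fst x) \<and> sact ?X 1 [0] e = x \<and> sact ?X 1 [1] e \<in> U"
      by (rule bexI[of _ "([j, j], snd e)"])
        (use z jj s0 s1 in \<open>auto simp: xy j spc_total_sx dcomp_pair dcomp_sing U_def One_nat_def\<close>)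
  qed
  have S_sx: "(\<beta>, z) \<in> sx ?S k \<longleftrightarrow> \<beta> \<in> dmaps k m \<and> z \<in> fib1 T \<alpha> m b \<beta>" for \<beta> z k
    unfolding full_sub_sx spc_total_sx fib1_def
    by (auto simp: U_def dcomp_sing dmaps_length less_Suc_eq_le)
  have X'_sx: "(\<beta>, y) \<in> sx ?X' k \<longleftrightarrow> \<beta> \<in> dmaps k m \<and> y \<in> fib T \<alpha> m b \<beta>" for \<beta> y k
    unfolding spc_total_sx by (auto simp: blend_fst)
  have bij: "bij_betw (f k) (sx ?X' k) (sx ?S k)" for k
  proof (rule bij_betwI')
    fix x y assume xy: "x \<in> sx ?X' k" "y \<in> sx ?X' k"
    obtain \<beta> x' \<gamma> y' where e: "x = (\<beta>, x')" "y = (\<gamma>, y')" by (cases x, cases y)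
    have h: "\<beta> \<in> dmaps k m" "x' \<in> fib T \<alpha> m b \<beta>" "y' \<in> fib T \<alpha> m b \<gamma>" using xy unfolding e X'_sx by auto
    show "(f k x = f k y) = (x = y)"
      unfolding e f_def using inj_onD[OF bij_betw_imp_inj_on[OF rename_bij[OF b h(1)]] _ h(2), of y'] h(3) by auto
  next
    fix x assume x: "x \<in> sx ?X' k"
    obtain \<beta> x' where e: "x = (\<beta>, x')" by (cases x)
    have h: "\<beta> \<in> dmaps k m" "x' \<in> fib T \<alpha> m b \<beta>" using x unfolding e X'_sx by auto
    show "f k x \<in> sx ?S k" unfolding e f_def
      using bij_betw_apply[OF rename_bij[OF b h(1)] h(2)] h(1) by (simp add: S_sx)
  next
    fix z assume z: "z \<in> sx ?S k"
    obtain \<beta> z' where e: "z = (\<beta>, z')" by (cases z)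
    have h: "\<beta> \<in> dmaps k m" "z' \<in> fib1 T \<alpha> m b \<beta>" using z unfolding e S_sx by auto
    obtain y where "y \<in> fib T \<alpha> m b \<beta>" "rename T \<alpha> m b \<beta> y = z'"
      using h(2) unfolding bij_betw_imp_surj_on[OF rename_bij[OF b h(1)], symmetric] by blast
    then show "\<exists>x\<in>sx ?X' k. z = f k x" unfolding e f_def
      by (intro bexI[of _ "(\<beta>, y)"]) (use h in \<open>auto simp: X'_sx\<close>)
  qed
  have cl: "sact ?X' n \<gamma> x \<in> sx ?X' l" and nat: "f l (sact ?X' n \<gamma> x) = sact ?S n \<gamma> (f n x)"
    if g: "\<gamma> \<in> dmaps l n" and x: "x \<in> sx ?X' n" for l n \<gamma> x
  proof -
    obtain \<beta> y where e: "x = (\<beta>, y)" by (cases x)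
    have h: "\<beta> \<in> dmaps n m" "y \<in> fib T \<alpha> m b \<beta>" using x unfolding e X'_sx by auto
    show "sact ?X' n \<gamma> x \<in> sx ?X' l"
      unfolding e spc_total_sact X'_sx using dcomp_in[OF h(1) g] blend_snd_in(1)[OF b h(1) g h(2)] by simp
    show "f l (sact ?X' n \<gamma> x) = sact ?S n \<gamma> (f n x)"
      unfolding e f_def using blend_snd_in(2)[OF b h(1) g h(2)] by simp
  qed
  have S: "is_sset ?S" by (rule is_sset_full_sub[OF X])
  have X': "is_sset ?X'" by (rule is_sset_bij[OF S bij cl nat])
  have fs: "simp_map ?X' ?S f" by (rule simp_mapI) (use bij_betw_apply[OF bij] nat in auto)
  show ?thesis
    by (rule left_fibration_bij[OF S_lf X' fs bij]) (simp add: f_def split: prod.split)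
qed

text \<open>The fibres over a face only depend on that face, which makes \<open>blend T\<close> a simplicial map.\<close>

lemma fib_pull:
  assumes b: "b \<in> sx B m" "\<gamma> \<in> dmaps k m" "\<beta> \<in> dmaps l k"
  shows "fib T (dcomp \<alpha> \<gamma>) k (sact B m \<gamma> b) \<beta> = fib T \<alpha> m b (dcomp \<gamma> \<beta>)"
    and "rename T (dcomp \<alpha> \<gamma>) k (sact B m \<gamma> b) \<beta> = rename T \<alpha> m b (dcomp \<gamma> \<beta>)"
proof -
  have 0: "dcomp (dcomp \<alpha> \<gamma>) \<beta> = dcomp \<alpha> (dcomp \<gamma> \<beta>)" by (rule dcomp_assoc[OF b(2,3)])
  have 1: "sact B k [\<beta> ! i] (sact B m \<gamma> b) = sact B m [dcomp \<gamma> \<beta> ! i] b"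
      "dcomp \<alpha> \<gamma> ! (\<beta> ! i) = \<alpha> ! (dcomp \<gamma> \<beta> ! i)" if "i < length \<beta>" for i
    using that dmaps_length[OF b(3)] dmaps_length[OF b(2)] dmaps_nth_le[OF b(3), of i]
      sact_vertex[OF F1.base b(2,1), of "\<beta> ! i"] by (auto simp: dcomp_nth)
  have 2: "snd (F1 k (sact B m \<gamma> b)) \<beta> [i] z = snd (F1 m b) (dcomp \<gamma> \<beta>) [i] z"
    if "i < length \<beta>" "z \<in> fst (F1 m b) (dcomp \<gamma> \<beta>)" for i z
    using F1.pull_snd[OF b sing_in that(2), of i] that(1) dmaps_length[OF b(3)] by simp
  have "fib1 T (dcomp \<alpha> \<gamma>) k (sact B m \<gamma> b) \<beta> = fib1 T \<alpha> m b (dcomp \<gamma> \<beta>)"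
    unfolding fib1_def F1.pull_fst[OF b] using 1 2 by auto
  then show "fib T (dcomp \<alpha> \<gamma>) k (sact B m \<gamma> b) \<beta> = fib T \<alpha> m b (dcomp \<gamma> \<beta>)"
    unfolding fib_def 0 F0.pull_fst[OF b] by simp
  show "rename T (dcomp \<alpha> \<gamma>) k (sact B m \<gamma> b) \<beta> = rename T \<alpha> m b (dcomp \<gamma> \<beta>)"
    using sset_comp[OF F1.base b(2,3,1)] by (intro ext) (simp add: rename_def name_def 0)
qed

lemma blend_pull:
  assumes b: "b \<in> sx B m" "\<gamma> \<in> dmaps k m"
  shows "blend T k (dcomp \<alpha> \<gamma>, sact B m \<gamma> b) = sact spaces m \<gamma> (blend T m (\<alpha>, b))"
proof -
  have "blend T k (dcomp \<alpha> \<gamma>, sact B m \<gamma> b) = spc_norm k (blend T k (dcomp \<alpha> \<gamma>, sact B m \<gamma> b))"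
    unfolding blend_def by (simp add: spc_norm_idem)
  also have "\<dots> = spc_norm k (\<lambda>\<beta>. fst (blend T m (\<alpha>, b)) (dcomp \<gamma> \<beta>), \<lambda>\<beta>. snd (blend T m (\<alpha>, b)) (dcomp \<gamma> \<beta>))"
  proof (rule spc_norm_cong, goal_cases)
    case (1 l \<beta>)
    then show ?case using fib_pull(1)[OF b 1] blend_fst[OF dcomp_in[OF b(2) 1]] by (simp add: blend_fst)
  next
    case (2 l j \<beta> \<delta> y)
    have y: "y \<in> fib T (dcomp \<alpha> \<gamma>) k (sact B m \<gamma> b) \<beta>" using 2(3) blend_fst[OF 2(1)] by simp
    have y1: "y \<in> fib T \<alpha> m b (dcomp \<gamma> \<beta>)" using y fib_pull(1)[OF b 2(1)] by simp
    have r: "rename T \<alpha> m b (dcomp \<gamma> \<beta>) y \<in> fst (F1 m b) (dcomp \<gamma> \<beta>)"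
      using bij_betw_apply[OF rename_bij[OF b(1) dcomp_in[OF b(2) 2(1)]] y1] by (simp add: fib1_def)
    show ?case
      unfolding snd_conv blend_snd[OF 2(1,2) y] blend_snd[OF dcomp_in[OF b(2) 2(1)] 2(2) y1]
        fib_pull[OF b dcomp_in[OF 2(1,2)]] fib_pull(2)[OF b 2(1)] F1.pull_snd[OF b 2(1,2) r]
        dcomp_assoc[OF 2(1,2)] ..
  qed
  finally show ?thesis unfolding spaces_sact using dmaps_length[OF b(2)] by simp
qed

lemma blend_map: "simp_map (prod_sset (std_simplex n) B) spaces (blend T)"
proof (rule simp_mapI)
  show "blend T m z \<in> sx spaces m" if "z \<in> sx (prod_sset (std_simplex n) B) m" for m z
  proof -
    obtain \<alpha> b where z: "z = (\<alpha>, b)" by (cases z)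
    have "b \<in> sx B m" using that z by simp
    then show ?thesis unfolding spaces_sx z using blend_fibration by (simp add: blend_def spc_norm_idem)
  qed
  show "blend T k (sact (prod_sset (std_simplex n) B) m \<gamma> z) = sact spaces m \<gamma> (blend T m z)"
    if "\<gamma> \<in> dmaps k m" "z \<in> sx (prod_sset (std_simplex n) B) m" for k m \<gamma> z
    using that by (cases z) (simp add: blend_pull)
qed

lemma blend_F0:
  assumes b: "b \<in> sx B m" and a: "\<alpha> \<in> dmaps m n" "set \<alpha> \<subseteq> T"
  shows "blend T m (\<alpha>, b) = F0 m b"
proof -
  have sub: "set (dcomp \<alpha> \<beta>) \<subseteq> T" if "\<beta> \<in> dmaps k m" for \<beta> k
    using dcomp_set[OF that a(1)] a(2) by blast
  have fe: "fib T \<alpha> m b \<beta> = fst (F0 m b) \<beta>" "rename T \<alpha> m b \<beta> = name m b \<beta>" if "\<beta> \<in> dmaps k m" for \<beta> k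
    using sub[OF that] by (auto simp: fib_def rename_def)
  have "blend T m (\<alpha>, b) = spc_norm m (blend T m (\<alpha>, b))" unfolding blend_def by (simp add: spc_norm_idem)
  also have "\<dots> = spc_norm m (F0 m b)"
  proof (rule spc_norm_cong, goal_cases)
    case (1 k \<beta>)
    then show ?case by (simp add: blend_fst fe)
  next
    case (2 k l \<beta> \<gamma> y)
    have y: "y \<in> fst (F0 m b) \<beta>" using 2(3) by (simp add: blend_fst[OF 2(1)] fe(1)[OF 2(1)])
    show ?case
      by (rule blend_snd_eq[OF b 2(1,2)])
        (use y F0.fib_in[OF b 2(1,2) y] name_nat[OF b 2(1,2) y] in \<open>simp_all add: fe[OF 2(1)] fe[OF dcomp_in[OF 2(1,2)]]\<close>)
  qed
  also have "\<dots> = F0 m b" by (rule F0.normal[OF b])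
  finally show ?thesis .
qed

lemma blend_F1:
  assumes b: "b \<in> sx B m" and a: "\<alpha> \<in> dmaps m n" "set \<alpha> \<inter> T = {}"
  shows "blend T m (\<alpha>, b) = F1 m b"
proof -
  have an: "\<alpha> ! j \<notin> T" if "j \<le> m" for j
  proof -
    have "\<alpha> ! j \<in> set \<alpha>" using that dmaps_length[OF a(1)] by (intro nth_mem) simp
    then show ?thesis using a(2) by blast
  qed
  have nsub: "\<not> set (dcomp \<alpha> \<beta>) \<subseteq> T" if "\<beta> \<in> dmaps k m" for \<beta> k
  proof -
    have "dcomp \<alpha> \<beta> ! 0 \<in> set (dcomp \<alpha> \<beta>)" by (rule nth_mem) (simp add: dmaps_length[OF that])
    moreover have "dcomp \<alpha> \<beta> ! 0 \<notin> T" using an[OF dmaps_nth_le[OF that, of 0]] dmaps_length[OF that] by (simp add: dcomp_nth)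
    ultimately show ?thesis by blast
  qed
  have fe: "fib T \<alpha> m b \<beta> = fst (F1 m b) \<beta>" "rename T \<alpha> m b \<beta> = (\<lambda>y. y)" if be: "\<beta> \<in> dmaps k m" for \<beta> k
  proof -
    have "\<alpha> ! (\<beta> ! i) \<notin> T" if "i < length \<beta>" for i
      using an[OF dmaps_nth_le[OF be, of i]] that dmaps_length[OF be] by simp
    then show "fib T \<alpha> m b \<beta> = fst (F1 m b) \<beta>" using nsub[OF be] by (auto simp: fib_def fib1_def)
    show "rename T \<alpha> m b \<beta> = (\<lambda>y. y)" using nsub[OF be] by (simp add: rename_def fun_eq_iff)
  qed
  have "blend T m (\<alpha>, b) = spc_norm m (blend T m (\<alpha>, b))" unfolding blend_def by (simp add: spc_norm_idem)
  also have "\<dots> = spc_norm m (F1 m b)"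
  proof (rule spc_norm_cong, goal_cases)
    case (1 k \<beta>)
    then show ?case by (simp add: blend_fst fe)
  next
    case (2 k l \<beta> \<gamma> y)
    have y: "y \<in> fst (F1 m b) \<beta>" using 2(3) by (simp add: blend_fst[OF 2(1)] fe(1)[OF 2(1)])
    show ?case
      by (rule blend_snd_eq[OF b 2(1,2)])
        (use y F1.fib_in[OF b 2(1,2) y] in \<open>simp_all add: fe[OF 2(1)] fe[OF dcomp_in[OF 2(1,2)]]\<close>)
  qed
  also have "\<dots> = F1 m b" by (rule F1.normal[OF b])
  finally show ?thesis .
qed

text \<open>Simplices of \<open>Fun\<close> are required to be undefined outside their domain.\<close>

definition blend_simplex :: "nat \<Rightarrow> nat set \<Rightarrow> nat \<Rightarrow> nat list \<times> 'b \<Rightarrow> 's spc" where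
  "blend_simplex n T = (\<lambda>m z. if z \<in> sx (prod_sset (std_simplex n) B) m then blend T m z else undefined)"

lemma blend_simplex_in: "blend_simplex n T \<in> sx (Fun B spaces) n"
proof -
  have P: "is_sset (prod_sset (std_simplex n) B)"
    by (rule is_ssetI) (auto simp: dcomp_in sset_act[OF F1.base] sset_id[OF F1.base] sset_comp[OF F1.base]
      dcomp_did dmaps_length dcomp_assoc)
  have "simp_map (prod_sset (std_simplex n) B) spaces (blend_simplex n T)"
  proof (rule simp_mapI)
    show "blend_simplex n T m z \<in> sx spaces m" if "z \<in> sx (prod_sset (std_simplex n) B) m" for m z
      using simp_map_in[OF blend_map that] that by (simp add: blend_simplex_def)
    show "blend_simplex n T k (sact (prod_sset (std_simplex n) B) m \<gamma> z) = sact spaces m \<gamma> (blend_simplex n T m z)"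
      if "\<gamma> \<in> dmaps k m" "z \<in> sx (prod_sset (std_simplex n) B) m" for k m \<gamma> z
      using simp_map_nat[OF blend_map that] sset_act[OF P that] that(2) unfolding blend_simplex_def by simp
  qed
  then show ?thesis unfolding Fun_sx by (simp add: blend_simplex_def)
qed

lemma blend_simplex_act:
  assumes g: "\<gamma> \<in> dmaps k n"
  shows "sact (Fun B spaces) n \<gamma> (blend_simplex n T) = blend_simplex k {i. i \<le> k \<and> \<gamma> ! i \<in> T}"
proof (intro ext)
  fix m z
  let ?T = "{i. i \<le> k \<and> \<gamma> ! i \<in> T}"
  show "sact (Fun B spaces) n \<gamma> (blend_simplex n T) m z = blend_simplex k ?T m z"
  proof (cases "z \<in> sx (prod_sset (std_simplex k) B) m")
    case False
    then show ?thesis using dmaps_length[OF g] by (simp add: Fun_sact blend_simplex_def del: prod_sx)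
  next
    case True
    obtain \<alpha> b where z: "z = (\<alpha>, b)" by (cases z)
    have a: "\<alpha> \<in> dmaps m k" and b: "b \<in> sx B m" using True z by auto
    have v: "dcomp \<gamma> \<alpha> ! j \<in> T \<longleftrightarrow> \<alpha> ! j \<in> ?T" if "j \<le> m" for j
      using that dmaps_nth_le[OF a that] dmaps_length[OF a] by (simp add: dcomp_nth)
    have s: "set (dcomp (dcomp \<gamma> \<alpha>) \<beta>) \<subseteq> T \<longleftrightarrow> set (dcomp \<alpha> \<beta>) \<subseteq> ?T" if be: "\<beta> \<in> dmaps l m" for \<beta> l
    proof -
      have "\<beta> ! i \<le> m" if "i < length \<beta>" for i using dmaps_nth_le[OF be, of i] that dmaps_length[OF be] by simp
      then show ?thesis using v by (auto simp: subset_iff in_set_conv_nth dcomp_nth)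
    qed
    have f: "fib T (dcomp \<gamma> \<alpha>) m b \<beta> = fib ?T \<alpha> m b \<beta>" "rename T (dcomp \<gamma> \<alpha>) m b \<beta> = rename ?T \<alpha> m b \<beta>"
      if be: "\<beta> \<in> dmaps l m" for \<beta> l
    proof -
      have "\<beta> ! i \<le> m" if "i < length \<beta>" for i using dmaps_nth_le[OF be, of i] that dmaps_length[OF be] by simp
      then have "fib1 T (dcomp \<gamma> \<alpha>) m b \<beta> = fib1 ?T \<alpha> m b \<beta>" using v unfolding fib1_def by auto
      then show "fib T (dcomp \<gamma> \<alpha>) m b \<beta> = fib ?T \<alpha> m b \<beta>" unfolding fib_def s[OF be] by simp
      show "rename T (dcomp \<gamma> \<alpha>) m b \<beta> = rename ?T \<alpha> m b \<beta>" unfolding rename_def s[OF be] ..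
    qed
    have "blend T m (dcomp \<gamma> \<alpha>, b) = blend ?T m (\<alpha>, b)"
      unfolding blend_def prod.case by (rule spc_norm_cong) (simp_all add: f f[OF dcomp_in])
    moreover have "dcomp \<gamma> \<alpha> \<in> dmaps m n" by (rule dcomp_in[OF g a])
    ultimately show ?thesis using True b dmaps_length[OF g] by (simp add: Fun_sact blend_simplex_def z)
  qed
qed

lemma blend_equivalence: "equivalence (Fun B spaces) (blend_simplex 1 {0})"
proof -
  have set1: "{l. l \<le> (1::nat) \<and> [i, j] ! l \<in> T} = (if i \<in> T then {0} else {}) \<union> (if j \<in> T then {1} else {})" for i j :: nat and T
  proof (rule set_eqI)
    fix l :: nat
    consider "l = 0" | "l = 1" | "l > 1" by linarith
    then show "l \<in> {l. l \<le> 1 \<and> [i, j] ! l \<in> T} \<longleftrightarrow> l \<in> (if i \<in> T then {0} else {}) \<union> (if j \<in> T then {1} else {})"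
      by cases (auto simp: One_nat_def)
  qed
  have act: "sact (Fun B spaces) n [i, j] (blend_simplex n T) =
      blend_simplex 1 ((if i \<in> T then {0} else {}) \<union> (if j \<in> T then {1} else {}))"
    if "i \<le> j" "j \<le> n" for i j n T
    using blend_simplex_act[OF pair_in[OF that]] unfolding set1 .
  show ?thesis
    unfolding equivalence_def
    by (rule conjI[OF blend_simplex_in], rule bexI[of _ "blend_simplex 1 {1}", OF _ blend_simplex_in],
        rule bexI[of _ "blend_simplex 2 {0, 2}", OF _ blend_simplex_in],
        rule bexI[of _ "blend_simplex 2 {1}", OF _ blend_simplex_in]) (simp add: act)
qed

end

lemma vmap_vertex:
  assumes H: "H \<in> sx (Fun B X) 0"
  shows "H m z = (if z \<in> sx (prod_sset (std_simplex 0) B) m then vmap H m (snd z) else undefined)"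
proof (cases "z \<in> sx (prod_sset (std_simplex 0) B) m")
  case True
  then have "z = (cst m 0, snd z)" by (cases z) (simp add: dmaps_0 del: replicate_Suc)
  then show ?thesis using True unfolding vmap_def by simp
next
  case False
  with H show ?thesis unfolding Fun_sx by presburger
qed

text \<open>A map of left fibrations that is an isomorphism onto a full simplicial subset is fully faithful
  on fibres, and the edges into \<open>V\<close> make it essentially surjective. Carried over along the identifications
  \<open>e0\<close> and \<open>e1\<close> it is a dense full inclusion, and the edge from \<open>H0\<close> to \<open>H1\<close> is the simplex \<open>X\<^sub>T\<close>
  for \<open>T = {0}\<close>: an element of \<open>E0\<close>, regarded in \<open>E1\<close> by means of \<open>\<psi>\<close>, gives an element of
  \<open>std_simplex 1 \<times> E1\<close> over every simplex of the cylinder, and this is the required transport.\<close>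

theorem full_dense_map_presents_equivalence:
  assumes B: "is_sset B" and H0: "H0 \<in> sx (Fun B spaces) 0" and H1: "H1 \<in> sx (Fun B spaces) 0"
    and c0: "classifies B (vmap H0) E0 p0 e0" and c1: "classifies B (vmap H1) E1 p1 e1"
    and \<psi>: "simp_map E0 E1 \<psi>" and \<psi>p: "\<And>n x. x \<in> sx E0 n \<Longrightarrow> p1 n (\<psi> n x) = p0 n x"
    and bij: "\<And>n. bij_betw (\<psi> n) (sx E0 n) (sx (full_sub E1 V) n)"
    and dense: "\<And>x. x \<in> sx E1 0 \<Longrightarrow> \<exists>e\<in>sx E1 1. p1 1 e = sact B 0 [0, 0] (p1 0 x) \<and>
      sact E1 1 [0] e = x \<and> sact E1 1 [1] e \<in> V"
  shows "\<exists>w. equivalence (Fun B spaces) w \<and> sact (Fun B spaces) 1 [0] w = H0 \<and>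
    sact (Fun B spaces) 1 [1] w = H1 \<and> presents B E0 p0 e0 E1 p1 e1 \<psi> w"
proof -
  have f0: "simp_map B spaces (vmap H0)" and f1: "simp_map B spaces (vmap H1)"
    and E0: "is_sset E0" and E1: "is_sset E1"
    and e0: "simp_map E0 (el B (vmap H0)) e0" and e1: "simp_map E1 (el B (vmap H1)) e1"
    and b0: "\<And>n. bij_betw (e0 n) (sx E0 n) (sx (el B (vmap H0)) n)"
    and b1: "\<And>n. bij_betw (e1 n) (sx E1 n) (sx (el B (vmap H1)) n)"
    and e0p: "\<And>n x. x \<in> sx E0 n \<Longrightarrow> fst (e0 n x) = p0 n x" and e1p: "\<And>n x. x \<in> sx E1 n \<Longrightarrow> fst (e1 n x) = p1 n x"
    and p0s: "simp_map E0 B p0" and p1s: "simp_map E1 B p1"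
    using c0 c1 unfolding classifies_def left_fibration_def by blast+
  interpret F0: space_family B "vmap H0" using B f0 by unfold_locales
  interpret F1: space_family B "vmap H1" using B f1 by unfold_locales
  define i0 where "i0 = (\<lambda>n. inv_into (sx E0 n) (e0 n))"
  define \<theta> where "\<theta> = (\<lambda>n z. e1 n (\<psi> n (i0 n z)))"
  define W where "W = e1 0 ` (V \<inter> sx E1 0)"
  have i0_in: "i0 n z \<in> sx E0 n" and e0_i0: "e0 n (i0 n z) = z" if "z \<in> sx (el B (vmap H0)) n" for n z
    using that inv_into_into[of z "e0 n" "sx E0 n"] f_inv_into_f[of z "e0 n" "sx E0 n"]
    unfolding i0_def bij_betw_imp_surj_on[OF b0] by auto
  have i0_e0: "i0 n (e0 n x) = x" if "x \<in> sx E0 n" for n x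
    unfolding i0_def by (rule inv_into_f_f[OF bij_betw_imp_inj_on[OF b0] that])
  have \<theta>_e0: "\<theta> n (e0 n x) = e1 n (\<psi> n x)" if "x \<in> sx E0 n" for n x
    unfolding \<theta>_def using i0_e0[OF that] by simp
  have e1_inj: "x = y" if "e1 n x = e1 n y" "x \<in> sx E1 n" "y \<in> sx E1 n" for n x y
    using inj_onD[OF bij_betw_imp_inj_on[OF b1] that] .
  have W_iff: "e1 0 x \<in> W \<longleftrightarrow> x \<in> V" if "x \<in> sx E1 0" for x
    unfolding W_def using that e1_inj[of 0] by auto
  have full: "e1 n x \<in> sx (full_sub (el B (vmap H1)) W) n \<longleftrightarrow> x \<in> sx (full_sub E1 V) n"
    if x: "x \<in> sx E1 n" for n x
  proof -
    have "sact (el B (vmap H1)) n [i] (e1 n x) \<in> W \<longleftrightarrow> sact E1 n [i] x \<in> V" if "i \<le> n" for i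
      using W_iff[OF sset_act[OF E1 sing_in[OF that] x]] simp_map_nat[OF e1 sing_in[OF that] x] by simp
    then show ?thesis unfolding full_sub_sx using x simp_map_in[OF e1 x] by auto
  qed
  interpret dense_full_inclusion B "vmap H0" "vmap H1" \<theta> W
  proof unfold_locales
    show "simp_map (el B (vmap H0)) (el B (vmap H1)) \<theta>"
    proof (rule simp_mapI)
      show "\<theta> n z \<in> sx (el B (vmap H1)) n" if "z \<in> sx (el B (vmap H0)) n" for n z
        unfolding \<theta>_def by (rule simp_map_in[OF e1 simp_map_in[OF \<psi> i0_in[OF that]]])
      show "\<theta> m (sact (el B (vmap H0)) n \<alpha> z) = sact (el B (vmap H1)) n \<alpha> (\<theta> n z)"
        if a: "\<alpha> \<in> dmaps m n" and z: "z \<in> sx (el B (vmap H0)) n" for m n \<alpha> z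
      proof -
        have "sact (el B (vmap H0)) n \<alpha> z = e0 m (sact E0 n \<alpha> (i0 n z))"
          using simp_map_nat[OF e0 a i0_in[OF z]] e0_i0[OF z] by simp
        then show ?thesis
          using \<theta>_e0[OF sset_act[OF E0 a i0_in[OF z]]] simp_map_nat[OF \<psi> a i0_in[OF z]]
            simp_map_nat[OF e1 a simp_map_in[OF \<psi> i0_in[OF z]]] by (simp add: \<theta>_def)
      qed
    qed
    show "fst (\<theta> n z) = fst z" if "z \<in> sx (el B (vmap H0)) n" for z n
      using e1p[OF simp_map_in[OF \<psi> i0_in[OF that]]] \<psi>p[OF i0_in[OF that]] e0p[OF i0_in[OF that]] e0_i0[OF that]
      by (simp add: \<theta>_def)
    show "bij_betw (\<theta> n) (sx (el B (vmap H0)) n) (sx (full_sub (el B (vmap H1)) W) n)" for n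
    proof (rule bij_betwI')
      fix x y assume xy: "x \<in> sx (el B (vmap H0)) n" "y \<in> sx (el B (vmap H0)) n"
      have "x = y" if "\<theta> n x = \<theta> n y"
      proof -
        have "\<psi> n (i0 n x) = \<psi> n (i0 n y)"
          using that e1_inj[of n] simp_map_in[OF \<psi> i0_in[OF xy(1)]] simp_map_in[OF \<psi> i0_in[OF xy(2)]]
          unfolding \<theta>_def by blast
        then have "i0 n x = i0 n y"
          by (rule inj_onD[OF bij_betw_imp_inj_on[OF bij[of n]] _ i0_in[OF xy(1)] i0_in[OF xy(2)]])
        then have "e0 n (i0 n x) = e0 n (i0 n y)" by (rule arg_cong)
        then show ?thesis unfolding e0_i0[OF xy(1)] e0_i0[OF xy(2)] .
      qed
      then show "(\<theta> n x = \<theta> n y) = (x = y)" by blast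
    next
      fix x assume x: "x \<in> sx (el B (vmap H0)) n"
      have "\<psi> n (i0 n x) \<in> sx (full_sub E1 V) n" by (rule bij_betw_apply[OF bij i0_in[OF x]])
      then show "\<theta> n x \<in> sx (full_sub (el B (vmap H1)) W) n"
        unfolding \<theta>_def using full[OF simp_map_in[OF \<psi> i0_in[OF x]]] by blast
    next
      fix y assume y: "y \<in> sx (full_sub (el B (vmap H1)) W) n"
      then have "y \<in> e1 n ` sx E1 n" unfolding bij_betw_imp_surj_on[OF b1] full_sub_sx by simp
      then obtain z where z: "z \<in> sx E1 n" "y = e1 n z" by blast
      then have "z \<in> \<psi> n ` sx E0 n" unfolding bij_betw_imp_surj_on[OF bij] using full[OF z(1)] y by simp
      then obtain x where x: "x \<in> sx E0 n" "z = \<psi> n x" by blast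
      show "\<exists>x\<in>sx (el B (vmap H0)) n. y = \<theta> n x"
        by (rule bexI[of _ "e0 n x"]) (simp_all add: \<theta>_e0[OF x(1)] z x(2) simp_map_in[OF e0 x(1)])
    qed
    show "\<exists>e\<in>sx (el B (vmap H1)) 1. fst e = sact B 0 [0, 0] (fst x) \<and>
        sact (el B (vmap H1)) 1 [0] e = x \<and> sact (el B (vmap H1)) 1 [1] e \<in> W"
      if x: "x \<in> sx (el B (vmap H1)) 0" for x
    proof -
      have "x \<in> e1 0 ` sx E1 0" using x unfolding bij_betw_imp_surj_on[OF b1] .
      then obtain z where z: "z \<in> sx E1 0" "x = e1 0 z" by blast
      obtain e where e: "e \<in> sx E1 1" "p1 1 e = sact B 0 [0, 0] (p1 0 z)" "sact E1 1 [0] e = z" "sact E1 1 [1] e \<in> V"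
        using dense[OF z(1)] by blast
      have v: "sact E1 1 [1] e \<in> sx E1 0" by (rule sset_act[OF E1 sing_in e(1)]) simp
      have "sact (el B (vmap H1)) 1 [0] (e1 1 e) = x"
        using simp_map_nat[OF e1 sing_in[of 0 1] e(1)] e(3) z(2) by simp
      moreover have "sact (el B (vmap H1)) 1 [1] (e1 1 e) \<in> W"
        using simp_map_nat[OF e1 sing_in[of 1 1] e(1)] W_iff[OF v] e(4) by simp
      ultimately show ?thesis
        using simp_map_in[OF e1 e(1)] e1p[OF e(1)] e1p[OF z(1)] e(2) z(2) by auto
    qed
  qed
  let ?w = "blend_simplex 1 {0}"
  have end0: "sact (Fun B spaces) 1 [0] ?w = H0"
  proof -
    have "sact (Fun B spaces) 1 [0] ?w = blend_simplex 0 {0}"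
      using blend_simplex_act[OF sing_in[of 0 1], of "{0}"] by (simp add: conj_commute cong: conj_cong)
    also have "\<dots> = H0"
      by (intro ext) (auto simp: vmap_vertex[OF H0] blend_simplex_def dmaps_0 intro!: blend_F0[of _ _ _ 0] cst_in simp del: replicate_Suc)
    finally show ?thesis .
  qed
  have end1: "sact (Fun B spaces) 1 [1] ?w = H1"
  proof -
    have "sact (Fun B spaces) 1 [1] ?w = blend_simplex 0 {}"
      using blend_simplex_act[OF sing_in[of 1 1], of "{0}"] by (simp cong: conj_cong)
    also have "\<dots> = H1"
      by (intro ext) (auto simp: vmap_vertex[OF H1] blend_simplex_def dmaps_0 intro!: blend_F1[of _ _ _ 0] cst_in simp del: replicate_Suc)
    finally show ?thesis .
  qed
  \<comment> \<open>The transport is constant in \<open>E1\<close>; only the name changes once the vertex 1 is reached.\<close>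
  define h where "h = (\<lambda>n (\<alpha>, x). ((\<alpha>, p0 n x), if set \<alpha> \<subseteq> {0::nat} then snd (e0 n x) else snd (e1 n (\<psi> n x))))"
  have top: "\<alpha> \<in> dmaps n 1 \<Longrightarrow> dcomp \<alpha> (did n) = \<alpha>" for \<alpha> n using dcomp_did dmaps_length by blast
  have base: "sact B n (did n) (p0 n x) = p0 n x" if "x \<in> sx E0 n" for n x
    by (rule sset_id[OF B simp_map_in[OF p0s that]])
  have wz: "?w n (\<alpha>, b) = blend {0} n (\<alpha>, b)" if "\<alpha> \<in> dmaps n 1" "b \<in> sx B n" for n \<alpha> b
    using that by (simp add: blend_simplex_def)
  have s1: "snd (e1 n (\<psi> n x)) \<in> fst (vmap H1 n (p0 n x)) (did n)"
    and s0: "snd (e0 n x) \<in> fst (vmap H0 n (p0 n x)) (did n)"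
    and nm: "name n (p0 n x) (did n) (snd (e0 n x)) = snd (e1 n (\<psi> n x))"
    and pair1: "e1 n (\<psi> n x) = (p0 n x, snd (e1 n (\<psi> n x)))"
    if x: "x \<in> sx E0 n" for n x
  proof -
    have a: "e1 n (\<psi> n x) = (p0 n x, snd (e1 n (\<psi> n x)))" "e0 n x = (p0 n x, snd (e0 n x))"
      using e1p[OF simp_map_in[OF \<psi> x]] \<psi>p[OF x] e0p[OF x] by (simp_all add: prod_eq_iff)
    show "snd (e1 n (\<psi> n x)) \<in> fst (vmap H1 n (p0 n x)) (did n)"
      using simp_map_in[OF e1 simp_map_in[OF \<psi> x]] a(1) el_sx by metis
    show "snd (e0 n x) \<in> fst (vmap H0 n (p0 n x)) (did n)"
      using simp_map_in[OF e0 x] a(2) el_sx by metis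
    show "name n (p0 n x) (did n) (snd (e0 n x)) = snd (e1 n (\<psi> n x))"
      using \<theta>_e0[OF x] a(2) base[OF x] by (simp add: name_def)
    show "e1 n (\<psi> n x) = (p0 n x, snd (e1 n (\<psi> n x)))" by (rule a(1))
  qed
  have h_fib: "snd (h n (\<alpha>, x)) \<in> fib {0} \<alpha> n (p0 n x) (did n)"
    and h_ren: "rename {0} \<alpha> n (p0 n x) (did n) (snd (h n (\<alpha>, x))) = snd (e1 n (\<psi> n x))"
    if a: "\<alpha> \<in> dmaps n 1" and x: "x \<in> sx E0 n" for n \<alpha> x
  proof -
    have "(sact B n [did n ! i] (p0 n x), snd (vmap H1 n (p0 n x)) (did n) [i] (snd (e1 n (\<psi> n x)))) \<in> W"
      if i: "i < length (did n)" for i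
    proof -
      have i': "[i] \<in> dmaps 0 n" "did n ! i = i" using i sing_in[of i n] by (auto simp: did_nth)
      have "sact (el B (vmap H1)) n [i] (e1 n (\<psi> n x)) \<in> W"
        using full[OF simp_map_in[OF \<psi> x]] bij_betw_apply[OF bij x] i unfolding full_sub_sx by auto
      then show ?thesis using pair1[OF x] el_sact i'(2) by metis
    qed
    then show "snd (h n (\<alpha>, x)) \<in> fib {0} \<alpha> n (p0 n x) (did n)"
      using s0[OF x] s1[OF x] by (auto simp: h_def fib_def fib1_def top[OF a])
    show "rename {0} \<alpha> n (p0 n x) (did n) (snd (h n (\<alpha>, x))) = snd (e1 n (\<psi> n x))"
      using nm[OF x] by (simp add: h_def rename_def top[OF a])
  qed
  have hs: "simp_map (prod_sset (std_simplex 1) E0) (el (prod_sset (std_simplex 1) B) ?w) h"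
  proof (rule simp_mapI)
    fix n z assume "z \<in> sx (prod_sset (std_simplex 1) E0) n"
    then obtain \<alpha> x where z: "z = (\<alpha>, x)" "\<alpha> \<in> dmaps n 1" "x \<in> sx E0 n" by (cases z) auto
    have hz: "h n z = ((\<alpha>, p0 n x), snd (h n (\<alpha>, x)))" by (simp add: h_def z(1))
    show "h n z \<in> sx (el (prod_sset (std_simplex 1) B) ?w) n"
      unfolding hz el_sx wz[OF z(2) simp_map_in[OF p0s z(3)]] blend_fst[OF did_in]
      using z(2) h_fib[OF z(2,3)] simp_map_in[OF p0s z(3)] by simp
  next
    fix m n \<gamma> z assume g: "\<gamma> \<in> dmaps m n" and "z \<in> sx (prod_sset (std_simplex 1) E0) n"
    then obtain \<alpha> x where z: "z = (\<alpha>, x)" "\<alpha> \<in> dmaps n 1" "x \<in> sx E0 n" by (cases z) auto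
    let ?b = "p0 n x" and ?y = "snd (h n (\<alpha>, x))" and ?y' = "snd (h m (dcomp \<alpha> \<gamma>, sact E0 n \<gamma> x))"
    note b = simp_map_in[OF p0s z(3)] and gx = sset_act[OF E0 g z(3)] and ag = dcomp_in[OF z(2) g]
    have pb: "p0 m (sact E0 n \<gamma> x) = sact B n \<gamma> ?b" by (rule simp_map_nat[OF p0s g z(3)])
    have dg: "dcomp (did n) \<gamma> = \<gamma>" "dcomp \<gamma> (did m) = \<gamma>"
      using did_dcomp[OF g] dcomp_did[OF dmaps_length[OF g]] by auto
    have pull: "fib {0} (dcomp \<alpha> \<gamma>) m (sact B n \<gamma> ?b) (did m) = fib {0} \<alpha> n ?b (dcomp (did n) \<gamma>)"
      "rename {0} (dcomp \<alpha> \<gamma>) m (sact B n \<gamma> ?b) (did m) = rename {0} \<alpha> n ?b (dcomp (did n) \<gamma>)"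
      using fib_pull[OF b g did_in] dg by simp_all
    have "snd (e1 m (\<psi> m (sact E0 n \<gamma> x))) = snd (vmap H1 n ?b) (did n) \<gamma> (snd (e1 n (\<psi> n x)))"
      using simp_map_nat[OF e1 g simp_map_in[OF \<psi> z(3)]] simp_map_nat[OF \<psi> g z(3)] pair1[OF z(3)] el_sact snd_conv by metis
    then have "snd (blend {0} n (\<alpha>, ?b)) (did n) \<gamma> ?y = ?y'"
      using h_fib[OF ag gx] h_ren[OF ag gx] h_ren[OF z(2,3)] pull
      by (intro blend_snd_eq[OF b did_in g h_fib[OF z(2,3)]]) (simp_all add: pb)
    moreover have "h n z = ((\<alpha>, ?b), ?y)" "h m (sact (prod_sset (std_simplex 1) E0) n \<gamma> z) = ((dcomp \<alpha> \<gamma>, sact B n \<gamma> ?b), ?y')"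
      by (simp_all add: h_def z(1) pb)
    ultimately show "h m (sact (prod_sset (std_simplex 1) E0) n \<gamma> z) = sact (el (prod_sset (std_simplex 1) B) ?w) n \<gamma> (h n z)"
      unfolding wz[OF z(2) b, symmetric] by (simp only: el_sact prod_sact std_simplex_sact)
  qed
  have "presents B E0 p0 e0 E1 p1 e1 \<psi> ?w"
    unfolding presents_def using \<psi> \<psi>p hs
    by (intro conjI exI[of _ h]) (auto simp: h_def)
  then show ?thesis using blend_equivalence end0 end1 by blast
qed

section \<open>Connected components\<close>

lemma kan_complexD:
  assumes "kan_complex X"
  shows "is_sset X" "simp_map X (std_simplex 0) (\<lambda>n x. cst n 0)"
    "1 \<le> n \<Longrightarrow> k \<le> n \<Longrightarrow> horn_lift n k X (std_simplex 0) (\<lambda>n x. cst n 0)"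
  using kan_fibrationD[OF assms[unfolded kan_complex_def]] by blast+

lemma dcomp_cst: "\<beta> \<in> dmaps m n \<Longrightarrow> dcomp (cst n i) \<beta> = cst m i"
  by (rule nth_equalityI) (auto simp: dcomp_nth dmaps_length dmaps_nth_le less_Suc_eq_le simp del: replicate_Suc)

lemma kan_complex_fill:
  assumes X: "kan_complex X" and n: "1 \<le> n" "k \<le> n" and u: "simp_map (horn n k) X u"
  shows "\<exists>x\<in>sx X n. \<forall>m. \<forall>\<beta>\<in>sx (horn n k) m. sact X n \<beta> x = u m \<beta>"
proof -
  have y: "cst n 0 \<in> sx (std_simplex 0) n" by (simp add: cst_in del: replicate_Suc)
  have "cst m 0 = sact (std_simplex 0) n \<beta> (cst n 0)" if "\<beta> \<in> sx (horn n k) m" for m \<beta>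
    using dcomp_cst[OF horn_dmaps[OF that]] by (simp del: replicate_Suc)
  then show ?thesis using horn_liftD[OF kan_complexD(3)[OF X n] y u] by blast
qed

lemma kan_complexI:
  assumes X: "is_sset X"
    and fill: "\<And>n k u. 1 \<le> n \<Longrightarrow> k \<le> n \<Longrightarrow> simp_map (horn n k) X u \<Longrightarrow>
      \<exists>x\<in>sx X n. \<forall>m. \<forall>\<beta>\<in>sx (horn n k) m. sact X n \<beta> x = u m \<beta>"
  shows "kan_complex X"
  unfolding kan_complex_def kan_fibration_def
proof (intro conjI allI impI)
  show "simp_map X (std_simplex 0) (\<lambda>n x. cst n 0)"
    by (rule simp_mapI) (auto simp: cst_in dcomp_cst simp del: replicate_Suc)
  show "horn_lift n k X (std_simplex 0) (\<lambda>n x. cst n 0)" if "1 \<le> n \<and> k \<le> n" for n k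
    unfolding horn_lift_def
  proof (intro allI ballI impI)
    fix u y assume y: "y \<in> sx (std_simplex 0) n" and "simp_map (horn n k) X u \<and>
      (\<forall>m. \<forall>\<beta>\<in>sx (horn n k) m. cst m 0 = sact (std_simplex 0) n \<beta> y)"
    then have u: "simp_map (horn n k) X u" by blast
    have "cst n 0 = y" using y unfolding std_simplex_sx dmaps_0 by blast
    then show "\<exists>x\<in>sx X n. cst n 0 = y \<and> (\<forall>m. \<forall>\<beta>\<in>sx (horn n k) m. sact X n \<beta> x = u m \<beta>)"
      using fill[OF _ _ u] that by blast
  qed
qed (use X is_sset_std_simplex in auto)

lemma edge_relI: "e \<in> sx X 1 \<Longrightarrow> sact X 1 [0] e = x \<Longrightarrow> sact X 1 [1] e = y \<Longrightarrow> (x, y) \<in> edge_rel X"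
  unfolding edge_rel_def by blast

lemma edge_relE:
  assumes "(x, y) \<in> edge_rel X"
  obtains e where "e \<in> sx X 1" "sact X 1 [0] e = x" "sact X 1 [1] e = y"
  using assms unfolding edge_rel_def by blast

lemma equiv_conn: "equiv (sx X 0) (conn X)"
proof -
  have s: "sym ((edge_rel X \<union> (edge_rel X)\<inverse>)\<^sup>*)" by (rule sym_rtrancl) (auto simp: sym_def)
  show ?thesis
    unfolding equiv_def conn_def
  proof (intro conjI)
    show "refl_on (sx X 0) ((edge_rel X \<union> (edge_rel X)\<inverse>)\<^sup>* \<inter> sx X 0 \<times> sx X 0)" by (auto simp: refl_on_def)
    show "sym ((edge_rel X \<union> (edge_rel X)\<inverse>)\<^sup>* \<inter> sx X 0 \<times> sx X 0)" using s unfolding sym_def by blast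
    show "trans ((edge_rel X \<union> (edge_rel X)\<inverse>)\<^sup>* \<inter> sx X 0 \<times> sx X 0)"
      unfolding trans_def by (blast intro: rtrancl_trans)
  qed (auto)
qed

lemma conn_in: "(x, y) \<in> conn X \<Longrightarrow> x \<in> sx X 0 \<and> y \<in> sx X 0"
  unfolding conn_def by blast

lemma conn_sym: "(x, y) \<in> conn X \<Longrightarrow> (y, x) \<in> conn X"
  using equiv_conn[of X] unfolding equiv_def sym_def by blast

lemma conn_edge:
  assumes X: "is_sset X" and e: "e \<in> sx X 1"
  shows "(sact X 1 [0] e, sact X 1 [1] e) \<in> conn X"
proof -
  have "sact X 1 [0] e \<in> sx X 0" "sact X 1 [1] e \<in> sx X 0"
    using sset_act[OF X sing_in e] by auto
  moreover have "(sact X 1 [0] e, sact X 1 [1] e) \<in> (edge_rel X \<union> (edge_rel X)\<inverse>)\<^sup>*"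
    using edge_relI[OF e] by blast
  ultimately show ?thesis unfolding conn_def by blast
qed

lemma conn_vertices:
  assumes X: "is_sset X" and x: "x \<in> sx X n" and ij: "i \<le> n" "j \<le> n"
  shows "(sact X n [i] x, sact X n [j] x) \<in> conn X"
proof -
  have *: "(sact X n [i] x, sact X n [j] x) \<in> conn X" if "i \<le> j" "j \<le> n" for i j
    using conn_edge[OF X sset_act[OF X pair_in[OF that] x]]
      sact_vertex[OF X pair_in[OF that] x, of 0] sact_vertex[OF X pair_in[OF that] x, of 1]
    by (simp add: One_nat_def)
  show ?thesis
  proof (cases "i \<le> j")
    case True
    then show ?thesis using * ij by blast
  next
    case False
    then show ?thesis using *[of j i] ij conn_sym by force
  qed
qed

text \<open>In a Kan complex zigzags of edges compose to single edges.\<close>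

lemma kan_complex_conn_edge:
  assumes X: "kan_complex X" and xy: "(x, y) \<in> conn X"
  obtains e where "e \<in> sx X 1" "sact X 1 [0] e = x" "sact X 1 [1] e = y"
proof -
  note Xs = kan_complexD(1)[OF X]
  have base: "cst 2 0 \<in> sx (std_simplex 0) 2" unfolding std_simplex_sx by (rule cst_in) simp
  have bd: "sact (std_simplex 0) 2 [i, j] (cst 2 0) = cst 1 0" if "i \<le> j" "j \<le> 2" for i j
    unfolding std_simplex_sact by (rule dcomp_cst[OF pair_in[OF that]])
  have fill: "\<exists>t\<in>sx X 2. sact X 2 [l, h] t = e \<and> sact X 2 [l', h'] t = e'"
    if "k \<le> 2" "l < h" "l' < h'" "k \<in> {l, h}" "k \<in> {l', h'}" "{l, h, l', h'} = {0, 1, 2}" "h \<le> 2" "h' \<le> 2"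
      "e \<in> sx X 1" "e' \<in> sx X 1" "sact X 1 [if k = h then 1 else 0] e = sact X 1 [if k = h' then 1 else 0] e'"
    for k l h l' h' e e'
    by (rule fill_two_edges[OF kan_complexD(3)[OF X _ that(1)] Xs is_sset_std_simplex kan_complexD(2)[OF X]
          that(2-6) that(9-11) base]) (use that bd in \<open>auto simp del: replicate_Suc\<close>)
  have xy': "(x, y) \<in> (edge_rel X \<union> (edge_rel X)\<inverse>)\<^sup>*" and x: "x \<in> sx X 0" using xy unfolding conn_def by auto
  from xy' have "\<exists>e\<in>sx X 1. sact X 1 [0] e = x \<and> sact X 1 [1] e = y"
  proof (induction rule: rtrancl_induct)
    case base
    have d: "[0, 0] \<in> dmaps 1 0" by (rule pair_in) auto
    show ?case
      by (rule bexI[of _ "sact X 0 [0, 0] x"])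
        (use sset_act[OF Xs d x] sact_vertex[OF Xs d x, of 0] sact_vertex[OF Xs d x, of 1] sset_id[OF Xs x] in
          \<open>simp_all add: did_0 One_nat_def\<close>)
  next
    case (step y z)
    obtain e where e: "e \<in> sx X 1" "sact X 1 [0] e = x" "sact X 1 [1] e = y" using step.IH by blast
    have v: "sact X 1 [i] (sact X 2 [a, b] t) = sact X 2 [[a, b] ! i] t" if "t \<in> sx X 2" "a \<le> b" "b \<le> 2" "i \<le> 1" for a b i t
      using sact_vertex[OF Xs pair_in[OF that(2,3)] that(1,4)] .
    have sf: "sact X 2 [a, b] t \<in> sx X 1" if "t \<in> sx X 2" "a \<le> b" "b \<le> 2" for a b t
      by (rule sset_act[OF Xs pair_in[OF that(2,3)] that(1)])
    show ?case
    proof (cases "(y, z) \<in> edge_rel X")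
      case True
      then obtain f where f: "f \<in> sx X 1" "sact X 1 [0] f = y" "sact X 1 [1] f = z" by (rule edge_relE)
      obtain t where t: "t \<in> sx X 2" "sact X 2 [0, 1] t = e" "sact X 2 [1, 2] t = f"
        using fill[of 1 0 1 1 2 e f] e f by auto
      show ?thesis
        by (rule bexI[of _ "sact X 2 [0, 2] t"])
          (use v[OF t(1), of 0 2] v[OF t(1), of 0 1] v[OF t(1), of 1 2] t e f sf[OF t(1), of 0 2] in
            \<open>auto simp: One_nat_def\<close>)
    next
      case False
      then have "(z, y) \<in> edge_rel X" using step.hyps(2) by blast
      then obtain f where f: "f \<in> sx X 1" "sact X 1 [0] f = z" "sact X 1 [1] f = y" by (rule edge_relE)
      have tri: "{0, 2, 1, 2} = {0, 1, 2 :: nat}" by auto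
      obtain t where t: "t \<in> sx X 2" "sact X 2 [0, 2] t = e" "sact X 2 [1, 2] t = f"
        using fill[of 2 0 2 1 2 e f] e f tri by auto
      show ?thesis
        by (rule bexI[of _ "sact X 2 [0, 1] t"])
          (use v[OF t(1), of 0 2] v[OF t(1), of 0 1] v[OF t(1), of 1 2] t e f sf[OF t(1), of 0 1] in
            \<open>auto simp: One_nat_def\<close>)
    qed
  qed
  then show thesis using that by blast
qed

lemma conn_map:
  assumes f: "simp_map X Y f" and xy: "(x, y) \<in> conn X"
  shows "(f 0 x, f 0 y) \<in> conn Y"
proof -
  have edge: "(f 0 x, f 0 y) \<in> edge_rel Y" if xy: "(x, y) \<in> edge_rel X" for x y
  proof -
    obtain e where e: "e \<in> sx X 1" "sact X 1 [0] e = x" "sact X 1 [1] e = y" using xy by (rule edge_relE)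
    show ?thesis
      by (rule edge_relI[OF simp_map_in[OF f e(1)]])
        (use simp_map_nat[OF f sing_in e(1), of 0] simp_map_nat[OF f sing_in e(1), of 1] e in auto)
  qed
  have "(x, y) \<in> (edge_rel X \<union> (edge_rel X)\<inverse>)\<^sup>*" using xy unfolding conn_def by blast
  then have "(f 0 x, f 0 y) \<in> (edge_rel Y \<union> (edge_rel Y)\<inverse>)\<^sup>*"
  proof (induction rule: rtrancl_induct)
    case (step y z)
    then have "(f 0 y, f 0 z) \<in> edge_rel Y \<union> (edge_rel Y)\<inverse>" using edge by blast
    with step.IH show ?case by (rule rtrancl_into_rtrancl)
  qed simp
  then show ?thesis using conn_in[OF xy] simp_map_in[OF f] unfolding conn_def by blast
qed

lemma pi0_map_class:
  assumes f: "simp_map X Y f" and x: "x \<in> sx X 0"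
  shows "pi0_map Y f (conn X `` {x}) = conn Y `` {f 0 x}"
proof -
  have "trans (conn Y)" "refl_on (sx X 0) (conn X)" using equiv_conn unfolding equiv_def by blast+
  then show ?thesis
    unfolding pi0_map_def using conn_map[OF f] x by (auto simp: refl_on_def dest: transD)
qed

lemma conn_reflect:
  assumes f: "simp_map X Y f" and inj: "inj_on (pi0_map Y f) (pi0 X)"
    and xy: "x \<in> sx X 0" "y \<in> sx X 0" and c: "(f 0 x, f 0 y) \<in> conn Y"
  shows "(x, y) \<in> conn X"
proof -
  have "pi0_map Y f (conn X `` {x}) = pi0_map Y f (conn X `` {y})"
    unfolding pi0_map_class[OF f xy(1)] pi0_map_class[OF f xy(2)] by (rule equiv_class_eq[OF equiv_conn c])
  then have "conn X `` {x} = conn X `` {y}"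
    using inj_onD[OF inj] xy unfolding pi0_def by (blast intro: quotientI)
  then show ?thesis by (rule eq_equiv_class[OF _ equiv_conn xy(2)])
qed

lemma union_of_componentsD:
  assumes S: "union_of_components S X"
  shows "x \<in> sx S n \<Longrightarrow> x \<in> sx X n"
    "\<alpha> \<in> dmaps m n \<Longrightarrow> x \<in> sx S n \<Longrightarrow> sact S n \<alpha> x = sact X n \<alpha> x"
  using S unfolding union_of_components_def by auto

text \<open>All vertices of a simplex lie in one component.\<close>

lemma union_of_components_closed:
  assumes S: "union_of_components S X" and X: "is_sset X" and x: "x \<in> sx X n"
    and i: "i \<le> n" "sact X n [i] x \<in> sx S 0"
  shows "x \<in> sx S n"
proof -
  have "\<exists>\<C>\<subseteq>pi0 X. \<forall>n. sx S n = {x \<in> sx X n. \<exists>A\<in>\<C>. \<forall>i\<le>n. sact X n [i] x \<in> A}"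
    using S unfolding union_of_components_def by (elim conjE exE) (intro exI conjI)
  then obtain \<C> where C1: "\<C> \<subseteq> pi0 X"
    and C2': "\<forall>n. sx S n = {x \<in> sx X n. \<exists>A\<in>\<C>. \<forall>i\<le>n. sact X n [i] x \<in> A}"
    by (elim exE conjE)
  have C2: "y \<in> sx S n \<longleftrightarrow> y \<in> sx X n \<and> (\<exists>A\<in>\<C>. \<forall>i\<le>n. sact X n [i] y \<in> A)" for y n
    by (subst spec[OF C2']) (rule mem_Collect_eq)
  have v: "sact X n [i] x \<in> sx X 0" by (rule sset_act[OF X sing_in[OF i(1)] x])
  have "\<exists>A\<in>\<C>. \<forall>j\<le>0. sact X 0 [j] (sact X n [i] x) \<in> A" using i(2) unfolding C2 by (rule conjunct2)
  then obtain A where A: "A \<in> \<C>" "sact X 0 [0] (sact X n [i] x) \<in> A" by auto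
  have vA: "sact X n [i] x \<in> A" using A(2) sset_id[OF X v] by (simp add: did_0)
  have Aq: "A \<in> sx X 0 // conn X" using A(1) C1 unfolding pi0_def by blast
  have "sact X n [j] x \<in> A" if "j \<le> n" for j
    by (rule in_quotient_imp_closed[OF equiv_conn Aq vA conn_vertices[OF X x i(1) that]])
  then show ?thesis unfolding C2 using x A(1) by (intro conjI bexI[of _ A] allI impI)
qed

lemma union_of_components_kan:
  assumes S: "union_of_components S X" and Ss: "is_sset S" and X: "kan_complex X"
  shows "kan_complex S"
proof (rule kan_complexI[OF Ss])
  fix n k u assume n: "1 \<le> n" "k \<le> n" and u: "simp_map (horn n k) S u"
  note Xs = kan_complexD(1)[OF X] and D = union_of_componentsD[OF S]
  have "simp_map (horn n k) X u"
  proof (rule simp_mapI)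
    show "u m \<beta> \<in> sx X m" if "\<beta> \<in> sx (horn n k) m" for m \<beta> using D(1) simp_map_in[OF u that] .
    show "u l (sact (horn n k) m \<alpha> \<beta>) = sact X m \<alpha> (u m \<beta>)" if "\<alpha> \<in> dmaps l m" "\<beta> \<in> sx (horn n k) m" for l m \<alpha> \<beta>
      using simp_map_nat[OF u that] D(2)[OF that(1) simp_map_in[OF u that(2)]] by simp
  qed
  then obtain x where x: "x \<in> sx X n" "\<And>m \<beta>. \<beta> \<in> sx (horn n k) m \<Longrightarrow> sact X n \<beta> x = u m \<beta>"
    using kan_complex_fill[OF X n] by blast
  have "sact X n [k] x \<in> sx S 0"
    using x(2)[OF horn_vertex_apex[OF n]] simp_map_in[OF u horn_vertex_apex[OF n]] by simp
  then have xS: "x \<in> sx S n" by (rule union_of_components_closed[OF S Xs x(1) n(2)])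
  then show "\<exists>x\<in>sx S n. \<forall>m. \<forall>\<beta>\<in>sx (horn n k) m. sact S n \<beta> x = u m \<beta>"
  proof (intro bexI[of _ x] allI ballI)
    fix m \<beta> assume b: "\<beta> \<in> sx (horn n k) m"
    show "sact S n \<beta> x = u m \<beta>" using x(2)[OF b] D(2)[OF horn_dmaps[OF b] xS] by simp
  qed (rule xS)
qed

section \<open>Nerves and unstraightening\<close>

lemma tri_idem: "tri n (tri n s) = tri n s"
  by (simp add: tri_def fun_eq_iff)

lemma nerve_sact [simp]: "sact (nerve C) n = nerve_act"
  by (simp add: nerve_def)

lemma nerve_sx:
  "\<sigma> \<in> sx (nerve C) n \<longleftrightarrow> tri n \<sigma> = \<sigma> \<and>
     (\<forall>i\<le>n. ob C \<sigma> i \<in> cObj C \<and> \<sigma> i i = cId C (ob C \<sigma> i)) \<and>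
     (\<forall>i j. i \<le> j \<and> j \<le> n \<longrightarrow> \<sigma> i j \<in> cArr C \<and> cDom C (\<sigma> i j) = ob C \<sigma> i \<and> cCod C (\<sigma> i j) = ob C \<sigma> j) \<and>
     (\<forall>i j k. i \<le> j \<and> j \<le> k \<and> k \<le> n \<longrightarrow> \<sigma> i k = cComp C (\<sigma> j k) (\<sigma> i j))"
  by (simp add: nerve_def)

lemma nerveI:
  assumes "tri n \<sigma> = \<sigma>" "\<And>i. i \<le> n \<Longrightarrow> ob C \<sigma> i \<in> cObj C" "\<And>i. i \<le> n \<Longrightarrow> \<sigma> i i = cId C (ob C \<sigma> i)"
    "\<And>i j. i \<le> j \<Longrightarrow> j \<le> n \<Longrightarrow> \<sigma> i j \<in> cArr C \<and> cDom C (\<sigma> i j) = ob C \<sigma> i \<and> cCod C (\<sigma> i j) = ob C \<sigma> j"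
    "\<And>i j k. i \<le> j \<Longrightarrow> j \<le> k \<Longrightarrow> k \<le> n \<Longrightarrow> \<sigma> i k = cComp C (\<sigma> j k) (\<sigma> i j)"
  shows "\<sigma> \<in> sx (nerve C) n"
  unfolding nerve_sx using assms by blast

lemma nerveD:
  assumes "\<sigma> \<in> sx (nerve C) n"
  shows "tri n \<sigma> = \<sigma>" "i \<le> n \<Longrightarrow> ob C \<sigma> i \<in> cObj C" "i \<le> n \<Longrightarrow> \<sigma> i i = cId C (ob C \<sigma> i)"
    "i \<le> j \<Longrightarrow> j \<le> n \<Longrightarrow> \<sigma> i j \<in> cArr C" "i \<le> j \<Longrightarrow> j \<le> n \<Longrightarrow> cDom C (\<sigma> i j) = ob C \<sigma> i"
    "i \<le> j \<Longrightarrow> j \<le> n \<Longrightarrow> cCod C (\<sigma> i j) = ob C \<sigma> j"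
    "i \<le> j \<Longrightarrow> j \<le> k \<Longrightarrow> k \<le> n \<Longrightarrow> \<sigma> i k = cComp C (\<sigma> j k) (\<sigma> i j)"
  using assms unfolding nerve_sx by blast+

lemma nerve_act_nth:
  "\<alpha> \<in> dmaps m n \<Longrightarrow> i \<le> j \<Longrightarrow> j \<le> m \<Longrightarrow> nerve_act \<alpha> \<sigma> i j = \<sigma> (\<alpha> ! i) (\<alpha> ! j)"
  by (simp add: nerve_act_def tri_def dmaps_length)

lemma ob_nerve_act: "\<alpha> \<in> dmaps m n \<Longrightarrow> i \<le> m \<Longrightarrow> ob C (nerve_act \<alpha> \<sigma>) i = ob C \<sigma> (\<alpha> ! i)"
  by (simp add: ob_def nerve_act_nth)

lemma nerve_act_in:
  assumes a: "\<alpha> \<in> dmaps m n" and s: "\<sigma> \<in> sx (nerve C) n"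
  shows "nerve_act \<alpha> \<sigma> \<in> sx (nerve C) m"
proof (rule nerveI)
  note D = nerveD[OF s]
  have le: "\<alpha> ! i \<le> n" if "i \<le> m" for i using dmaps_nth_le[OF a that] .
  show "tri m (nerve_act \<alpha> \<sigma>) = nerve_act \<alpha> \<sigma>"
    unfolding nerve_act_def using dmaps_length[OF a] by (simp add: tri_idem)
  show "ob C (nerve_act \<alpha> \<sigma>) i \<in> cObj C" if "i \<le> m" for i
    using that D(2) le by (simp add: ob_nerve_act[OF a])
  show "nerve_act \<alpha> \<sigma> i i = cId C (ob C (nerve_act \<alpha> \<sigma>) i)" if "i \<le> m" for i
    using that D(3) le by (simp add: ob_nerve_act[OF a] nerve_act_nth[OF a])
  show "nerve_act \<alpha> \<sigma> i j \<in> cArr C \<and> cDom C (nerve_act \<alpha> \<sigma> i j) = ob C (nerve_act \<alpha> \<sigma>) i \<and>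
      cCod C (nerve_act \<alpha> \<sigma> i j) = ob C (nerve_act \<alpha> \<sigma>) j" if "i \<le> j" "j \<le> m" for i j
    using that D(4-6)[OF dmaps_mono[OF a that] le[OF that(2)]] by (simp add: ob_nerve_act[OF a] nerve_act_nth[OF a])
  show "nerve_act \<alpha> \<sigma> i k = cComp C (nerve_act \<alpha> \<sigma> j k) (nerve_act \<alpha> \<sigma> i j)" if "i \<le> j" "j \<le> k" "k \<le> m" for i j k
    using that D(7)[of "\<alpha> ! i" "\<alpha> ! j" "\<alpha> ! k"] dmaps_mono[OF a, of i j] dmaps_mono[OF a, of j k] le[OF that(3)]
    by (simp add: nerve_act_nth[OF a])
qed

lemma nerve_ext:
  assumes "tri n \<sigma> = \<sigma>" "tri n \<tau> = \<tau>" "\<And>i j. i \<le> j \<Longrightarrow> j \<le> n \<Longrightarrow> \<sigma> i j = \<tau> i j"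
  shows "\<sigma> = \<tau>"
proof -
  have "tri n \<sigma> = tri n \<tau>" unfolding tri_def using assms(3) by (auto simp: fun_eq_iff)
  then show ?thesis using assms(1,2) by simp
qed

lemma nerve_act_tri: "\<alpha> \<in> dmaps m n \<Longrightarrow> tri m (nerve_act \<alpha> \<sigma>) = nerve_act \<alpha> \<sigma>"
  unfolding nerve_act_def by (simp add: dmaps_length tri_idem)

lemma nerve_act_comp:
  assumes a: "\<alpha> \<in> dmaps m n" and b: "\<beta> \<in> dmaps k m"
  shows "nerve_act \<beta> (nerve_act \<alpha> \<sigma>) = nerve_act (dcomp \<alpha> \<beta>) \<sigma>"
  by (rule nerve_ext[OF nerve_act_tri[OF b] nerve_act_tri[OF dcomp_in[OF a b]]])
    (simp add: nerve_act_nth[OF a] nerve_act_nth[OF b] nerve_act_nth[OF dcomp_in[OF a b]]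
      dmaps_mono[OF b] dmaps_nth_le[OF b] dcomp_nth dmaps_length[OF b])

lemma is_sset_nerve: "is_sset (nerve C)"
proof (rule is_ssetI)
  show "sact (nerve C) n (did n) \<sigma> = \<sigma>" if "\<sigma> \<in> sx (nerve C) n" for n \<sigma>
    unfolding nerve_sact
    by (rule nerve_ext[OF nerve_act_tri[OF did_in] nerveD(1)[OF that]]) (simp add: nerve_act_nth[OF did_in] did_nth)
qed (simp_all add: nerve_act_in nerve_act_comp)

lemma op_cat_simps [simp]:
  "cObj (op_cat C) = cObj C" "cArr (op_cat C) = cArr C" "cDom (op_cat C) = cCod C" "cCod (op_cat C) = cDom C"
  "cId (op_cat C) = cId C" "cComp (op_cat C) g f = cComp C f g"
  by (simp_all add: op_cat_def)

lemma unstr_sx: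
  "(\<sigma>, xs) \<in> sx (unstr C F) n \<longleftrightarrow> \<sigma> \<in> sx (nerve (op_cat C)) n \<and> length xs = Suc n \<and>
     (\<forall>i\<le>n. xs ! i \<in> sx (pob F (ob (op_cat C) \<sigma> i)) i) \<and>
     (\<forall>i j. i \<le> j \<and> j \<le> n \<longrightarrow>
        sact (pob F (ob (op_cat C) \<sigma> j)) j (did i) (xs ! j) = pmap F (\<sigma> i j) i (xs ! i))"
  by (simp add: unstr_def)

lemma unstr_sact:
  "sact (unstr C F) n \<alpha> (\<sigma>, xs) = (nerve_act \<alpha> \<sigma>,
     map (\<lambda>k. sact (pob F (ob (op_cat C) \<sigma> (\<alpha> ! k))) (\<alpha> ! k) (take (Suc k) \<alpha>) (xs ! (\<alpha> ! k))) [0..<length \<alpha>])"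
  by (simp add: unstr_def)

locale presheaf_of_simplicial_sets =
  fixes C :: "('o, 'a) cat" and F :: "('o, 'a, 'x) psh"
  assumes psh: "simplicial_presheaf C F"
begin

lemma pob_sset: "c \<in> cObj C \<Longrightarrow> is_sset (pob F c)"
  using psh unfolding simplicial_presheaf_def by blast

lemma pmap_simp_map: "u \<in> cArr C \<Longrightarrow> simp_map (pob F (cCod C u)) (pob F (cDom C u)) (pmap F u)"
  using psh unfolding simplicial_presheaf_def by blast

lemma pmap_id: "c \<in> cObj C \<Longrightarrow> x \<in> sx (pob F c) n \<Longrightarrow> pmap F (cId C c) n x = x"
  using psh unfolding simplicial_presheaf_def by blast

lemma pmap_comp:
  "u \<in> cArr C \<Longrightarrow> v \<in> cArr C \<Longrightarrow> cCod C u = cDom C v \<Longrightarrow> x \<in> sx (pob F (cCod C v)) n \<Longrightarrow>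
   pmap F (cComp C v u) n x = pmap F u n (pmap F v n x)"
  using psh unfolding simplicial_presheaf_def by blast

context
  fixes \<sigma> :: "nat \<Rightarrow> nat \<Rightarrow> 'a" and n :: nat
  assumes \<sigma>: "\<sigma> \<in> sx (nerve (op_cat C)) n"
begin

lemma chain_sset: "i \<le> n \<Longrightarrow> is_sset (pob F (ob (op_cat C) \<sigma> i))"
  using nerveD(2)[OF \<sigma>] pob_sset by simp

lemma chain_map: "i \<le> j \<Longrightarrow> j \<le> n \<Longrightarrow>
  simp_map (pob F (ob (op_cat C) \<sigma> i)) (pob F (ob (op_cat C) \<sigma> j)) (pmap F (\<sigma> i j))"
  using pmap_simp_map[of "\<sigma> i j"] nerveD(4-6)[OF \<sigma>] by simp

lemma chain_id: "i \<le> n \<Longrightarrow> x \<in> sx (pob F (ob (op_cat C) \<sigma> i)) k \<Longrightarrow> pmap F (\<sigma> i i) k x = x"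
  using pmap_id nerveD(2,3)[OF \<sigma>] by simp

lemma chain_comp: "i \<le> j \<Longrightarrow> j \<le> l \<Longrightarrow> l \<le> n \<Longrightarrow> x \<in> sx (pob F (ob (op_cat C) \<sigma> i)) k \<Longrightarrow>
  pmap F (\<sigma> j l) k (pmap F (\<sigma> i j) k x) = pmap F (\<sigma> i l) k x"
  using pmap_comp[of "\<sigma> j l" "\<sigma> i j" x k] nerveD(4-6)[OF \<sigma>] nerveD(7)[OF \<sigma>, of i j l] by simp

end

lemma unstr_act_nth:
  assumes "\<alpha> \<in> dmaps m n" "k \<le> m"
  shows "snd (sact (unstr C F) n \<alpha> (\<sigma>, xs)) ! k =
    sact (pob F (ob (op_cat C) \<sigma> (\<alpha> ! k))) (\<alpha> ! k) (take (Suc k) \<alpha>) (xs ! (\<alpha> ! k))"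
  using assms by (simp add: unstr_sact dmaps_length del: upt_Suc)

lemma unstr_act_in:
  assumes a: "\<alpha> \<in> dmaps m n" and x: "(\<sigma>, xs) \<in> sx (unstr C F) n"
  shows "sact (unstr C F) n \<alpha> (\<sigma>, xs) \<in> sx (unstr C F) m"
proof -
  let ?ys = "snd (sact (unstr C F) n \<alpha> (\<sigma>, xs))" and ?o = "ob (op_cat C) \<sigma>"
  have s: "\<sigma> \<in> sx (nerve (op_cat C)) n" and xin: "\<And>i. i \<le> n \<Longrightarrow> xs ! i \<in> sx (pob F (?o i)) i"
    and compat: "\<And>i j. i \<le> j \<Longrightarrow> j \<le> n \<Longrightarrow> sact (pob F (?o j)) j (did i) (xs ! j) = pmap F (\<sigma> i j) i (xs ! i)"
    using x unfolding unstr_sx by auto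
  have "(nerve_act \<alpha> \<sigma>, ?ys) \<in> sx (unstr C F) m"
    unfolding unstr_sx
  proof (intro conjI allI impI)
    show "nerve_act \<alpha> \<sigma> \<in> sx (nerve (op_cat C)) m" by (rule nerve_act_in[OF a s])
    show "length ?ys = Suc m" by (simp add: unstr_sact dmaps_length[OF a])
    show "?ys ! i \<in> sx (pob F (ob (op_cat C) (nerve_act \<alpha> \<sigma>) i)) i" if "i \<le> m" for i
      unfolding unstr_act_nth[OF a that] ob_nerve_act[OF a that]
      by (rule sset_act[OF chain_sset[OF s dmaps_nth_le[OF a that]] take_in[OF a that] xin[OF dmaps_nth_le[OF a that]]])
    fix i j assume "i \<le> j \<and> j \<le> m"
    then have ij: "i \<le> j" "j \<le> m" "i \<le> m" by auto
    note aj = dmaps_nth_le[OF a ij(2)] and ai = dmaps_nth_le[OF a ij(3)] and aij = dmaps_mono[OF a ij(1,2)]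
    have "sact (pob F (?o (\<alpha> ! j))) j (did i) (?ys ! j) = sact (pob F (?o (\<alpha> ! j))) (\<alpha> ! j) (take (Suc i) \<alpha>) (xs ! (\<alpha> ! j))"
    proof -
      have "dcomp (take (Suc j) \<alpha>) (did i) = take (Suc i) \<alpha>"
        using take_dcomp[OF take_in[OF a ij(2)] ij(1)] ij(1) by (simp add: min_def)
      then show ?thesis
        unfolding unstr_act_nth[OF a ij(2)] using sset_comp[OF chain_sset[OF s aj] take_in[OF a ij(2)] did_sub[OF ij(1)] xin[OF aj]] by simp
    qed
    also have "\<dots> = sact (pob F (?o (\<alpha> ! j))) (\<alpha> ! i) (take (Suc i) \<alpha>) (sact (pob F (?o (\<alpha> ! j))) (\<alpha> ! j) (did (\<alpha> ! i)) (xs ! (\<alpha> ! j)))"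
      using sset_comp[OF chain_sset[OF s aj] did_sub[OF aij] take_in[OF a ij(3)] xin[OF aj]] did_dcomp[OF take_in[OF a ij(3)]] by simp
    also have "\<dots> = pmap F (\<sigma> (\<alpha> ! i) (\<alpha> ! j)) i (?ys ! i)"
      unfolding compat[OF aij aj] unstr_act_nth[OF a ij(3)]
      using simp_map_nat[OF chain_map[OF s aij aj] take_in[OF a ij(3)] xin[OF ai]] by simp
    finally show "sact (pob F (ob (op_cat C) (nerve_act \<alpha> \<sigma>) j)) j (did i) (?ys ! j) = pmap F (nerve_act \<alpha> \<sigma> i j) i (?ys ! i)"
      unfolding ob_nerve_act[OF a ij(2)] nerve_act_nth[OF a ij(1,2)] .
  qed
  then show ?thesis by (simp add: unstr_sact)
qed

lemma is_sset_unstr: "is_sset (unstr C F)"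
proof (rule is_ssetI)
  show "sact (unstr C F) n \<alpha> x \<in> sx (unstr C F) m" if "\<alpha> \<in> dmaps m n" "x \<in> sx (unstr C F) n" for m n \<alpha> x
    using that unstr_act_in by (cases x) blast
  show "sact (unstr C F) n (did n) x = x" if "x \<in> sx (unstr C F) n" for n x
  proof -
    obtain \<sigma> xs where x: "x = (\<sigma>, xs)" by (cases x)
    have h: "\<sigma> \<in> sx (nerve (op_cat C)) n" "length xs = Suc n" "\<And>i. i \<le> n \<Longrightarrow> xs ! i \<in> sx (pob F (ob (op_cat C) \<sigma> i)) i"
      using that unfolding x unstr_sx by auto
    have "snd (sact (unstr C F) n (did n) (\<sigma>, xs)) = xs"
    proof (rule nth_equalityI)
      show l: "length (snd (sact (unstr C F) n (did n) (\<sigma>, xs))) = length xs" by (simp add: unstr_sact h(2))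
      fix k assume "k < length (snd (sact (unstr C F) n (did n) (\<sigma>, xs)))"
      then have k: "k \<le> n" using l h(2) by simp
      have "take (Suc k) (did n) = did k" using take_dcomp[OF did_in k] did_dcomp[OF did_sub[OF k]] by simp
      then show "snd (sact (unstr C F) n (did n) (\<sigma>, xs)) ! k = xs ! k"
        using unstr_act_nth[OF did_in k] sset_id[OF chain_sset[OF h(1) k] h(3)[OF k]] did_nth[OF k] by simp
    qed
    moreover have "nerve_act (did n) \<sigma> = \<sigma>" using sset_id[OF is_sset_nerve h(1)] by simp
    ultimately show ?thesis unfolding x by (simp add: unstr_sact)
  qed
  show "sact (unstr C F) m \<beta> (sact (unstr C F) n \<alpha> x) = sact (unstr C F) n (dcomp \<alpha> \<beta>) x"
    if a: "\<alpha> \<in> dmaps m n" and b: "\<beta> \<in> dmaps k m" and xin: "x \<in> sx (unstr C F) n" for k m n \<alpha> \<beta> x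
  proof -
    obtain \<sigma> xs where x: "x = (\<sigma>, xs)" by (cases x)
    have h: "\<sigma> \<in> sx (nerve (op_cat C)) n" "\<And>i. i \<le> n \<Longrightarrow> xs ! i \<in> sx (pob F (ob (op_cat C) \<sigma> i)) i"
      using xin unfolding x unstr_sx by auto
    let ?ys = "snd (sact (unstr C F) n \<alpha> (\<sigma>, xs))"
    have y: "sact (unstr C F) n \<alpha> x = (nerve_act \<alpha> \<sigma>, ?ys)" by (simp add: x unstr_sact)
    have "snd (sact (unstr C F) m \<beta> (nerve_act \<alpha> \<sigma>, ?ys)) = snd (sact (unstr C F) n (dcomp \<alpha> \<beta>) (\<sigma>, xs))"
    proof (rule nth_equalityI)
      show l: "length (snd (sact (unstr C F) m \<beta> (nerve_act \<alpha> \<sigma>, ?ys))) = length (snd (sact (unstr C F) n (dcomp \<alpha> \<beta>) (\<sigma>, xs)))"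
        by (simp add: unstr_sact)
      fix i assume "i < length (snd (sact (unstr C F) m \<beta> (nerve_act \<alpha> \<sigma>, ?ys)))"
      then have i: "i \<le> k" by (simp add: unstr_sact dmaps_length[OF b])
      note bi = dmaps_nth_le[OF b i]
      note abi = dmaps_nth_le[OF a bi]
      have n: "dcomp \<alpha> \<beta> ! i = \<alpha> ! (\<beta> ! i)" using i dmaps_length[OF b] by (simp add: dcomp_nth)
      have t: "dcomp (take (Suc (\<beta> ! i)) \<alpha>) (take (Suc i) \<beta>) = take (Suc i) (dcomp \<alpha> \<beta>)"
      proof -
        have "dcomp (take (Suc (\<beta> ! i)) \<alpha>) (take (Suc i) \<beta>) = dcomp (dcomp \<alpha> (did (\<beta> ! i))) (take (Suc i) \<beta>)"
          using take_dcomp[OF a bi] by simp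
        also have "\<dots> = dcomp \<alpha> (take (Suc i) \<beta>)"
          using dcomp_assoc[OF did_sub[OF bi] take_in[OF b i]] did_dcomp[OF take_in[OF b i]] by simp
        also have "\<dots> = take (Suc i) (dcomp \<alpha> \<beta>)" by (simp add: dcomp_def take_map)
        finally show ?thesis .
      qed
      show "snd (sact (unstr C F) m \<beta> (nerve_act \<alpha> \<sigma>, ?ys)) ! i = snd (sact (unstr C F) n (dcomp \<alpha> \<beta>) (\<sigma>, xs)) ! i"
        unfolding unstr_act_nth[OF b i] unstr_act_nth[OF dcomp_in[OF a b] i] n unstr_act_nth[OF a bi] ob_nerve_act[OF a bi]
          sset_comp[OF chain_sset[OF h(1) abi] take_in[OF a bi] take_in[OF b i] h(2)[OF abi]] t ..
    qed
    moreover have "fst (sact (unstr C F) m \<beta> (nerve_act \<alpha> \<sigma>, ?ys)) = fst (sact (unstr C F) n (dcomp \<alpha> \<beta>) (\<sigma>, xs))"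
      using nerve_act_comp[OF a b] by (simp add: unstr_sact)
    ultimately show ?thesis unfolding y unfolding x prod_eq_iff by (intro conjI)
  qed
qed

text \<open>For \<open>k < n\<close> the horn contains the faces on the vertices \<open>0, \<dots>, j\<close> with \<open>j < n\<close>, and thereby all
  components of the required simplex except the one over the last object. There the last components
  of the simplices of the horn, transported to the last object along the chain, form a horn in a Kan
  complex, and any filler of it is the missing component.\<close>

theorem left_fibration_unstr:
  assumes kan: "\<And>c. c \<in> cObj C \<Longrightarrow> kan_complex (pob F c)"
  shows "left_fibration (unstr C F) (nerve (op_cat C)) (\<lambda>n. fst)"
proof (rule left_fibrationI[OF is_sset_unstr is_sset_nerve])
  show "simp_map (unstr C F) (nerve (op_cat C)) (\<lambda>n. fst)"
    by (rule simp_mapI) (auto simp: unstr_sx unstr_sact)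
next
  fix n k u \<sigma>
  assume k: "k < n" and s: "\<sigma> \<in> sx (nerve (op_cat C)) n" and u: "simp_map (horn n k) (unstr C F) u"
    and fu': "\<And>m \<beta>. \<beta> \<in> sx (horn n k) m \<Longrightarrow> fst (u m \<beta>) = sact (nerve (op_cat C)) n \<beta> \<sigma>"
  let ?o = "ob (op_cat C) \<sigma>"
  \<comment> \<open>\<open>L\<close> is the last component; by compatibility with the operators it determines the others.\<close>
  define xx where "xx = (\<lambda>m \<beta>. snd (u m \<beta>))"
  define L where "L = (\<lambda>m \<beta>. xx m \<beta> ! m)"
  have ue: "u m \<beta> = (nerve_act \<beta> \<sigma>, xx m \<beta>)" if "\<beta> \<in> sx (horn n k) m" for m \<beta>
    using fu'[OF that] by (simp add: xx_def prod_eq_iff)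
  have xlen: "length (xx m \<beta>) = Suc m" and xin: "\<And>i. i \<le> m \<Longrightarrow> xx m \<beta> ! i \<in> sx (pob F (?o (\<beta> ! i))) i"
    and xcomp: "\<And>i j. i \<le> j \<Longrightarrow> j \<le> m \<Longrightarrow>
      sact (pob F (?o (\<beta> ! j))) j (did i) (xx m \<beta> ! j) = pmap F (\<sigma> (\<beta> ! i) (\<beta> ! j)) i (xx m \<beta> ! i)"
    if b: "\<beta> \<in> sx (horn n k) m" for m \<beta>
  proof -
    note bd = horn_dmaps[OF b]
    have "(nerve_act \<beta> \<sigma>, xx m \<beta>) \<in> sx (unstr C F) m" using simp_map_in[OF u b] ue[OF b] by simp
    then show "length (xx m \<beta>) = Suc m" "\<And>i. i \<le> m \<Longrightarrow> xx m \<beta> ! i \<in> sx (pob F (?o (\<beta> ! i))) i"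
      "\<And>i j. i \<le> j \<Longrightarrow> j \<le> m \<Longrightarrow>
        sact (pob F (?o (\<beta> ! j))) j (did i) (xx m \<beta> ! j) = pmap F (\<sigma> (\<beta> ! i) (\<beta> ! j)) i (xx m \<beta> ! i)"
      unfolding unstr_sx by (auto simp: ob_nerve_act[OF bd] nerve_act_nth[OF bd])
  qed
  have L_act: "L l (dcomp \<beta> \<gamma>) = sact (pob F (?o (\<beta> ! (\<gamma> ! l)))) (\<gamma> ! l) \<gamma> (xx m \<beta> ! (\<gamma> ! l))"
    if b: "\<beta> \<in> sx (horn n k) m" and g: "\<gamma> \<in> dmaps l m" for l m \<beta> \<gamma>
  proof -
    have "u l (dcomp \<beta> \<gamma>) = sact (unstr C F) m \<gamma> (nerve_act \<beta> \<sigma>, xx m \<beta>)"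
      using simp_map_nat[OF u g b] ue[OF b] by simp
    then have "L l (dcomp \<beta> \<gamma>) = snd (sact (unstr C F) m \<gamma> (nerve_act \<beta> \<sigma>, xx m \<beta>)) ! l" by (simp add: L_def xx_def)
    also have "\<dots> = sact (pob F (?o (\<beta> ! (\<gamma> ! l)))) (\<gamma> ! l) \<gamma> (xx m \<beta> ! (\<gamma> ! l))"
      unfolding unstr_act_nth[OF g order_refl] ob_nerve_act[OF horn_dmaps[OF b] dmaps_nth_le[OF g order_refl]]
      using dmaps_length[OF g] by simp
    finally show ?thesis .
  qed
  have x_L: "xx m \<beta> ! i = L i (dcomp \<beta> (did i))" if b: "\<beta> \<in> sx (horn n k) m" and i: "i \<le> m" for m \<beta> i
    using L_act[OF b did_sub[OF i]] did_nth[of i i]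
      sset_id[OF chain_sset[OF s dmaps_nth_le[OF horn_dmaps[OF b] i]] xin[OF b i]] by simp
  \<comment> \<open>The horn in the last fibre.\<close>
  define v where "v = (\<lambda>m \<beta>. pmap F (\<sigma> (\<beta> ! m) n) m (L m \<beta>))"
  have "simp_map (horn n k) (pob F (?o n)) v"
  proof (rule simp_mapI)
    fix m \<beta> assume b: "\<beta> \<in> sx (horn n k) m"
    note bm = dmaps_nth_le[OF horn_dmaps[OF b] order_refl]
    show "v m \<beta> \<in> sx (pob F (?o n)) m"
      unfolding v_def L_def by (rule simp_map_in[OF chain_map[OF s bm order_refl] xin[OF b order_refl]])
    fix l \<gamma> assume g: "\<gamma> \<in> dmaps l m"
    let ?i = "\<gamma> ! l" and ?X = "pob F (?o (\<beta> ! m))"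
    have i: "?i \<le> m" by (rule dmaps_nth_le[OF g order_refl])
    have bi: "\<beta> ! ?i \<le> n" "\<beta> ! ?i \<le> \<beta> ! m"
      using dmaps_nth_le[OF horn_dmaps[OF b] i] dmaps_mono[OF horn_dmaps[OF b] i] by auto
    have g': "\<gamma> \<in> dmaps l ?i" using take_in[OF g order_refl] dmaps_length[OF g] by simp
    note X = chain_sset[OF s bm] and xm = xin[OF b order_refl] and xi = xin[OF b i]
    have "sact ?X m \<gamma> (xx m \<beta> ! m) = sact ?X ?i \<gamma> (sact ?X m (did ?i) (xx m \<beta> ! m))"
      using sset_comp[OF X did_sub[OF i] g' xm] did_dcomp[OF g'] by simp
    also have "\<dots> = sact ?X ?i \<gamma> (pmap F (\<sigma> (\<beta> ! ?i) (\<beta> ! m)) ?i (xx m \<beta> ! ?i))"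
      using xcomp[OF b i order_refl] by simp
    also have "\<dots> = pmap F (\<sigma> (\<beta> ! ?i) (\<beta> ! m)) l (sact (pob F (?o (\<beta> ! ?i))) ?i \<gamma> (xx m \<beta> ! ?i))"
      using simp_map_nat[OF chain_map[OF s bi(2) bm] g' xi] by simp
    finally have e: "sact ?X m \<gamma> (xx m \<beta> ! m) = pmap F (\<sigma> (\<beta> ! ?i) (\<beta> ! m)) l (L l (dcomp \<beta> \<gamma>))"
      unfolding L_act[OF b g] .
    have Lin: "L l (dcomp \<beta> \<gamma>) \<in> sx (pob F (?o (\<beta> ! ?i))) l"
      unfolding L_act[OF b g] by (rule sset_act[OF chain_sset[OF s bi(1)] g' xi])
    have "sact (pob F (?o n)) m \<gamma> (v m \<beta>) = pmap F (\<sigma> (\<beta> ! m) n) l (sact ?X m \<gamma> (xx m \<beta> ! m))"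
      unfolding v_def L_def using simp_map_nat[OF chain_map[OF s bm order_refl] g xm] by simp
    also have "\<dots> = pmap F (\<sigma> (\<beta> ! ?i) n) l (L l (dcomp \<beta> \<gamma>))"
      unfolding e by (rule chain_comp[OF s bi(2) bm order_refl Lin])
    also have "\<dots> = v l (dcomp \<beta> \<gamma>)"
      unfolding v_def using dmaps_length[OF g] by (simp add: dcomp_nth)
    finally show "v l (sact (horn n k) m \<gamma> \<beta>) = sact (pob F (?o n)) m \<gamma> (v m \<beta>)" by simp
  qed
  then obtain z where z: "z \<in> sx (pob F (?o n)) n" "\<And>m \<beta>. \<beta> \<in> sx (horn n k) m \<Longrightarrow> sact (pob F (?o n)) n \<beta> z = v m \<beta>"
    using kan_complex_fill[OF kan, of "?o n" n k v] nerveD(2)[OF s order_refl] k by auto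
  define xs where "xs = map (\<lambda>j. if j < n then L j (did j) else z) [0..<Suc n]"
  have xs_nth: "xs ! j = (if j < n then L j (did j) else z)" if "j \<le> n" for j
    using that by (simp add: xs_def del: upt_Suc)
  have dh: "did j \<in> sx (horn n k) j" if "j < n" for j
    by (rule horn_sxI[OF did_sub, of _ _ n]) (use that k in auto)
  have xs_in: "xs ! j \<in> sx (pob F (?o j)) j" if "j \<le> n" for j
    using that xs_nth[OF that] z(1) xin[OF dh order_refl, of j] did_nth[of j j] by (auto simp: L_def)
  have mem: "(\<sigma>, xs) \<in> sx (unstr C F) n"
    unfolding unstr_sx
  proof (intro conjI allI impI)
    show "\<sigma> \<in> sx (nerve (op_cat C)) n" by (rule s)
    show "length xs = Suc n" by (simp add: xs_def)
    show "xs ! i \<in> sx (pob F (?o i)) i" if "i \<le> n" for i using xs_in[OF that] .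
    fix i j assume "i \<le> j \<and> j \<le> n"
    then have ij: "i \<le> j" "j \<le> n" "i \<le> n" by auto
    consider "j < n" | "j = n" "i < n" | "j = n" "i = n" using ij by linarith
    then show "sact (pob F (?o j)) j (did i) (xs ! j) = pmap F (\<sigma> i j) i (xs ! i)"
    proof cases
      case 1
      have "xx j (did j) ! i = L i (did i)"
        using x_L[OF dh[OF 1] ij(1)] did_dcomp[OF did_sub[OF ij(1)]] by simp
      then show ?thesis
        using xcomp[OF dh[OF 1] ij(1) order_refl] 1 ij did_nth[of i j] did_nth[of j j] xs_nth[of i] xs_nth[of j]
        by (simp add: L_def)
    next
      case 2
      then show ?thesis using z(2)[OF dh[OF 2(2)]] xs_nth[of i] xs_nth[of n] did_nth[of i i] by (simp add: v_def)
    next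
      case 3
      then show ?thesis using sset_id[OF chain_sset[OF s order_refl] z(1)] chain_id[OF s order_refl z(1)] xs_nth[of n] by simp
    qed
  qed
  have top: "sact (pob F (?o (\<beta> ! m))) (\<beta> ! m) \<beta> (xs ! (\<beta> ! m)) = L m \<beta>" if b: "\<beta> \<in> sx (horn n k) m" for m \<beta>
  proof (cases "\<beta> ! m = n")
    case True
    then have "sact (pob F (?o (\<beta> ! m))) (\<beta> ! m) \<beta> (xs ! (\<beta> ! m)) = pmap F (\<sigma> n n) m (L m \<beta>)"
      using z(2)[OF b] xs_nth[of n] by (simp add: v_def)
    also have "\<dots> = L m \<beta>"
      by (rule chain_id[OF s order_refl]) (use xin[OF b order_refl] True in \<open>simp add: L_def\<close>)
    finally show ?thesis .
  next
    case False
    then have j: "\<beta> ! m < n" using dmaps_nth_le[OF horn_dmaps[OF b] order_refl] by simp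
    have b': "\<beta> \<in> dmaps m (\<beta> ! m)" using take_in[OF horn_dmaps[OF b] order_refl] dmaps_length[OF horn_dmaps[OF b]] by simp
    show ?thesis
      using L_act[OF dh[OF j] b'] did_dcomp[OF b'] did_nth[of "\<beta> ! m" "\<beta> ! m"] xs_nth[of "\<beta> ! m"] j by (simp add: L_def)
  qed
  have "sact (unstr C F) n \<beta> (\<sigma>, xs) = u m \<beta>" if b: "\<beta> \<in> sx (horn n k) m" for m \<beta>
  proof -
    note bd = horn_dmaps[OF b]
    have "snd (sact (unstr C F) n \<beta> (\<sigma>, xs)) = xx m \<beta>"
    proof (rule nth_equalityI)
      show l: "length (snd (sact (unstr C F) n \<beta> (\<sigma>, xs))) = length (xx m \<beta>)"
        by (simp add: unstr_sact dmaps_length[OF bd] xlen[OF b])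
      fix i assume "i < length (snd (sact (unstr C F) n \<beta> (\<sigma>, xs)))"
      then have i: "i \<le> m" using l xlen[OF b] by simp
      have t: "take (Suc i) \<beta> \<in> sx (horn n k) i" "take (Suc i) \<beta> ! i = \<beta> ! i"
        using horn_act[OF b did_sub[OF i]] take_dcomp[OF bd i] by auto
      show "snd (sact (unstr C F) n \<beta> (\<sigma>, xs)) ! i = xx m \<beta> ! i"
        unfolding unstr_act_nth[OF bd i] x_L[OF b i] take_dcomp[OF bd i] using top[OF t(1)] t(2) by simp
    qed
    then show ?thesis unfolding ue[OF b] by (simp add: prod_eq_iff) (simp add: unstr_sact)
  qed
  then show "\<exists>x\<in>sx (unstr C F) n. fst x = \<sigma> \<and> (\<forall>m. \<forall>\<beta>\<in>sx (horn n k) m. sact (unstr C F) n \<beta> x = u m \<beta>)"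
    using mem by (intro bexI[of _ "(\<sigma>, xs)"]) auto
qed

end

lemma unstr_map_simp: "unstr_map C t n (\<sigma>, xs) = (\<sigma>, map (\<lambda>i. t (ob (op_cat C) \<sigma> i) i (xs ! i)) [0..<length xs])"
  by (simp add: unstr_map_def)

lemma simp_map_unstr_map:
  assumes t: "presheaf_map C F G t"
  shows "simp_map (unstr C F) (unstr C G) (unstr_map C t)"
proof (rule simp_mapI)
  have tc: "simp_map (pob F c) (pob G c) (t c)" if "c \<in> cObj C" for c
    using t that unfolding presheaf_map_def by blast
  have tn: "t (cDom C u) n (pmap F u n x) = pmap G u n (t (cCod C u) n x)" if "u \<in> cArr C" "x \<in> sx (pob F (cCod C u)) n" for u n x
    using t that unfolding presheaf_map_def by blast
  fix n x assume x: "x \<in> sx (unstr C F) n"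
  obtain \<sigma> xs where xe: "x = (\<sigma>, xs)" by (cases x)
  let ?o = "ob (op_cat C) \<sigma>"
  have s: "\<sigma> \<in> sx (nerve (op_cat C)) n" and len: "length xs = Suc n" and xin: "\<And>i. i \<le> n \<Longrightarrow> xs ! i \<in> sx (pob F (?o i)) i"
    and compat: "\<And>i j. i \<le> j \<Longrightarrow> j \<le> n \<Longrightarrow> sact (pob F (?o j)) j (did i) (xs ! j) = pmap F (\<sigma> i j) i (xs ! i)"
    using x unfolding xe unstr_sx by auto
  have os: "?o i \<in> cObj C" if "i \<le> n" for i using nerveD(2)[OF s that] by simp
  have tnth: "map (\<lambda>i. t (?o i) i (xs ! i)) [0..<length xs] ! i = t (?o i) i (xs ! i)" if "i \<le> n" for i
    using that len by (simp del: upt_Suc)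
  show "unstr_map C t n x \<in> sx (unstr C G) n"
    unfolding xe unstr_map_simp unstr_sx
  proof (intro conjI allI impI)
    fix i j assume "i \<le> j \<and> j \<le> n"
    then have ij: "i \<le> j" "j \<le> n" "i \<le> n" by auto
    have "sact (pob G (?o j)) j (did i) (t (?o j) j (xs ! j)) = t (?o j) i (pmap F (\<sigma> i j) i (xs ! i))"
      using simp_map_nat[OF tc[OF os[OF ij(2)]] did_sub[OF ij(1)] xin[OF ij(2)]] compat[OF ij(1,2)] by simp
    also have "\<dots> = pmap G (\<sigma> i j) i (t (?o i) i (xs ! i))"
      using tn[of "\<sigma> i j" "xs ! i" i] nerveD(4-6)[OF s ij(1,2)] xin[OF ij(3)] by simp
    finally show "sact (pob G (?o j)) j (did i) (map (\<lambda>i. t (?o i) i (xs ! i)) [0..<length xs] ! j) =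
      pmap G (\<sigma> i j) i (map (\<lambda>i. t (?o i) i (xs ! i)) [0..<length xs] ! i)"
      unfolding tnth[OF ij(2)] tnth[OF ij(3)] .
  qed (use s len tnth simp_map_in[OF tc[OF os] xin] in auto)
  fix m \<alpha> assume a: "\<alpha> \<in> dmaps m n"
  show "unstr_map C t m (sact (unstr C F) n \<alpha> x) = sact (unstr C G) n \<alpha> (unstr_map C t n x)"
    unfolding xe unstr_map_simp unstr_sact prod.inject
  proof (intro conjI refl nth_equalityI)
    fix i assume "i < length (map (\<lambda>i. t (ob (op_cat C) (nerve_act \<alpha> \<sigma>) i) i
        (map (\<lambda>k. sact (pob F (?o (\<alpha> ! k))) (\<alpha> ! k) (take (Suc k) \<alpha>) (xs ! (\<alpha> ! k))) [0..<length \<alpha>] ! i))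
        [0..<length (map (\<lambda>k. sact (pob F (?o (\<alpha> ! k))) (\<alpha> ! k) (take (Suc k) \<alpha>) (xs ! (\<alpha> ! k))) [0..<length \<alpha>])])"
    then have i: "i \<le> m" "i < length \<alpha>" using dmaps_length[OF a] by auto
    note ai = dmaps_nth_le[OF a i(1)]
    show "map (\<lambda>i. t (ob (op_cat C) (nerve_act \<alpha> \<sigma>) i) i
        (map (\<lambda>k. sact (pob F (?o (\<alpha> ! k))) (\<alpha> ! k) (take (Suc k) \<alpha>) (xs ! (\<alpha> ! k))) [0..<length \<alpha>] ! i))
        [0..<length (map (\<lambda>k. sact (pob F (?o (\<alpha> ! k))) (\<alpha> ! k) (take (Suc k) \<alpha>) (xs ! (\<alpha> ! k))) [0..<length \<alpha>])] ! i =
      map (\<lambda>k. sact (pob G (?o (\<alpha> ! k))) (\<alpha> ! k) (take (Suc k) \<alpha>)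
        (map (\<lambda>i. t (?o i) i (xs ! i)) [0..<length xs] ! (\<alpha> ! k))) [0..<length \<alpha>] ! i"
      using i tnth[OF ai] simp_map_nat[OF tc[OF os[OF ai]] take_in[OF a i(1)] xin[OF ai]]
      by (simp add: ob_nerve_act[OF a i(1)] del: upt_Suc)
  qed simp
qed

section \<open>Identities and constant maps are smooth\<close>

lemma openin_line_slice:
  assumes U: "openin (Euclidean_space n) U" and x: "x \<in> U" and i: "i < n"
  shows "open {t. x(i := t) \<in> U}"
proof -
  have xs: "x \<in> topspace (Euclidean_space n)" using openin_subset[OF U] x by blast
  then have e: "(\<lambda>j. if j < n then (x(i := t)) j else 0) = x(i := t)" for t
    using i by (auto simp: topspace_Euclidean_space fun_eq_iff)
  have "continuous_map euclideanreal euclideanreal (\<lambda>t. (x(i := t)) j)" for j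
    by (cases "j = i") auto
  then have "continuous_map euclideanreal (Euclidean_space n) (\<lambda>t j. if j < n then (x(i := t)) j else 0)"
    unfolding continuous_map_componentwise_Euclidean_space by blast
  then have "continuous_map euclideanreal (Euclidean_space n) (\<lambda>t. x(i := t))" unfolding e .
  from openin_continuous_map_preimage[OF this U] show ?thesis by simp
qed

text \<open>In charts the maps below are only controlled on the image of the chart, so smoothness has to be
  insensitive to values outside an open set.\<close>

lemma ck_cong:
  assumes U: "openin (Euclidean_space n) U"
  shows "(\<And>x. x \<in> U \<Longrightarrow> f x = g x) \<Longrightarrow> ck k n U f \<Longrightarrow> ck k n U g"
proof (induction k arbitrary: f g)
  case 0
  then show ?case using openin_subset[OF U] by (auto intro: continuous_map_eq)
next
  case (Suc k)
  have c: "continuous_map (subtopology (Euclidean_space n) U) euclideanreal g"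
    by (rule continuous_map_eq[of _ _ f]) (use Suc.prems in auto)
  have "\<exists>d. (\<forall>x\<in>U. ((\<lambda>t. g (x(i := t))) has_real_derivative d x) (at (x i))) \<and> ck k n U d" if i: "i < n" for i
  proof -
    obtain d where d: "\<forall>x\<in>U. ((\<lambda>t. f (x(i := t))) has_real_derivative d x) (at (x i))" "ck k n U d"
      using Suc.prems(2) i unfolding ck.simps by blast
    have "((\<lambda>t. g (x(i := t))) has_real_derivative d x) (at (x i))" if x: "x \<in> U" for x
      by (rule has_field_derivative_transform_within_open[OF bspec[OF d(1) x] openin_line_slice[OF U x i]])
        (use x Suc.prems(1) in auto)
    then show ?thesis using d(2) by (intro exI[of _ d]) simp
  qed
  then show ?case using c by simp
qed

lemma ck_const: "ck k n U (\<lambda>x. a)"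
proof (induction k arbitrary: a)
  case (Suc k)
  then show ?case by (auto intro!: exI[of _ "\<lambda>x. 0"] derivative_eq_intros)
qed simp

text \<open>The \<open>m\<close> coordinates from index \<open>s\<close> on. A product chart with factors of dimensions \<open>m\<close> and \<open>n\<close> is
  split into these by \<open>coords 0 m\<close> and \<open>coords m n\<close>.\<close>

definition coords :: "nat \<Rightarrow> nat \<Rightarrow> (nat \<Rightarrow> real) \<Rightarrow> nat \<Rightarrow> real" where
  "coords s m w = (\<lambda>i. if i < m then w (i + s) else 0)"

lemma continuous_map_coords: "continuous_map (Euclidean_space n) (Euclidean_space m) (coords s m)"
proof -
  have "continuous_map (Euclidean_space n) euclideanreal (\<lambda>w. w i)" for i
    unfolding Euclidean_space_def by (intro continuous_map_from_subtopology continuous_map_product_projection) simp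
  then show ?thesis unfolding coords_def continuous_map_componentwise_Euclidean_space by blast
qed

text \<open>A partial derivative of the composite is one of \<open>f\<close>, or 0 for a coordinate that \<open>coords\<close> discards.\<close>

lemma ck_coords:
  assumes A: "\<And>w. w \<in> A \<Longrightarrow> coords s m w \<in> A1"
  shows "ck k m A1 f \<Longrightarrow> ck k n A (\<lambda>w. f (coords s m w))"
proof (induction k arbitrary: f)
  case 0
  have "continuous_map (subtopology (Euclidean_space n) A) (subtopology (Euclidean_space m) A1) (coords s m)"
    using A by (auto simp: continuous_map_in_subtopology intro!: continuous_map_from_subtopology continuous_map_coords)
  then show ?case using continuous_map_compose[of _ _ "coords s m" _ f] 0 by (simp add: o_def)
next
  case (Suc k)
  have "continuous_map (subtopology (Euclidean_space n) A) (subtopology (Euclidean_space m) A1) (coords s m)"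
    using A by (auto simp: continuous_map_in_subtopology intro!: continuous_map_from_subtopology continuous_map_coords)
  then have c: "continuous_map (subtopology (Euclidean_space n) A) euclideanreal (\<lambda>w. f (coords s m w))"
    using continuous_map_compose[of _ _ "coords s m" _ f] Suc.prems by (simp add: o_def)
  have "\<exists>d. (\<forall>w\<in>A. ((\<lambda>t. f (coords s m (w(i := t)))) has_real_derivative d w) (at (w i))) \<and> ck k n A d" for i
  proof (cases "s \<le> i \<and> i - s < m")
    case True
    then obtain j where j: "i = j + s" "j < m" by (metis le_add_diff_inverse2)
    obtain d where d: "\<forall>x\<in>A1. ((\<lambda>t. f (x(j := t))) has_real_derivative d x) (at (x j))" "ck k m A1 d"
      using Suc.prems j(2) unfolding ck.simps by blast
    have "coords s m (w(i := t)) = (coords s m w)(j := t)" for w t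
      using j by (auto simp: coords_def fun_eq_iff)
    moreover have "coords s m w j = w i" for w using j by (simp add: coords_def)
    ultimately have "((\<lambda>t. f (coords s m (w(i := t)))) has_real_derivative d (coords s m w)) (at (w i))" if "w \<in> A" for w
      using bspec[OF d(1) A[OF that]] by simp
    then show ?thesis using Suc.IH[OF d(2)] by (intro exI[of _ "\<lambda>w. d (coords s m w)"]) simp
  next
    case False
    have "coords s m (w(i := t)) = coords s m w" for w t
      using False by (auto simp: coords_def fun_eq_iff)
    then show ?thesis by (intro exI[of _ "\<lambda>w. 0"]) (simp add: ck_const)
  qed
  then show ?case using c by simp
qed

text \<open>The conditions on charts that make identities smooth. They pass to products.\<close>

definition smooth_atlas :: "'a mfd \<Rightarrow> bool" where
  "smooth_atlas N \<longleftrightarrow> (\<forall>(U, h)\<in>matlas N. U \<subseteq> pts N \<and> inj_on h U) \<and>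
     (\<forall>(U, h)\<in>matlas N. \<forall>(V, k)\<in>matlas N. openin (Euclidean_space (mdim N)) (h ` (U \<inter> V)) \<and>
        smooth_eucl (mdim N) (mdim N) (h ` (U \<inter> V)) (\<lambda>y. k (inv_into U h y)))"

lemma smooth_map_id:
  assumes N: "smooth_atlas N" and f: "\<And>x. x \<in> pts N \<Longrightarrow> f x = x"
  shows "smooth_map N N f"
  unfolding smooth_map_def
proof (rule conjI)
  show "continuous_map (mtop N) (mtop N) f"
    by (rule continuous_map_eq[of _ _ "\<lambda>x. x"]) (auto simp: f)
  have "smooth_eucl (mdim N) (mdim N) (h ` (U \<inter> f -` V)) (\<lambda>y. k (f (inv_into U h y)))"
    if c: "(U, h) \<in> matlas N" "(V, k) \<in> matlas N" for U h V k
  proof -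
    have U: "U \<subseteq> pts N" and op: "openin (Euclidean_space (mdim N)) (h ` (U \<inter> V))"
      and sm: "smooth_eucl (mdim N) (mdim N) (h ` (U \<inter> V)) (\<lambda>y. k (inv_into U h y))"
      using N c unfolding smooth_atlas_def by fast+
    have UV: "U \<inter> f -` V = U \<inter> V" using U f by auto
    have fi: "inv_into U h y = f (inv_into U h y)" if "y \<in> h ` (U \<inter> V)" for y
      using f[of "inv_into U h y"] inv_into_into[of y h U] that U by auto
    show ?thesis
      unfolding UV smooth_eucl_def
    proof (intro allI impI)
      fix j K assume "j < mdim N"
      then have "ck K (mdim N) (h ` (U \<inter> V)) (\<lambda>y. k (inv_into U h y) j)" using sm unfolding smooth_eucl_def by blast
      then show "ck K (mdim N) (h ` (U \<inter> V)) (\<lambda>y. k (f (inv_into U h y)) j)"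
        by (rule ck_cong[OF op, rotated]) (use fi in auto)
    qed
  qed
  then show "\<forall>(U, h)\<in>matlas N. \<forall>(V, k)\<in>matlas N.
      smooth_eucl (mdim N) (mdim N) (h ` (U \<inter> f -` V)) (\<lambda>y. k (f (inv_into U h y)))"
    by blast
qed

lemma diffeo_id:
  assumes N: "smooth_atlas N" and f: "\<And>x. x \<in> pts N \<Longrightarrow> f x = x"
  shows "diffeo N N f"
proof -
  have b: "bij_betw f (pts N) (pts N)" by (rule bij_betw_byWitness[of _ "\<lambda>x. x"]) (auto simp: f)
  have "inv_into (pts N) f x = x" if "x \<in> pts N" for x
    using inv_into_f_f[OF bij_betw_imp_inj_on[OF b] that] f[OF that] by simp
  then show ?thesis unfolding diffeo_def using b smooth_map_id[OF N f] smooth_map_id[OF N] by blast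
qed

lemma smooth_atlas_manifold:
  assumes M: "smooth_manifold M"
  shows "smooth_atlas M"
proof -
  have ch: "is_chart (mtop M) (mdim M) c" if "c \<in> matlas M" for c using M that unfolding smooth_manifold_def by blast
  have 1: "U \<subseteq> pts M \<and> inj_on h U" if "(U, h) \<in> matlas M" for U h
  proof -
    have c: "openin (mtop M) U" "homeomorphic_map (subtopology (mtop M) U) (subtopology (Euclidean_space (mdim M)) (h ` U)) h"
      using ch[OF that] unfolding is_chart_def by auto
    have U: "U \<subseteq> pts M" by (rule openin_subset[OF c(1)])
    then have "topspace (subtopology (mtop M) U) = U" by auto
    then show ?thesis using U homeomorphic_imp_injective_map[OF c(2)] by simp
  qed
  have 2: "openin (Euclidean_space (mdim M)) (h ` (U \<inter> V))" if "(U, h) \<in> matlas M" "(V, k) \<in> matlas M" for U h V k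
  proof -
    have c: "openin (Euclidean_space (mdim M)) (h ` U)" "openin (mtop M) U"
      "homeomorphic_map (subtopology (mtop M) U) (subtopology (Euclidean_space (mdim M)) (h ` U)) h" "openin (mtop M) V"
      using ch[OF that(1)] ch[OF that(2)] unfolding is_chart_def by auto
    have "openin (subtopology (mtop M) U) (U \<inter> V)" using c(4) by (auto simp: openin_subtopology)
    then have "openin (subtopology (Euclidean_space (mdim M)) (h ` U)) (h ` (U \<inter> V))"
      using homeomorphic_imp_open_map[OF c(3)] unfolding open_map_def by blast
    then show ?thesis by (rule openin_trans_full[OF _ c(1)])
  qed
  have 3: "smooth_eucl (mdim M) (mdim M) (h ` (U \<inter> V)) (\<lambda>y. k (inv_into U h y))"
    if "(U, h) \<in> matlas M" "(V, k) \<in> matlas M" for U h V k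
    using M that unfolding smooth_manifold_def by fast
  have 4: "openin (Euclidean_space (mdim M)) (h ` (U \<inter> V)) \<and>
      smooth_eucl (mdim M) (mdim M) (h ` (U \<inter> V)) (\<lambda>y. k (inv_into U h y))"
    if "(U, h) \<in> matlas M" "(V, k) \<in> matlas M" for U h V k
    using 2[OF that] 3[OF that] by (rule conjI)
  show ?thesis unfolding smooth_atlas_def
  proof (rule conjI)
    show "\<forall>(U, h)\<in>matlas M. U \<subseteq> pts M \<and> inj_on h U" by clarify (rule 1)
    show "\<forall>(U, h)\<in>matlas M. \<forall>(V, k)\<in>matlas M. openin (Euclidean_space (mdim M)) (h ` (U \<inter> V)) \<and>
        smooth_eucl (mdim M) (mdim M) (h ` (U \<inter> V)) (\<lambda>y. k (inv_into U h y))"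
      by clarify (rule 4)
  qed
qed

lemma pts_prod_mfd [simp]: "pts (prod_mfd M N) = pts M \<times> pts N"
  by (simp add: prod_mfd_def)

lemma chart_vanishes: "smooth_atlas M \<Longrightarrow> (U, h) \<in> matlas M \<Longrightarrow> x \<in> U \<Longrightarrow> i \<ge> mdim M \<Longrightarrow> h x i = 0"
proof -
  assume M: "smooth_atlas M" and U: "(U, h) \<in> matlas M" and x: "x \<in> U" and i: "i \<ge> mdim M"
  have "openin (Euclidean_space (mdim M)) (h ` (U \<inter> U))" using M U unfolding smooth_atlas_def by fast
  then have "h x \<in> topspace (Euclidean_space (mdim M))" using openin_subset x by blast
  then show ?thesis using i by (simp add: topspace_Euclidean_space)
qed

text \<open>The transition functions of product charts split into those of the factors, each of which depends
  on the coordinates of its own factor.\<close>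

lemma smooth_atlas_prod:
  fixes M :: "'a mfd" and N :: "'b mfd"
  assumes M: "smooth_atlas M" and N: "smooth_atlas N"
  shows "smooth_atlas (prod_mfd M N)"
proof -
  let ?m = "mdim M" and ?n = "mdim N" and ?P = "prod_mfd M N"
  define pr :: "('a \<Rightarrow> nat \<Rightarrow> real) \<Rightarrow> ('b \<Rightarrow> nat \<Rightarrow> real) \<Rightarrow> 'a \<times> 'b \<Rightarrow> nat \<Rightarrow> real"
    where "pr = (\<lambda>h k (x, y) i. if i < ?m then (h x i :: real) else k y (i - ?m))"
  have pr_app: "pr h k (x, y) i = (if i < ?m then h x i else k y (i - ?m))" for h k x y i
    by (simp add: pr_def)
  have dim: "mdim ?P = ?m + ?n" by (simp add: prod_mfd_def)
  have atlas: "matlas ?P = {(U \<times> V, pr h k) | U h V k. (U, h) \<in> matlas M \<and> (V, k) \<in> matlas N}"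
    by (simp add: prod_mfd_def pr_def)
  have c1: "coords 0 ?m (pr h k (x, y)) = h x" if "(U, h) \<in> matlas M" "x \<in> U" for U h k x y
    using chart_vanishes[OF M that] by (auto simp: coords_def pr_def fun_eq_iff)
  have c2: "coords ?m ?n (pr h k (x, y)) = k y" if "(V, k) \<in> matlas N" "y \<in> V" for V h k x y
    using chart_vanishes[OF N that] by (auto simp: coords_def pr_def fun_eq_iff)
  have Msub: "U \<subseteq> pts M" "inj_on h U" if "(U, h) \<in> matlas M" for U h using M that unfolding smooth_atlas_def by fast+
  have Nsub: "U \<subseteq> pts N" "inj_on h U" if "(U, h) \<in> matlas N" for U h using N that unfolding smooth_atlas_def by fast+
  have Mop: "openin (Euclidean_space ?m) (h ` (U \<inter> V))" "smooth_eucl ?m ?m (h ` (U \<inter> V)) (\<lambda>y. k (inv_into U h y))"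
    if "(U, h) \<in> matlas M" "(V, k) \<in> matlas M" for U h V k using M that unfolding smooth_atlas_def by fast+
  have Nop: "openin (Euclidean_space ?n) (h ` (U \<inter> V))" "smooth_eucl ?n ?n (h ` (U \<inter> V)) (\<lambda>y. k (inv_into U h y))"
    if "(U, h) \<in> matlas N" "(V, k) \<in> matlas N" for U h V k using N that unfolding smooth_atlas_def by fast+
  have sub: "U \<times> V \<subseteq> pts ?P \<and> inj_on (pr h k) (U \<times> V)" if UV: "(U, h) \<in> matlas M" "(V, k) \<in> matlas N" for U h V k
  proof
    show "U \<times> V \<subseteq> pts ?P" using Msub(1)[OF UV(1)] Nsub(1)[OF UV(2)] by auto
    show "inj_on (pr h k) (U \<times> V)"
    proof (rule inj_onI)
      fix z z' assume z: "z \<in> U \<times> V" "z' \<in> U \<times> V" "pr h k z = pr h k z'"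
      obtain x y x' y' where e: "z = (x, y)" "z' = (x', y')" by (cases z, cases z')
      have m: "x \<in> U" "x' \<in> U" "y \<in> V" "y' \<in> V" using z e by auto
      have "h x = h x'" using c1[OF UV(1) m(1), of k y] c1[OF UV(1) m(2), of k y'] z(3) e by simp
      moreover have "k y = k y'" using c2[OF UV(2) m(3), of h x] c2[OF UV(2) m(4), of h x'] z(3) e by simp
      ultimately show "z = z'" using inj_onD[OF Msub(2)[OF UV(1)]] inj_onD[OF Nsub(2)[OF UV(2)]] m e by blast
    qed
  qed
  have trans: "openin (Euclidean_space (?m + ?n)) (pr h k ` (U \<times> V \<inter> U' \<times> V')) \<and>
      smooth_eucl (?m + ?n) (?m + ?n) (pr h k ` (U \<times> V \<inter> U' \<times> V')) (\<lambda>y. pr h' k' (inv_into (U \<times> V) (pr h k) y))"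
    if UV: "(U, h) \<in> matlas M" "(V, k) \<in> matlas N" and UV': "(U', h') \<in> matlas M" "(V', k') \<in> matlas N"
    for U h V k U' h' V' k'
  proof -
    let ?A = "pr h k ` (U \<times> V \<inter> U' \<times> V')" and ?A1 = "h ` (U \<inter> U')" and ?A2 = "k ` (V \<inter> V')"
    let ?E = "Euclidean_space (?m + ?n)"
    have co: "coords 0 ?m w \<in> ?A1" "coords ?m ?n w \<in> ?A2"
      "inv_into (U \<times> V) (pr h k) w = (inv_into U h (coords 0 ?m w), inv_into V k (coords ?m ?n w))" if w: "w \<in> ?A" for w
    proof -
      obtain x y where xy: "x \<in> U" "x \<in> U'" "y \<in> V" "y \<in> V'" "w = pr h k (x, y)" using w by auto
      have e: "coords 0 ?m w = h x" "coords ?m ?n w = k y"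
        using c1[OF UV(1) xy(1)] c2[OF UV(2) xy(3)] xy(5) by auto
      show "coords 0 ?m w \<in> ?A1" "coords ?m ?n w \<in> ?A2" using e xy by auto
      have "inv_into (U \<times> V) (pr h k) w = (x, y)"
        unfolding xy(5) by (rule inv_into_f_f) (use sub[OF UV] xy in auto)
      then show "inv_into (U \<times> V) (pr h k) w = (inv_into U h (coords 0 ?m w), inv_into V k (coords ?m ?n w))"
        unfolding e using inv_into_f_f[OF Msub(2)[OF UV(1)] xy(1)] inv_into_f_f[OF Nsub(2)[OF UV(2)] xy(3)] by simp
    qed
    have A_eq: "?A = {w \<in> topspace ?E. coords 0 ?m w \<in> ?A1} \<inter> {w \<in> topspace ?E. coords ?m ?n w \<in> ?A2}" (is "_ = ?R")
    proof (rule set_eqI, rule iffI)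
      fix w assume w: "w \<in> ?A"
      then obtain x y where xy: "x \<in> U" "y \<in> V" "w = pr h k (x, y)" by auto
      have "w \<in> topspace ?E"
        unfolding topspace_Euclidean_space xy(3) pr_def using chart_vanishes[OF N UV(2) xy(2)] by auto
      then show "w \<in> ?R" using co[OF w] by blast
    next
      fix w assume w: "w \<in> ?R"
      then obtain x y where xy: "x \<in> U" "x \<in> U'" "y \<in> V" "y \<in> V'" "coords 0 ?m w = h x" "coords ?m ?n w = k y" by auto
      have w0: "w i = 0" if "i \<ge> ?m + ?n" for i using w that by (auto simp: topspace_Euclidean_space)
      have "w i = pr h k (x, y) i" for i
      proof (cases "i < ?m")
        case True
        then show ?thesis using fun_cong[OF xy(5), of i] by (simp add: coords_def pr_def)
      next
        case False
        then show ?thesis using fun_cong[OF xy(6), of "i - ?m"] w0[of i] by (auto simp: coords_def pr_def split: if_splits)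
      qed
      then have "w = pr h k (x, y)" by (rule ext)
      then show "w \<in> ?A" using xy by blast
    qed
    have op: "openin ?E ?A"
      unfolding A_eq
      by (intro openin_Int openin_continuous_map_preimage[OF continuous_map_coords])
        (use Mop(1)[OF UV(1) UV'(1)] Nop(1)[OF UV(2) UV'(2)] in auto)
    moreover have "ck K (?m + ?n) ?A (\<lambda>w. pr h' k' (inv_into (U \<times> V) (pr h k) w) j)" if j: "j < ?m + ?n" for j K
    proof (cases "j < ?m")
      case True
      have "ck K ?m ?A1 (\<lambda>y. h' (inv_into U h y) j)" using Mop(2)[OF UV(1) UV'(1)] True unfolding smooth_eucl_def by blast
      from ck_coords[OF co(1) this, where n = "?m + ?n"] show ?thesis
      proof (rule ck_cong[OF op, rotated])
        fix w assume w: "w \<in> ?A"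
        show "h' (inv_into U h (coords 0 ?m w)) j = pr h' k' (inv_into (U \<times> V) (pr h k) w) j"
          unfolding co(3)[OF w] pr_app using True by simp
      qed
    next
      case False
      then have "j - ?m < ?n" using j by simp
      then have "ck K ?n ?A2 (\<lambda>y. k' (inv_into V k y) (j - ?m))" using Nop(2)[OF UV(2) UV'(2)] unfolding smooth_eucl_def by blast
      from ck_coords[OF co(2) this, where n = "?m + ?n"] show ?thesis
      proof (rule ck_cong[OF op, rotated])
        fix w assume w: "w \<in> ?A"
        show "k' (inv_into V k (coords ?m ?n w)) (j - ?m) = pr h' k' (inv_into (U \<times> V) (pr h k) w) j"
          unfolding co(3)[OF w] pr_app using False by simp
      qed
    qed
    ultimately show ?thesis unfolding smooth_eucl_def by blast
  qed
  show ?thesis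
    unfolding smooth_atlas_def dim
  proof (rule conjI)
    show "\<forall>(W, g)\<in>matlas ?P. W \<subseteq> pts ?P \<and> inj_on g W"
    proof (intro ballI, clarify)
      fix W g assume "(W, g) \<in> matlas ?P"
      then obtain U h V k where "W = U \<times> V" "g = pr h k" "(U, h) \<in> matlas M" "(V, k) \<in> matlas N"
        unfolding atlas by blast
      then show "W \<subseteq> pts ?P \<and> inj_on g W" using sub by simp
    qed
    show "\<forall>(W, g)\<in>matlas ?P. \<forall>(W', g')\<in>matlas ?P. openin (Euclidean_space (?m + ?n)) (g ` (W \<inter> W')) \<and>
        smooth_eucl (?m + ?n) (?m + ?n) (g ` (W \<inter> W')) (\<lambda>y. g' (inv_into W g y))"
    proof (intro ballI, clarify)
      fix W g W' g' assume "(W, g) \<in> matlas ?P" "(W', g') \<in> matlas ?P"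
      then obtain U h V k U' h' V' k' where
        "W = U \<times> V" "g = pr h k" "(U, h) \<in> matlas M" "(V, k) \<in> matlas N"
        "W' = U' \<times> V'" "g' = pr h' k'" "(U', h') \<in> matlas M" "(V', k') \<in> matlas N"
        unfolding atlas by blast
      then show "openin (Euclidean_space (?m + ?n)) (g ` (W \<inter> W')) \<and>
          smooth_eucl (?m + ?n) (?m + ?n) (g ` (W \<inter> W')) (\<lambda>y. g' (inv_into W g y))"
        by (simp only: trans)
    qed
  qed
qed

lemma smooth_map_const:
  fixes N :: "'a mfd" and R :: "'b mfd"
  assumes N: "smooth_atlas N" and a: "a \<in> pts R"
  shows "smooth_map N R (\<lambda>x\<in>pts N. a)"
  unfolding smooth_map_def
proof (rule conjI)
  show "continuous_map (mtop N) (mtop R) (\<lambda>x\<in>pts N. a)"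
    by (rule continuous_map_eq[of _ _ "\<lambda>x. a"]) (auto simp: a)
  have "smooth_eucl (mdim N) (mdim R) (h ` (U \<inter> (\<lambda>x\<in>pts N. a) -` V)) (\<lambda>y. k ((\<lambda>x\<in>pts N. a) (inv_into U h y)))"
    if c: "(U, h) \<in> matlas N" for U h V and k :: "'b \<Rightarrow> nat \<Rightarrow> real"
  proof -
    have U: "U \<subseteq> pts N" and op: "openin (Euclidean_space (mdim N)) (h ` (U \<inter> U))"
      using N c unfolding smooth_atlas_def by fast+
    let ?A = "h ` (U \<inter> (\<lambda>x\<in>pts N. a) -` V)"
    have A: "?A = (if a \<in> V then h ` U else {})" using U by auto
    have opA: "openin (Euclidean_space (mdim N)) ?A" unfolding A using op by simp
    have v: "(\<lambda>x\<in>pts N. a) (inv_into U h y) = a" if "y \<in> ?A" for y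
      using that inv_into_into[of y h U] U by auto
    have "ck K (mdim N) ?A (\<lambda>y. k ((\<lambda>x\<in>pts N. a) (inv_into U h y)) j)" for j K
      by (rule ck_cong[OF opA _ ck_const[of _ _ _ "k a j"]]) (simp only: v)
    then show ?thesis unfolding smooth_eucl_def by blast
  qed
  then show "\<forall>(U, h)\<in>matlas N. \<forall>(V, k)\<in>matlas R.
      smooth_eucl (mdim N) (mdim R) (h ` (U \<inter> (\<lambda>x\<in>pts N. a) -` V)) (\<lambda>y. k ((\<lambda>x\<in>pts N. a) (inv_into U h y)))"
    by blast
qed

lemma cart_obj_atlas: "c \<in> cart_obj \<Longrightarrow> smooth_atlas c"
  unfolding cart_obj_def by (simp add: smooth_atlas_manifold)

text \<open>This and \<open>cart_const_arr\<close> below are what it takes to restrict the vertex \<open>G\<close> of \<open>Fix(R\<^sup>0)\<close> to every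
  object and to use that the restriction is functorial.\<close>

lemma fam_id_diff_fam:
  assumes M: "smooth_manifold M" and c: "c \<in> cart_obj"
  shows "fam_id M c \<in> diff_fam M c"
proof -
  have "diffeo M M (\<lambda>z\<in>pts M. z)" by (rule diffeo_id[OF smooth_atlas_manifold[OF M]]) simp
  moreover have "diffeo (prod_mfd c M) (prod_mfd c M) (\<lambda>(x, z). (x, fam_id M c x z))"
    by (rule diffeo_id[OF smooth_atlas_prod[OF cart_obj_atlas[OF c] smooth_atlas_manifold[OF M]]])
      (auto simp: fam_id_def)
  ultimately show ?thesis unfolding diff_fam_def by (auto simp: fam_id_def)
qed

lemma cart_arr_iff: "(c, f, d) \<in> cArr cart \<longleftrightarrow> c \<in> cart_obj \<and> d \<in> cart_obj \<and> f \<in> extensional (pts c) \<and> smooth_map c d f"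
  by (simp add: cart_def)

lemma cart_id_arr: "c \<in> cart_obj \<Longrightarrow> (c, \<lambda>x\<in>pts c. x, c) \<in> cArr cart"
  unfolding cart_arr_iff by (simp add: smooth_map_id[OF cart_obj_atlas])

lemma cart_const_arr: "c \<in> cart_obj \<Longrightarrow> R \<in> cart_obj \<Longrightarrow> a \<in> pts R \<Longrightarrow> (c, \<lambda>x\<in>pts c. a, R) \<in> cArr cart"
  unfolding cart_arr_iff by (simp add: smooth_map_const[OF cart_obj_atlas])

section \<open>Categories of families of diffeomorphisms\<close>

lemma bdiff_simps [simp]:
  "cObj (bdiff M D) = cart_obj" "cDom (bdiff M D) (c, (f, \<phi>), d) = c" "cCod (bdiff M D) (c, (f, \<phi>), d) = d"
  "cId (bdiff M D) c = (c, (\<lambda>x\<in>pts c. x, fam_id M c), c)"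
  "cComp (bdiff M D) (d', (g, \<psi>), e) (c, (f, \<phi>), d) =
    (c, (compose (pts c) g f, \<lambda>x\<in>pts c. compose (pts M) (\<psi> (f x)) (\<phi> x)), e)"
  by (simp_all add: bdiff_def)

lemma bdiff_arr_iff: "(c, (f, \<phi>), d) \<in> cArr (bdiff M D) \<longleftrightarrow> (c, f, d) \<in> cArr cart \<and> \<phi> \<in> D c"
  by (simp add: bdiff_def)

lemma bdiff_arrE:
  assumes "u \<in> cArr (bdiff M D)"
  obtains c f \<phi> d where "u = (c, (f, \<phi>), d)" "(c, f, d) \<in> cArr cart" "\<phi> \<in> D c" "c \<in> cart_obj" "d \<in> cart_obj"
proof -
  obtain c f \<phi> d where u: "u = (c, (f, \<phi>), d)" by (metis prod.exhaust)
  then have "(c, f, d) \<in> cArr cart" "\<phi> \<in> D c" using assms unfolding u bdiff_arr_iff by auto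
  then show thesis using that[OF u] unfolding cart_arr_iff by blast
qed

lemma bdiff_cong:
  assumes "\<And>c. c \<in> cart_obj \<Longrightarrow> D c = D' c"
  shows "bdiff M D = bdiff M D'"
proof -
  have "{(c, (f, \<phi>), d). (c, f, d) \<in> cArr cart \<and> \<phi> \<in> D c} = {(c, (f, \<phi>), d). (c, f, d) \<in> cArr cart \<and> \<phi> \<in> D' c}"
    using assms by (auto simp: cart_arr_iff)
  then show ?thesis unfolding bdiff_def by simp
qed

lemma bdiff_sub_arr: "D \<le> D' \<Longrightarrow> cArr (bdiff M D) \<subseteq> cArr (bdiff M D')"
  unfolding bdiff_def le_fun_def by auto

lemma simplicial_presheaf_restrict:
  assumes F: "simplicial_presheaf (bdiff M D') F" and D: "D \<le> D'"
  shows "simplicial_presheaf (bdiff M D) F"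
proof -
  interpret presheaf_of_simplicial_sets "bdiff M D'" F using F by unfold_locales
  have sub: "u \<in> cArr (bdiff M D')" if "u \<in> cArr (bdiff M D)" for u using bdiff_sub_arr[OF D] that by blast
  have e: "cDom (bdiff M D) = cDom (bdiff M D')" "cCod (bdiff M D) = cCod (bdiff M D')"
    "cId (bdiff M D) = cId (bdiff M D')" "cComp (bdiff M D) = cComp (bdiff M D')" by (simp_all add: bdiff_def)
  show ?thesis
    unfolding simplicial_presheaf_def e
    using pob_sset pmap_simp_map[OF sub] pmap_id pmap_comp[OF sub sub] by simp
qed

lemma presheaf_map_restrict:
  assumes t: "presheaf_map (bdiff M D') F G t" and D: "D \<le> D'"
  shows "presheaf_map (bdiff M D) F G t"
proof -
  have sub: "u \<in> cArr (bdiff M D')" if "u \<in> cArr (bdiff M D)" for u using bdiff_sub_arr[OF D] that by blast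
  have e: "cDom (bdiff M D) = cDom (bdiff M D')" "cCod (bdiff M D) = cCod (bdiff M D')" by (simp_all add: bdiff_def)
  show ?thesis using t sub unfolding presheaf_map_def e bdiff_simps by blast
qed

lemma diff_stab_sub: "diff_stab M R0 Fix G \<le> diff_fam M"
  unfolding diff_stab_def le_fun_def by blast

section \<open>Vertices and edges of the unstraightening\<close>

lemma nerve_vertex:
  assumes "\<sigma> \<in> sx (nerve C) 0"
  shows "\<sigma> = tri 0 (\<lambda>i j. cId C (ob C \<sigma> 0))"
  by (rule nerve_ext[OF nerveD(1)[OF assms] tri_idem])
    (use nerveD(3)[OF assms order_refl] in \<open>simp add: tri_def\<close>)

lemma unstr_map_comp:
  "unstr_map C t n (unstr_map C r n s) = unstr_map C (\<lambda>c n x. t c n (r c n x)) n s"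
  by (cases s) (auto simp: unstr_map_simp intro!: nth_equalityI)

lemma fst_unstr_map [simp]: "fst (unstr_map C t n s) = fst s"
  by (cases s) (simp add: unstr_map_simp)

context presheaf_of_simplicial_sets
begin

lemma unstr_vertexE:
  assumes "s \<in> sx (unstr C F) 0"
  obtains \<sigma> x where "s = (\<sigma>, [x])" "\<sigma> \<in> sx (nerve (op_cat C)) 0" "x \<in> sx (pob F (ob (op_cat C) \<sigma> 0)) 0"
proof -
  obtain \<sigma> xs where s: "s = (\<sigma>, xs)" by (cases s)
  have h: "\<sigma> \<in> sx (nerve (op_cat C)) 0" "length xs = Suc 0" "xs ! 0 \<in> sx (pob F (ob (op_cat C) \<sigma> 0)) 0"
    using assms unfolding s unstr_sx by auto
  obtain x where "xs = [x]" using h(2) by (auto simp: length_Suc_conv)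
  then show thesis using that h s by simp
qed

text \<open>An edge over an arrow from \<open>c'\<close> to \<open>c\<close> is a vertex over \<open>c\<close> with an edge over \<open>c'\<close> that begins
  in its restriction.\<close>

lemma unstr_edge:
  assumes t: "\<tau> \<in> sx (nerve (op_cat C)) 1"
    and x: "x \<in> sx (pob F (ob (op_cat C) \<tau> 0)) 0" and e: "e \<in> sx (pob F (ob (op_cat C) \<tau> 1)) 1"
    and xe: "sact (pob F (ob (op_cat C) \<tau> 1)) 1 [0] e = pmap F (\<tau> 0 1) 0 x"
  shows "(\<tau>, [x, e]) \<in> sx (unstr C F) 1"
    and "sact (unstr C F) 1 [0] (\<tau>, [x, e]) = (nerve_act [0] \<tau>, [x])"
    and "sact (unstr C F) 1 [1] (\<tau>, [x, e]) = (nerve_act [1] \<tau>, [sact (pob F (ob (op_cat C) \<tau> 1)) 1 [1] e])"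
proof -
  note X0 = chain_sset[OF t, of 0] and X1 = chain_sset[OF t, of 1]
  have n1: "[x, e] ! 1 = e" by (simp add: One_nat_def)
  show "(\<tau>, [x, e]) \<in> sx (unstr C F) 1"
    unfolding unstr_sx
  proof (intro conjI)
    show "\<tau> \<in> sx (nerve (op_cat C)) 1" by (rule t)
    show "length [x, e] = Suc 1" by (simp add: One_nat_def)
    show "\<forall>i\<le>1. [x, e] ! i \<in> sx (pob F (ob (op_cat C) \<tau> i)) i"
      unfolding all_le_1 n1 using x e by simp
    show "\<forall>i j. i \<le> j \<and> j \<le> 1 \<longrightarrow>
        sact (pob F (ob (op_cat C) \<tau> j)) j (did i) ([x, e] ! j) = pmap F (\<tau> i j) i ([x, e] ! i)"
    proof (intro allI impI)
      fix i j :: nat assume "i \<le> j \<and> j \<le> 1"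
      then consider "i = 0" "j = 0" | "i = 0" "j = 1" | "i = 1" "j = 1" by linarith
      then show "sact (pob F (ob (op_cat C) \<tau> j)) j (did i) ([x, e] ! j) = pmap F (\<tau> i j) i ([x, e] ! i)"
      proof cases
        case 1
        then show ?thesis using sset_id[OF X0 x] chain_id[OF t _ x] by simp
      next
        case 2
        then show ?thesis using xe by (simp add: did_0 n1)
      next
        case 3
        then show ?thesis using sset_id[OF X1 e] chain_id[OF t _ e] by (simp add: n1)
      qed
    qed
  qed
  show "sact (unstr C F) 1 [0] (\<tau>, [x, e]) = (nerve_act [0] \<tau>, [x])"
    using sset_id[OF X0 x] by (simp add: unstr_sact did_0)
  show "sact (unstr C F) 1 [1] (\<tau>, [x, e]) = (nerve_act [1] \<tau>, [sact (pob F (ob (op_cat C) \<tau> 1)) 1 [1] e])"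
    by (simp add: unstr_sact n1)
qed

end

section \<open>Solutions on a fixed background\<close>

text \<open>The part of the situation that involves a single presheaf \<open>Fix\<close>. It is used for \<open>p\<close> and for the
  composite of \<open>p\<close> and \<open>q\<close>, restricted to \<open>Sol\<close>.\<close>

locale solutions_on_background =
  fixes M :: "'m mfd" and R0 :: "'u mfd"
    and Sol :: "('u mfd, ('u, 'm) bd_arr, 'x) psh" and Fix :: "('u mfd, ('u, 'm) bd_arr, 'y) psh"
    and r :: "'u mfd \<Rightarrow> nat \<Rightarrow> 'x \<Rightarrow> 'y" and G :: 'y
  assumes M: "smooth_manifold M" and R0: "R0 \<in> cart_obj" "diffeomorphic R0 (eucl_mfd 0)"
    and Fix: "proj_fibrant (bdiff M (diff_fam M)) Fix"
    and Sol: "proj_fibrant (bdiff M (diff_fam M)) Sol"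
    and r: "presheaf_map (bdiff M (diff_fam M)) Sol Fix r"
    and path_lift: "c \<in> cart_obj \<Longrightarrow> x \<in> sx (pob Sol c) 0 \<Longrightarrow> e \<in> sx (pob Fix c) 1 \<Longrightarrow>
      sact (pob Fix c) 1 [0] e = r c 0 x \<Longrightarrow>
      \<exists>e'\<in>sx (pob Sol c) 1. r c 1 e' = e \<and> sact (pob Sol c) 1 [0] e' = x"
    and G: "G \<in> sx (pob Fix R0) 0"
begin

abbreviation BD where "BD \<equiv> bdiff M (diff_fam M)"
abbreviation S where "S \<equiv> bd_stab M R0 Fix G"
abbreviation Gc where "Gc \<equiv> pull_const M R0 Fix G"

sublocale Fix: presheaf_of_simplicial_sets BD Fix
  using Fix unfolding proj_fibrant_def by unfold_locales blast

sublocale SolS: presheaf_of_simplicial_sets S Sol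
  by unfold_locales
    (rule simplicial_presheaf_restrict[OF conjunct1[OF Sol[unfolded proj_fibrant_def]] diff_stab_sub])

sublocale FixS: presheaf_of_simplicial_sets S Fix
  by unfold_locales
    (rule simplicial_presheaf_restrict[OF conjunct1[OF Fix[unfolded proj_fibrant_def]] diff_stab_sub])

lemma rS: "presheaf_map S Sol Fix r"
  by (rule presheaf_map_restrict[OF r diff_stab_sub])

lemma r_map: "c \<in> cart_obj \<Longrightarrow> simp_map (pob Sol c) (pob Fix c) (r c)"
  using r unfolding presheaf_map_def by simp

lemma r_nat: "u \<in> cArr S \<Longrightarrow> x \<in> sx (pob Sol (cCod S u)) n \<Longrightarrow>
    r (cDom S u) n (pmap Sol u n x) = pmap Fix u n (r (cCod S u) n x)"
  using rS unfolding presheaf_map_def by blast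

lemma point_in: "the_elem (pts R0) \<in> pts R0"
proof -
  obtain f where "bij_betw f (pts R0) (pts (eucl_mfd 0))"
    using R0(2) unfolding diffeomorphic_def diffeo_def by blast
  moreover have "pts (eucl_mfd 0) = {\<lambda>i. 0}" by (auto simp: eucl_mfd_def topspace_Euclidean_space fun_eq_iff)
  ultimately have "card (pts R0) = 1" using bij_betw_same_card by fastforce
  then obtain a where "pts R0 = {a}" by (rule card_1_singletonE)
  then show ?thesis by simp
qed

lemma const_arr: "c \<in> cart_obj \<Longrightarrow> (c, (\<lambda>x\<in>pts c. the_elem (pts R0), fam_id M c), R0) \<in> cArr BD"
  unfolding bdiff_arr_iff using cart_const_arr[OF _ R0(1) point_in] fam_id_diff_fam[OF M] by blast

lemma Gc_in: "c \<in> cart_obj \<Longrightarrow> Gc c \<in> sx (pob Fix c) 0"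
  unfolding pull_const_def using simp_map_in[OF Fix.pmap_simp_map[OF const_arr]] G by simp

lemma fam_pts: "\<phi> \<in> diff_fam M c \<Longrightarrow> x \<in> pts c \<Longrightarrow> \<phi> x \<in> extensional (pts M) \<and> \<phi> x ` pts M = pts M"
  unfolding diff_fam_def diffeo_def by (auto dest: bij_betw_imp_surj_on)

lemma cart_fun: "(c, f, d) \<in> cArr cart \<Longrightarrow> f \<in> extensional (pts c) \<and> f ` pts c \<subseteq> pts d"
  unfolding cart_arr_iff smooth_map_def by (auto simp: continuous_map_def)

text \<open>Restricting \<open>G\<close> along \<open>(f, \<phi>)\<close> depends on \<open>\<phi>\<close> only, since \<open>(f, \<phi>)\<close> is \<open>(1, \<phi>)\<close> followed by
  \<open>(f, 1)\<close> and the latter restricts one constant family to another.\<close>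

lemma pmap_Gc:
  assumes u: "(c', (f, \<phi>), c) \<in> cArr BD"
  shows "pmap Fix (c', (f, \<phi>), c) 0 (Gc c) = pmap Fix (c', (\<lambda>x\<in>pts c'. x, \<phi>), c') 0 (Gc c')"
proof -
  have f: "(c', f, c) \<in> cArr cart" and p: "\<phi> \<in> diff_fam M c'" and c: "c' \<in> cart_obj" "c \<in> cart_obj"
    using u unfolding bdiff_arr_iff cart_arr_iff by auto
  let ?f = "(c', (f, fam_id M c'), c)" and ?p = "(c', (\<lambda>x\<in>pts c'. x, \<phi>), c')"
  let ?k = "\<lambda>c. (c, (\<lambda>x\<in>pts c. the_elem (pts R0), fam_id M c), R0)"
  have fa: "?f \<in> cArr BD" and pa: "?p \<in> cArr BD"
    unfolding bdiff_arr_iff using f p cart_id_arr[OF c(1)] fam_id_diff_fam[OF M c(1)] by auto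
  note fp = cart_fun[OF f] and pp = fam_pts[OF p]
  have comp1: "cComp BD ?f ?p = (c', (f, \<phi>), c)"
  proof -
    have "compose (pts c') f (\<lambda>x\<in>pts c'. x) = f" using fp by (auto simp: compose_def fun_eq_iff extensional_def)
    moreover have "(\<lambda>x\<in>pts c'. compose (pts M) (fam_id M c' ((\<lambda>x\<in>pts c'. x) x)) (\<phi> x)) = \<phi>"
    proof (rule extensionalityI[of _ "pts c'"])
      show "\<phi> \<in> extensional (pts c')" using p unfolding diff_fam_def by blast
      fix x assume x: "x \<in> pts c'"
      have "compose (pts M) (\<lambda>z\<in>pts M. z) (\<phi> x) = \<phi> x"
        using pp[OF x] by (auto simp: compose_def fun_eq_iff extensional_def)
      then show "(\<lambda>x\<in>pts c'. compose (pts M) (fam_id M c' ((\<lambda>x\<in>pts c'. x) x)) (\<phi> x)) x = \<phi> x"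
        using x by (simp add: fam_id_def)
    qed simp
    ultimately show ?thesis by simp
  qed
  have comp2: "cComp BD (?k c) ?f = ?k c'"
  proof -
    have "compose (pts c') (\<lambda>x\<in>pts c. the_elem (pts R0)) f = (\<lambda>x\<in>pts c'. the_elem (pts R0))"
      using fp by (auto simp: compose_def fun_eq_iff)
    moreover have "(\<lambda>x\<in>pts c'. compose (pts M) (fam_id M c (f x)) (fam_id M c' x)) = fam_id M c'"
      using fp by (auto simp: compose_def fun_eq_iff fam_id_def)
    ultimately show ?thesis by simp
  qed
  have "pmap Fix (c', (f, \<phi>), c) 0 (Gc c) = pmap Fix ?p 0 (pmap Fix ?f 0 (Gc c))"
    using Fix.pmap_comp[OF pa fa, of "Gc c" 0] Gc_in[OF c(2)] unfolding comp1 by simp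
  also have "pmap Fix ?f 0 (Gc c) = Gc c'"
    using Fix.pmap_comp[OF fa const_arr[OF c(2)], of G 0] G unfolding comp2 pull_const_def by simp
  finally show ?thesis .
qed

text \<open>The stabiliser is defined by arrows \<open>(1, \<phi>)\<close>; by the preceding lemma all arrows of \<open>S\<close> preserve the
  component of \<open>G\<close>.\<close>

lemma stab_arr_Gc:
  assumes u: "(c', (f, \<phi>), c) \<in> cArr S"
  shows "(pmap Fix (c', (f, \<phi>), c) 0 (Gc c), Gc c') \<in> conn (pob Fix c')"
proof -
  have "(c', (f, \<phi>), c) \<in> cArr BD" by (rule subsetD[OF bdiff_sub_arr[OF diff_stab_sub] u])
  moreover have "\<phi> \<in> diff_stab M R0 Fix G c'" using u unfolding bdiff_arr_iff by blast
  ultimately show ?thesis unfolding diff_stab_def by (simp add: pmap_Gc)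
qed

text \<open>The vertices of \<open>BSYM\<close> inside the unstraightening, and those of the moduli problem inside the
  pullback of the unstraightening of \<open>Sol\<close> to \<open>Q\<close>.\<close>

definition backgrounds :: "(('u, 'm) bd_arr, 'y) un set" where
  "backgrounds = {(tri 0 (\<lambda>i j. cId S c), [Gc c]) | c. c \<in> cart_obj}"

definition on_background :: "('q \<times> (('u, 'm) bd_arr, 'x) un) set" where
  "on_background = {(a, s). unstr_map S r 0 s \<in> backgrounds}"

lemma background_iff:
  assumes "\<sigma> \<in> sx (nerve (op_cat S)) 0"
  shows "unstr_map S r 0 (\<sigma>, [x]) \<in> backgrounds \<longleftrightarrow> r (ob (op_cat S) \<sigma> 0) 0 x = Gc (ob (op_cat S) \<sigma> 0)"
proof -
  let ?c = "ob (op_cat S) \<sigma> 0"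
  have c: "?c \<in> cart_obj" using nerveD(2)[OF assms order_refl] by simp
  have s: "\<sigma> = tri 0 (\<lambda>i j. cId S ?c)" using nerve_vertex[OF assms] by (simp del: bdiff_simps)
  have m: "unstr_map S r 0 (\<sigma>, [x]) = (\<sigma>, [r ?c 0 x])" by (simp add: unstr_map_simp)
  have o: "ob (op_cat S) (tri 0 (\<lambda>i j. cId S c)) 0 = c" for c by (simp add: ob_def tri_def)
  show ?thesis
  proof
    assume "unstr_map S r 0 (\<sigma>, [x]) \<in> backgrounds"
    then obtain d where d: "\<sigma> = tri 0 (\<lambda>i j. cId S d)" "r ?c 0 x = Gc d" unfolding m backgrounds_def by blast
    have "?c = d" using o[of d] d(1) by simp
    then show "r ?c 0 x = Gc ?c" using d(2) by simp
  next
    assume "r ?c 0 x = Gc ?c"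
    then show "unstr_map S r 0 (\<sigma>, [x]) \<in> backgrounds" unfolding m backgrounds_def using c s by blast
  qed
qed

lemma r_unstr: "simp_map (unstr S Sol) (unstr S Fix) (unstr_map S r)"
  by (rule simp_map_unstr_map[OF rS])

lemma sol_fibration: "left_fibration (unstr S Sol) (nerve (op_cat S)) (\<lambda>n. fst)"
  by (rule SolS.left_fibration_unstr) (use Sol in \<open>auto simp: proj_fibrant_def\<close>)

lemma mdl_sact:
  "sact (mdl_total M R0 Sol Fix r G Q \<phi>) n \<alpha> ((a, b), s) =
    ((sact Q n \<alpha> a, sact (unstr S Fix) n \<alpha> b), sact (unstr S Sol) n \<alpha> s)"
  by (simp add: mdl_total_def bsym_rev_def)

text \<open>The component of a simplex in \<open>BSYM\<close> is the image of its component in the unstraightening of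
  \<open>Sol\<close>. Forgetting it embeds the total space as a full simplicial subset of a pullback that does not
  involve \<open>Fix\<close>; different choices of \<open>Fix\<close> only lead to different sets of vertices.\<close>

lemma mdl_sx:
  fixes Q :: "'q sset"
  assumes Q: "is_sset Q"
  shows "((a, b), s) \<in> sx (mdl_total M R0 Sol Fix r G Q \<phi>) n \<longleftrightarrow>
    b = unstr_map S r n s \<and> (a, s) \<in> sx (full_sub (pullback Q (unstr S Sol) \<phi> (\<lambda>n. fst)) on_background) n"
proof -
  have v: "sact (unstr S Fix) n [i] (unstr_map S r n s) = unstr_map S r 0 (sact (unstr S Sol) n [i] s)"
    if "i \<le> n" "s \<in> sx (unstr S Sol) n" for i
    using simp_map_nat[OF r_unstr sing_in[OF that(1)] that(2)] by simp
  have b: "unstr_map S r n s \<in> sx (bsym_rev M R0 Fix G) n \<longleftrightarrow>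
      (\<forall>i\<le>n. unstr_map S r 0 (sact (unstr S Sol) n [i] s) \<in> backgrounds)" if s: "s \<in> sx (unstr S Sol) n"
    unfolding bsym_rev_def full_sub_sx backgrounds_def[symmetric] using v s simp_map_in[OF r_unstr s] by auto
  show ?thesis
    unfolding mdl_total_def pullback_sx full_sub_sx pullback_sact on_background_def
    using b by auto
qed

lemma mdl_bij:
  fixes Q :: "'q sset"
  assumes Q: "is_sset Q"
  shows "bij_betw (\<lambda>((a, b), s). (a, s)) (sx (mdl_total M R0 Sol Fix r G Q \<phi>) n)
    (sx (full_sub (pullback Q (unstr S Sol) \<phi> (\<lambda>n. fst)) on_background) n)"
  by (rule bij_betw_byWitness[of _ "\<lambda>(a, s). ((a, unstr_map S r n s), s)"]) (auto simp: mdl_sx[OF Q])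

text \<open>By \<open>left_fibration_full_sub\<close> it remains to lift an arrow so that the lift ends in \<open>on_background\<close>.
  The restriction of a solution on \<open>G\<close> along an arrow of \<open>S\<close> lies over a vertex in the component of
  \<open>G\<close>; an edge in \<open>Fix\<close> that joins this vertex to \<open>G\<close> lifts to an edge of solutions, and this edge is
  the required second component.\<close>

theorem left_fibration_mdl:
  fixes Q :: "'q sset"
  assumes Q: "left_fibration Q NCop pQ" and \<phi>: "simp_map Q (nerve (op_cat S)) \<phi>"
  shows "left_fibration (mdl_total M R0 Sol Fix r G Q \<phi>) NCop (mdl_proj pQ)"
proof -
  let ?P = "pullback Q (unstr S Sol) \<phi> (\<lambda>n. fst)" and ?T = "mdl_total M R0 Sol Fix r G Q \<phi>"
  let ?f = "\<lambda>((a, b), s). (a, s)"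
  note Qs = left_fibrationD(1)[OF Q]
  have P: "left_fibration ?P NCop (\<lambda>n z. pQ n (fst z))"
    by (rule left_fibration_comp[OF left_fibration_pullback[OF sol_fibration Qs \<phi>] Q])
  have full: "left_fibration (full_sub ?P on_background) NCop (\<lambda>n z. pQ n (fst z))"
  proof (rule left_fibration_full_sub[OF P])
    fix z y assume z: "z \<in> sx ?P 0" "z \<in> on_background" and y: "y \<in> sx NCop 1" "sact NCop 1 [0] y = pQ 0 (fst z)"
    obtain a s where zs: "z = (a, s)" by (cases z)
    have a: "a \<in> sx Q 0" and s: "s \<in> sx (unstr S Sol) 0" and as: "\<phi> 0 a = fst s" using z(1) unfolding zs pullback_sx by auto
    obtain \<sigma> x where sx: "s = (\<sigma>, [x])" "\<sigma> \<in> sx (nerve (op_cat S)) 0" "x \<in> sx (pob Sol (ob (op_cat S) \<sigma> 0)) 0"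
      using s by (rule SolS.unstr_vertexE)
    have bg: "r (ob (op_cat S) \<sigma> 0) 0 x = Gc (ob (op_cat S) \<sigma> 0)"
      using z(2) background_iff[OF sx(2), of x] unfolding zs on_background_def sx(1) by simp
    have y0: "sact NCop 1 [0] y = pQ 0 a" using y(2) by (simp add: zs)
    obtain a1 where a1: "a1 \<in> sx Q 1" "pQ 1 a1 = y" "sact Q 1 [0] a1 = a"
      by (rule edge_lift[OF left_fibrationD(4)[OF Q] Qs left_fibrationD(2)[OF Q] left_fibrationD(3)[OF Q] a y(1) y0]) simp
    let ?\<tau> = "\<phi> 1 a1"
    let ?u = "?\<tau> 0 1" and ?c = "ob (op_cat S) ?\<tau> 0" and ?d = "ob (op_cat S) ?\<tau> 1"
    have t: "?\<tau> \<in> sx (nerve (op_cat S)) 1" by (rule simp_map_in[OF \<phi> a1(1)])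
    have t0: "nerve_act [0] ?\<tau> = \<sigma>"
      using simp_map_nat[OF \<phi> sing_in[of 0 1] a1(1)] a1(3) as sx(1) by simp
    have c: "?c = ob (op_cat S) \<sigma> 0" using ob_nerve_act[OF sing_in[of 0 1], of 0 "op_cat S" ?\<tau>] t0 by simp
    have cd: "?c \<in> cart_obj" "?d \<in> cart_obj" using nerveD(2)[OF t, of 0] nerveD(2)[OF t, of 1] by auto
    have u: "?u \<in> cArr S" "cCod S ?u = ?c" "cDom S ?u = ?d" using nerveD(4-6)[OF t, of 0 1] by auto
    have xc: "x \<in> sx (pob Sol ?c) 0" using sx(3) c by simp
    have x': "pmap Sol ?u 0 x \<in> sx (pob Sol ?d) 0"
      using simp_map_in[OF SolS.pmap_simp_map[OF u(1)], of x 0] xc u by simp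
    have rx: "r ?d 0 (pmap Sol ?u 0 x) = pmap Fix ?u 0 (Gc ?c)"
      using r_nat[OF u(1), of x 0] u xc bg c by simp
    obtain c' f \<psi> d' where ue: "?u = (c', (f, \<psi>), d')" using u(1) by (rule bdiff_arrE)
    have "(pmap Fix ?u 0 (Gc ?c), Gc ?d) \<in> conn (pob Fix ?d)"
      using stab_arr_Gc[of c' f \<psi> d'] u unfolding ue by simp
    then obtain e where e: "e \<in> sx (pob Fix ?d) 1" "sact (pob Fix ?d) 1 [0] e = pmap Fix ?u 0 (Gc ?c)"
      "sact (pob Fix ?d) 1 [1] e = Gc ?d"
      using kan_complex_conn_edge[of "pob Fix ?d"] Fix cd(2) unfolding proj_fibrant_def by (metis bdiff_simps(1))
    obtain e' where e': "e' \<in> sx (pob Sol ?d) 1" "r ?d 1 e' = e" "sact (pob Sol ?d) 1 [0] e' = pmap Sol ?u 0 x"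
      using path_lift[OF cd(2) x' e(1)] e(2) rx by auto
    note E = SolS.unstr_edge[OF t xc e'(1) e'(3)]
    have end1: "(sact Q 1 [1] a1, sact (unstr S Sol) 1 [1] (?\<tau>, [x, e'])) \<in> on_background"
    proof -
      have t1: "nerve_act [1] ?\<tau> \<in> sx (nerve (op_cat S)) 0" by (rule nerve_act_in[OF sing_in t]) simp
      have o1: "ob (op_cat S) (nerve_act [1] ?\<tau>) 0 = ?d" using ob_nerve_act[OF sing_in[of 1 1], of 0 "op_cat S" ?\<tau>] by simp
      have "r ?d 0 (sact (pob Sol ?d) 1 [1] e') = Gc ?d"
        using simp_map_nat[OF r_map[OF cd(2)] sing_in[of 1 1] e'(1)] e'(2) e(3) by simp
      then show ?thesis
        using background_iff[OF t1] unfolding on_background_def E(3) o1 by simp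
    qed
    have mem: "(a1, (?\<tau>, [x, e'])) \<in> sx ?P 1"
      unfolding pullback_sx using a1(1) E(1) by simp
    show "\<exists>e\<in>sx ?P 1. pQ 1 (fst e) = y \<and> sact ?P 1 [0] e = z \<and> sact ?P 1 [1] e \<in> on_background"
      by (rule bexI[OF _ mem]) (use a1 E(2) t0 zs sx(1) end1 in simp)
  qed
  have Ps: "is_sset ?P" by (rule left_fibrationD(1)[OF P])
  have fs_nat: "?f (sact ?T n \<alpha> z) = sact (full_sub ?P on_background) n \<alpha> (?f z)" for n \<alpha> z
    by (cases z; cases "fst z") (simp add: mdl_sact)
  have cl: "sact ?T n \<alpha> z \<in> sx ?T m" if al: "\<alpha> \<in> dmaps m n" and z: "z \<in> sx ?T n" for m n \<alpha> z
  proof -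
    obtain a b s where ze: "z = ((a, b), s)" by (metis prod.exhaust)
    have h: "b = unstr_map S r n s" "(a, s) \<in> sx (full_sub ?P on_background) n" using z unfolding ze mdl_sx[OF Qs] by auto
    have s: "s \<in> sx (unstr S Sol) n" using h(2) unfolding full_sub_sx pullback_sx by blast
    show ?thesis
      unfolding ze mdl_sact mdl_sx[OF Qs]
      using full_sub_act[OF Ps al h(2)] simp_map_nat[OF r_unstr al s] h(1) by simp
  qed
  have Fs: "is_sset (full_sub ?P on_background)" by (rule is_sset_full_sub[OF Ps])
  have T: "is_sset ?T" by (rule is_sset_bij[OF Fs mdl_bij[OF Qs] cl fs_nat])
  have fs: "simp_map ?T (full_sub ?P on_background) (\<lambda>n. ?f)"
    by (rule simp_mapI) (use bij_betw_apply[OF mdl_bij[OF Qs]] fs_nat in blast)+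
  show ?thesis
    by (rule left_fibration_bij[OF full T fs mdl_bij[OF Qs]]) (auto simp: mdl_proj_def)
qed

end

section \<open>Comparison of the moduli prestacks\<close>

lemma presents_actionD:
  assumes "presents_action M D \<Phi> eH Q pQ \<phi>"
  shows "left_fibration Q NCop pQ" "simp_map Q (nerve (op_cat (bdiff M D))) \<phi>"
proof -
  show "left_fibration Q NCop pQ" using assms unfolding presents_action_def by (rule conjunct1)
  show "simp_map Q (nerve (op_cat (bdiff M D))) \<phi>"
    using assms unfolding presents_action_def Let_def presents_def by (elim conjE exE)
qed

theorem theorem2p11:
  fixes M :: "'m mfd" and R0 :: "'u mfd"
    and Sol Conf :: "('u mfd, ('u, 'm) bd_arr, 'x) psh"
    and Fix\<^sub>0 :: "('u mfd, ('u, 'm) bd_arr, 'y) psh"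
    and Fix\<^sub>1 :: "('u mfd, ('u, 'm) bd_arr, 'z) psh"
    and p :: "'u mfd \<Rightarrow> nat \<Rightarrow> 'x \<Rightarrow> 'y" and q :: "'u mfd \<Rightarrow> nat \<Rightarrow> 'y \<Rightarrow> 'z"
    and G\<^sub>0 :: 'y and G\<^sub>1 :: 'z
  defines "BD \<equiv> bdiff M (diff_fam M)"
  assumes "smooth_manifold M"
    and "R0 \<in> cart_obj" and "diffeomorphic R0 (eucl_mfd 0)"
    and "proj_fibrant BD Conf" and "proj_fibrant BD Fix\<^sub>0" and "proj_fibrant BD Fix\<^sub>1"
    and "solution_subpresheaf BD Sol Conf"
    and "proj_fibration BD Conf Fix\<^sub>0 p" and "proj_fibration BD Fix\<^sub>0 Fix\<^sub>1 q"
    and "zero_connected BD Fix\<^sub>0 Fix\<^sub>1 q"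
    and "G\<^sub>0 \<in> sx (pob Fix\<^sub>0 R0) 0" and "G\<^sub>1 = q R0 0 G\<^sub>0"
  shows "(\<forall>c\<in>cart_obj. diff_stab M R0 Fix\<^sub>0 G\<^sub>0 c = diff_stab M R0 Fix\<^sub>1 G\<^sub>1 c) \<and>
    (\<forall>(\<Gamma> :: ('u, 's) smooth_group) H eH \<Phi> (Q :: 'q sset) pQ \<phi>.
       represents_group M (diff_stab M R0 Fix\<^sub>0 G\<^sub>0) H eH \<and> smooth_group_hom \<Gamma> H \<Phi> \<and>
       presents_action M (diff_stab M R0 Fix\<^sub>0 G\<^sub>0) \<Phi> eH Q pQ \<phi> \<longrightarrow>
       left_fibration (mdl_total M R0 Sol Fix\<^sub>0 p G\<^sub>0 Q \<phi>) NCop (mdl_proj pQ) \<and>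
       left_fibration (mdl_total M R0 Sol Fix\<^sub>1 (\<lambda>c n x. q c n (p c n x)) G\<^sub>1 Q \<phi>) NCop (mdl_proj pQ) \<and>
       (\<forall>(F\<^sub>0 :: ('u, 's) prestack) e\<^sub>0 (F\<^sub>1 :: ('u, 's) prestack) e\<^sub>1.
          is_mdl M R0 Sol Fix\<^sub>0 p G\<^sub>0 Q pQ \<phi> F\<^sub>0 e\<^sub>0 \<and>
          is_mdl M R0 Sol Fix\<^sub>1 (\<lambda>c n x. q c n (p c n x)) G\<^sub>1 Q pQ \<phi> F\<^sub>1 e\<^sub>1 \<longrightarrow>
          (\<exists>w. equivalence PCart w \<and> sact PCart 1 [0] w = F\<^sub>0 \<and> sact PCart 1 [1] w = F\<^sub>1 \<and>
            presents NCop
              (mdl_total M R0 Sol Fix\<^sub>0 p G\<^sub>0 Q \<phi>) (mdl_proj pQ) e\<^sub>0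
              (mdl_total M R0 Sol Fix\<^sub>1 (\<lambda>c n x. q c n (p c n x)) G\<^sub>1 Q \<phi>) (mdl_proj pQ) e\<^sub>1
              (mdl_map (bd_stab M R0 Fix\<^sub>0 G\<^sub>0) q) w)))"
proof -
  let ?B = "bdiff M (diff_fam M)"
  note A = assms(2-)[unfolded BD_def]
  have uc: "union_of_components (pob Sol c) (pob Conf c)" and Conf_kan: "kan_complex (pob Conf c)"
    and Solc: "is_sset (pob Sol c)"
    and pf: "kan_fibration (pob Conf c) (pob Fix\<^sub>0 c) (p c)" and qf: "kan_fibration (pob Fix\<^sub>0 c) (pob Fix\<^sub>1 c) (q c)"
    and zc: "inj_on (pi0_map (pob Fix\<^sub>1 c) (q c)) (pi0 (pob Fix\<^sub>0 c))" if "c \<in> cart_obj" for c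
    using A(4,7,8,9,10) that
    unfolding proj_fibrant_def solution_subpresheaf_def proj_fibration_def zero_connected_def simplicial_presheaf_def
    by (auto dest: bij_betw_imp_inj_on)
  have p_map: "presheaf_map ?B Conf Fix\<^sub>0 p"
    and q_map: "presheaf_map ?B Fix\<^sub>0 Fix\<^sub>1 q"
    using A(8,9) unfolding proj_fibration_def by blast+
  have Sol: "proj_fibrant ?B Sol"
    using A(7) union_of_components_kan[OF uc Solc Conf_kan]
    unfolding proj_fibrant_def solution_subpresheaf_def by simp
  have Sol_Conf: "pmap Sol u n x = pmap Conf u n x"
    if "u \<in> cArr ?B" "x \<in> sx (pob Sol (cCod ?B u)) n" for u n x
    using A(7) that unfolding solution_subpresheaf_def by blast
  have pS: "presheaf_map ?B Sol Fix\<^sub>0 p"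
    unfolding presheaf_map_def
  proof (intro conjI ballI allI)
    fix c :: "'u mfd" assume "c \<in> cObj ?B"
    then have c: "c \<in> cart_obj" by simp
    note U = union_of_componentsD[OF uc[OF c]] and pc = kan_fibrationD(3)[OF pf[OF c]]
    show "simp_map (pob Sol c) (pob Fix\<^sub>0 c) (p c)"
      by (rule simp_mapI) (use simp_map_in[OF pc U(1)] U(2) simp_map_nat[OF pc _ U(1)] in auto)
  next
    fix u :: "('u, 'm) bd_arr" and n x
    assume u: "u \<in> cArr ?B" and x: "x \<in> sx (pob Sol (cCod ?B u)) n"
    have "cCod ?B u \<in> cart_obj" using u by (rule bdiff_arrE) simp
    then have "x \<in> sx (pob Conf (cCod ?B u)) n" using union_of_componentsD(1)[OF uc] x by blast
    then show "p (cDom ?B u) n (pmap Sol u n x) = pmap Fix\<^sub>0 u n (p (cCod ?B u) n x)"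
      using p_map u unfolding presheaf_map_def Sol_Conf[OF u x] by blast
  qed
  have q_nat: "q (cDom ?B u) n (pmap Fix\<^sub>0 u n x) = pmap Fix\<^sub>1 u n (q (cCod ?B u) n x)"
    if "u \<in> cArr ?B" "x \<in> sx (pob Fix\<^sub>0 (cCod ?B u)) n" for u n x
    using q_map that unfolding presheaf_map_def by blast
  have qpS: "presheaf_map ?B Sol Fix\<^sub>1 (\<lambda>c n x. q c n (p c n x))"
    unfolding presheaf_map_def
  proof (intro conjI ballI allI)
    fix c :: "'u mfd" assume c: "c \<in> cObj ?B"
    show "simp_map (pob Sol c) (pob Fix\<^sub>1 c) (\<lambda>n x. q c n (p c n x))"
      by (rule simp_map_comp) (use pS q_map c in \<open>unfold presheaf_map_def, blast+\<close>)
  next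
    fix u :: "('u, 'm) bd_arr" and n x
    assume u: "u \<in> cArr ?B" and x: "x \<in> sx (pob Sol (cCod ?B u)) n"
    have "cCod ?B u \<in> cObj ?B" using u by (rule bdiff_arrE) simp
    then have "p (cCod ?B u) n x \<in> sx (pob Fix\<^sub>0 (cCod ?B u)) n"
      using pS x unfolding presheaf_map_def by (blast intro: simp_map_in)
    moreover have "p (cDom ?B u) n (pmap Sol u n x) = pmap Fix\<^sub>0 u n (p (cCod ?B u) n x)"
      using pS u x unfolding presheaf_map_def by blast
    ultimately show "q (cDom ?B u) n (p (cDom ?B u) n (pmap Sol u n x)) =
        pmap Fix\<^sub>1 u n (q (cCod ?B u) n (p (cCod ?B u) n x))"
      using q_nat[OF u] by simp
  qed
  \<comment> \<open>Edges lift to \<open>Conf\<close>, and a lift that begins in the union of components \<open>Sol\<close> stays there.\<close>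
  have p_lift: "\<exists>e'\<in>sx (pob Sol c) 1. p c 1 e' = e \<and> sact (pob Sol c) 1 [0] e' = x"
    if c: "c \<in> cart_obj" and x: "x \<in> sx (pob Sol c) 0" and e: "e \<in> sx (pob Fix\<^sub>0 c) 1" "sact (pob Fix\<^sub>0 c) 1 [0] e = p c 0 x" for c x e
  proof -
    note K = kan_fibrationD[OF pf[OF c]] and U = union_of_componentsD[OF uc[OF c]]
    obtain e' where e': "e' \<in> sx (pob Conf c) 1" "p c 1 e' = e" "sact (pob Conf c) 1 [0] e' = x"
      by (rule edge_lift[OF K(4) K(1-3) U(1)[OF x] e]) auto
    have "e' \<in> sx (pob Sol c) 1"
      by (rule union_of_components_closed[OF uc[OF c] K(1) e'(1), of 0]) (use e'(3) x in auto)
    then show ?thesis using e' U(2)[OF sing_in[of 0 1]] by auto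
  qed
  have qp_lift: "\<exists>e'\<in>sx (pob Sol c) 1. q c 1 (p c 1 e') = e \<and> sact (pob Sol c) 1 [0] e' = x"
    if c: "c \<in> cart_obj" and x: "x \<in> sx (pob Sol c) 0" and e: "e \<in> sx (pob Fix\<^sub>1 c) 1" "sact (pob Fix\<^sub>1 c) 1 [0] e = q c 0 (p c 0 x)" for c x e
  proof -
    note K = kan_fibrationD[OF qf[OF c]]
    have px: "p c 0 x \<in> sx (pob Fix\<^sub>0 c) 0"
      using simp_map_in[OF kan_fibrationD(3)[OF pf[OF c]] union_of_componentsD(1)[OF uc[OF c] x]] .
    obtain e0 where e0: "e0 \<in> sx (pob Fix\<^sub>0 c) 1" "q c 1 e0 = e" "sact (pob Fix\<^sub>0 c) 1 [0] e0 = p c 0 x"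
      by (rule edge_lift[OF K(4) K(1-3) px e]) auto
    show ?thesis using p_lift[OF c x e0(1,3)] e0(2) by auto
  qed
  have G1: "G\<^sub>1 \<in> sx (pob Fix\<^sub>1 R0) 0"
    unfolding A(12) by (rule simp_map_in[OF kan_fibrationD(3)[OF qf[OF A(2)]] A(11)])
  interpret D0: solutions_on_background M R0 Sol Fix\<^sub>0 p G\<^sub>0
    by unfold_locales (use A Sol pS p_lift in auto)
  interpret D1: solutions_on_background M R0 Sol Fix\<^sub>1 "\<lambda>c n x. q c n (p c n x)" G\<^sub>1
    by unfold_locales (use A Sol qpS qp_lift G1 in auto)
  have qGc: "q c 0 (D0.Gc c) = D1.Gc c" if c: "c \<in> cart_obj" for c
    unfolding pull_const_def A(12) using q_nat[OF D0.const_arr[OF c], of G\<^sub>0 0] A(11) by simp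
  \<comment> \<open>As \<open>q\<close> is injective on components, it detects whether \<open>(1, \<psi>)\<close> preserves that of \<open>G\<close>.\<close>
  have stab: "diff_stab M R0 Fix\<^sub>0 G\<^sub>0 c = diff_stab M R0 Fix\<^sub>1 G\<^sub>1 c" if c: "c \<in> cart_obj" for c
  proof -
    have "(pmap Fix\<^sub>0 (c, (\<lambda>x\<in>pts c. x, \<psi>), c) 0 (D0.Gc c), D0.Gc c) \<in> conn (pob Fix\<^sub>0 c) \<longleftrightarrow>
        (pmap Fix\<^sub>1 (c, (\<lambda>x\<in>pts c. x, \<psi>), c) 0 (D1.Gc c), D1.Gc c) \<in> conn (pob Fix\<^sub>1 c)"
      if \<psi>: "\<psi> \<in> diff_fam M c" for \<psi>
    proof -
      let ?u = "(c, (\<lambda>x\<in>pts c. x, \<psi>), c)"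
      have u: "?u \<in> cArr ?B" unfolding bdiff_arr_iff using cart_id_arr[OF c] \<psi> by blast
      have n: "q c 0 (pmap Fix\<^sub>0 ?u 0 (D0.Gc c)) = pmap Fix\<^sub>1 ?u 0 (D1.Gc c)"
        using q_nat[OF u, of "D0.Gc c" 0] D0.Gc_in[OF c] qGc[OF c] by simp
      have i: "pmap Fix\<^sub>0 ?u 0 (D0.Gc c) \<in> sx (pob Fix\<^sub>0 c) 0"
        using simp_map_in[OF D0.Fix.pmap_simp_map[OF u], of "D0.Gc c" 0] D0.Gc_in[OF c] by simp
      note qc = kan_fibrationD(3)[OF qf[OF c]]
      show ?thesis
        using conn_map[OF qc, of "pmap Fix\<^sub>0 ?u 0 (D0.Gc c)" "D0.Gc c"]
          conn_reflect[OF qc zc[OF c] i D0.Gc_in[OF c]] unfolding n qGc[OF c] by blast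
    qed
    then show ?thesis unfolding diff_stab_def by blast
  qed
  have S_eq: "D1.S = D0.S" by (rule bdiff_cong) (simp add: stab)
  have main: "left_fibration (mdl_total M R0 Sol Fix\<^sub>0 p G\<^sub>0 Q \<phi>) NCop (mdl_proj pQ) \<and>
       left_fibration (mdl_total M R0 Sol Fix\<^sub>1 (\<lambda>c n x. q c n (p c n x)) G\<^sub>1 Q \<phi>) NCop (mdl_proj pQ) \<and>
       (\<forall>(F\<^sub>0 :: ('u, 's) prestack) e\<^sub>0 (F\<^sub>1 :: ('u, 's) prestack) e\<^sub>1.
          is_mdl M R0 Sol Fix\<^sub>0 p G\<^sub>0 Q pQ \<phi> F\<^sub>0 e\<^sub>0 \<and>
          is_mdl M R0 Sol Fix\<^sub>1 (\<lambda>c n x. q c n (p c n x)) G\<^sub>1 Q pQ \<phi> F\<^sub>1 e\<^sub>1 \<longrightarrow>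
          (\<exists>w. equivalence PCart w \<and> sact PCart 1 [0] w = F\<^sub>0 \<and> sact PCart 1 [1] w = F\<^sub>1 \<and>
            presents NCop
              (mdl_total M R0 Sol Fix\<^sub>0 p G\<^sub>0 Q \<phi>) (mdl_proj pQ) e\<^sub>0
              (mdl_total M R0 Sol Fix\<^sub>1 (\<lambda>c n x. q c n (p c n x)) G\<^sub>1 Q \<phi>) (mdl_proj pQ) e\<^sub>1
              (mdl_map D0.S q) w))"
    if Q: "left_fibration Q NCop pQ" and \<phi>: "simp_map Q (nerve (op_cat D0.S)) \<phi>"
    for Q :: "'q sset" and pQ and \<phi> :: "nat \<Rightarrow> 'q \<Rightarrow> nat \<Rightarrow> nat \<Rightarrow> ('u, 'm) bd_arr"
  proof -
    let ?T0 = "mdl_total M R0 Sol Fix\<^sub>0 p G\<^sub>0 Q \<phi>" and ?T1 = "mdl_total M R0 Sol Fix\<^sub>1 (\<lambda>c n x. q c n (p c n x)) G\<^sub>1 Q \<phi>"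
    let ?S = "D0.S" and ?P = "pullback Q (unstr D0.S Sol) \<phi> (\<lambda>n. fst)"
    let ?W0 = "D0.on_background :: ('q \<times> _) set" and ?W1 = "D1.on_background :: ('q \<times> _) set"
    let ?q = "unstr_map ?S q" and ?m = "mdl_map ?S q"
    note Qs = left_fibrationD(1)[OF Q]
    note lf0 = D0.left_fibration_mdl[OF Q \<phi>] and lf1 = D1.left_fibration_mdl[OF Q, unfolded S_eq, OF \<phi>]
    note sx0 = D0.mdl_sx[OF Qs, of _ _ _ \<phi>] and sx1 = D1.mdl_sx[OF Qs, of _ _ _ \<phi>, unfolded S_eq]
    note sact0 = D0.mdl_sact[of Q \<phi>] and sact1 = D1.mdl_sact[of Q \<phi>, unfolded S_eq]
    have qS: "simp_map (unstr ?S Fix\<^sub>0) (unstr ?S Fix\<^sub>1) ?q"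
      by (rule simp_map_unstr_map[OF presheaf_map_restrict[OF q_map diff_stab_sub]])
    have P: "is_sset ?P"
      by (rule is_sset_pullback[OF Qs D0.SolS.is_sset_unstr \<phi> left_fibrationD(3)[OF D0.sol_fibration]])
    \<comment> \<open>A solution on \<open>G\<^sub>0\<close> is one on \<open>G\<^sub>1\<close>, so both total spaces are full in \<open>?P\<close>, the first inside the second.\<close>
    have W_sub: "z \<in> ?W1" if z: "z \<in> sx ?P 0" "z \<in> ?W0" for z
    proof -
      obtain a s where zs: "z = (a, s)" by (cases z)
      have s: "s \<in> sx (unstr ?S Sol) 0" using z(1) unfolding zs pullback_sx by blast
      obtain \<sigma> x where sx: "s = (\<sigma>, [x])" "\<sigma> \<in> sx (nerve (op_cat ?S)) 0" using s by (rule D0.SolS.unstr_vertexE)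
      have c: "ob (op_cat ?S) \<sigma> 0 \<in> cart_obj" using nerveD(2)[OF sx(2) order_refl] by simp
      show ?thesis
        using z(2) D0.background_iff[OF sx(2), of x] D1.background_iff[unfolded S_eq, OF sx(2), of x] qGc[OF c]
        unfolding zs D0.on_background_def D1.on_background_def S_eq sx(1) by simp
    qed
    define V where "V = (\<lambda>((a, b :: (('u, 'm) bd_arr, 'z) un), s). (a, s)) -` ?W0"
    have V_iff: "((a, b), s) \<in> V \<longleftrightarrow> (a, s) \<in> ?W0" for a b s by (simp add: V_def)
    have m_eq: "?m n ((a, unstr_map ?S p n s), s) = ((a, unstr_map ?S (\<lambda>c n x. q c n (p c n x)) n s), s)" for n a s
      by (simp add: mdl_map_def unstr_map_comp)
    have full0: "(a, s) \<in> sx (full_sub ?P ?W0) n \<longleftrightarrow>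
        ((a, unstr_map ?S (\<lambda>c n x. q c n (p c n x)) n s), s) \<in> sx (full_sub ?T1 V) n" for a s n
    proof
      assume as: "(a, s) \<in> sx (full_sub ?P ?W0) n"
      have v: "sact ?P n [i] (a, s) \<in> ?W1" if "i \<le> n" for i
        using as W_sub[OF sset_act[OF P sing_in[OF that]]] that unfolding full_sub_sx by blast
      then have "(a, s) \<in> sx (full_sub ?P ?W1) n" using as unfolding full_sub_sx by blast
      then have t1: "((a, unstr_map ?S (\<lambda>c n x. q c n (p c n x)) n s), s) \<in> sx ?T1 n" unfolding sx1 by simp
      have "sact ?T1 n [i] ((a, unstr_map ?S (\<lambda>c n x. q c n (p c n x)) n s), s) \<in> V" if "i \<le> n" for i
        using as that unfolding V_iff sact1 full_sub_sx by auto
      then show "((a, unstr_map ?S (\<lambda>c n x. q c n (p c n x)) n s), s) \<in> sx (full_sub ?T1 V) n"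
        using t1 unfolding full_sub_sx by blast
    next
      assume t: "((a, unstr_map ?S (\<lambda>c n x. q c n (p c n x)) n s), s) \<in> sx (full_sub ?T1 V) n"
      then have "(a, s) \<in> sx ?P n" unfolding full_sub_sx[of _ ?T1] sx1 unfolding full_sub_sx by blast
      moreover have "sact ?P n [i] (a, s) \<in> ?W0" if "i \<le> n" for i
        using t that unfolding full_sub_sx sact1 V_iff by auto
      ultimately show "(a, s) \<in> sx (full_sub ?P ?W0) n" unfolding full_sub_sx by blast
    qed
    have bij: "bij_betw (?m n) (sx ?T0 n) (sx (full_sub ?T1 V) n)" for n
    proof (rule bij_betw_byWitness[of _ "\<lambda>((a, b), s). ((a, unstr_map ?S p n s), s)"])
      show "\<forall>z\<in>sx ?T0 n. (\<lambda>((a, b), s). ((a, unstr_map ?S p n s), s)) (?m n z) = z"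
        by (auto simp: mdl_map_def sx0)
      show "\<forall>z\<in>sx (full_sub ?T1 V) n. ?m n ((\<lambda>((a, b), s). ((a, unstr_map ?S p n s), s)) z) = z"
        by (auto simp: m_eq full_sub_sx[of _ ?T1] sx1)
      show "?m n ` sx ?T0 n \<subseteq> sx (full_sub ?T1 V) n"
        using full0 by (auto simp: sx0 m_eq)
      show "(\<lambda>((a, b), s). ((a, unstr_map ?S p n s), s)) ` sx (full_sub ?T1 V) n \<subseteq> sx ?T0 n"
      proof (rule image_subsetI)
        fix z assume z: "z \<in> sx (full_sub ?T1 V) n"
        obtain a b s where ze: "z = ((a, b), s)" by (metis prod.exhaust)
        have t: "((a, b), s) \<in> sx (full_sub ?T1 V) n" using z unfolding ze .
        then have "b = unstr_map ?S (\<lambda>c n x. q c n (p c n x)) n s" unfolding full_sub_sx[of _ ?T1] sx1 by blast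
        then show "(\<lambda>((a, b), s). ((a, unstr_map ?S p n s), s)) z \<in> sx ?T0 n"
          using t full0 unfolding ze prod.case sx0 by simp
      qed
    qed
    have ms: "simp_map ?T0 ?T1 ?m"
    proof (rule simp_mapI)
      show "?m n z \<in> sx ?T1 n" if "z \<in> sx ?T0 n" for n z
        using bij_betw_apply[OF bij that] unfolding full_sub_sx by blast
      fix k n \<alpha> z assume al: "\<alpha> \<in> dmaps k n" and z: "z \<in> sx ?T0 n"
      obtain a b s where ze: "z = ((a, b), s)" by (metis prod.exhaust)
      have b: "b = unstr_map ?S p n s" and s: "s \<in> sx (unstr ?S Sol) n"
        using z unfolding ze sx0 full_sub_sx pullback_sx by blast+
      have "b \<in> sx (unstr ?S Fix\<^sub>0) n" unfolding b by (rule simp_map_in[OF D0.r_unstr s])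
      then show "?m k (sact ?T0 n \<alpha> z) = sact ?T1 n \<alpha> (?m n z)"
        unfolding ze sact0 mdl_map_def prod.case sact1 using simp_map_nat[OF qS al] by simp
    qed
    \<comment> \<open>A solution on \<open>G\<^sub>1\<close> lies over a vertex of the fibre of \<open>q\<close> through \<open>G\<^sub>0\<close>. By injectivity on
      components that vertex is joined to \<open>G\<^sub>0\<close>, and a lift of the edge to solutions, taken over a
      degenerate edge of \<open>Q\<close>, is an edge in the fibre that ends at a solution on \<open>G\<^sub>0\<close>. The image of this
      edge in \<open>Fix\<^sub>1\<close> need not be constant, which is harmless because \<open>BSYM\<close> is full.\<close>
    have dense: "\<exists>e\<in>sx ?T1 1. mdl_proj pQ 1 e = sact NCop 0 [0, 0] (mdl_proj pQ 0 z) \<and>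
        sact ?T1 1 [0] e = z \<and> sact ?T1 1 [1] e \<in> V" if z: "z \<in> sx ?T1 0" for z
    proof -
      obtain a b s where ze: "z = ((a, b), s)" by (metis prod.exhaust)
      have b: "b = unstr_map ?S (\<lambda>c n x. q c n (p c n x)) 0 s" and as: "(a, s) \<in> sx (full_sub ?P ?W1) 0"
        using z unfolding ze sx1 by blast+
      have a: "a \<in> sx Q 0" and s: "s \<in> sx (unstr ?S Sol) 0" and pa: "\<phi> 0 a = fst s"
        using as unfolding full_sub_sx pullback_sx by blast+
      have asW: "(a, s) \<in> ?W1"
        using as sset_id[OF P, of "(a, s)" 0] unfolding full_sub_sx did_0 by force
      obtain \<sigma> x where sx: "s = (\<sigma>, [x])" "\<sigma> \<in> sx (nerve (op_cat ?S)) 0" "x \<in> sx (pob Sol (ob (op_cat ?S) \<sigma> 0)) 0"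
        using s by (rule D0.SolS.unstr_vertexE)
      let ?c = "ob (op_cat ?S) \<sigma> 0"
      have c: "?c \<in> cart_obj" using nerveD(2)[OF sx(2) order_refl] by simp
      have px: "p ?c 0 x \<in> sx (pob Fix\<^sub>0 ?c) 0" by (rule simp_map_in[OF D0.r_map[OF c] sx(3)])
      have "q ?c 0 (p ?c 0 x) = q ?c 0 (D0.Gc ?c)"
        using asW D1.background_iff[unfolded S_eq, OF sx(2), of x] qGc[OF c]
        unfolding D1.on_background_def S_eq sx(1) by simp
      then have "(q ?c 0 (p ?c 0 x), q ?c 0 (D0.Gc ?c)) \<in> conn (pob Fix\<^sub>1 ?c)"
        using simp_map_in[OF kan_fibrationD(3)[OF qf[OF c]] D0.Gc_in[OF c]] unfolding conn_def by simp
      then have "(p ?c 0 x, D0.Gc ?c) \<in> conn (pob Fix\<^sub>0 ?c)"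
        by (rule conn_reflect[OF kan_fibrationD(3)[OF qf[OF c]] zc[OF c] px D0.Gc_in[OF c]])
      moreover have "kan_complex (pob Fix\<^sub>0 ?c)" using A(5) c unfolding proj_fibrant_def by simp
      ultimately obtain e where e: "e \<in> sx (pob Fix\<^sub>0 ?c) 1" "sact (pob Fix\<^sub>0 ?c) 1 [0] e = p ?c 0 x"
        "sact (pob Fix\<^sub>0 ?c) 1 [1] e = D0.Gc ?c" using kan_complex_conn_edge by metis
      obtain e' where e': "e' \<in> sx (pob Sol ?c) 1" "p ?c 1 e' = e" "sact (pob Sol ?c) 1 [0] e' = x"
        using p_lift[OF c sx(3) e(1,2)] by blast
      let ?a = "sact Q 0 [0, 0] a"
      have d: "[0, 0] \<in> dmaps 1 0" by (rule pair_in) auto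
      have a1: "?a \<in> sx Q 1" by (rule sset_act[OF Qs d a])
      define \<tau> where "\<tau> = nerve_act [0, 0] \<sigma>"
      have t: "\<tau> \<in> sx (nerve (op_cat ?S)) 1" unfolding \<tau>_def by (rule nerve_act_in[OF d sx(2)])
      have pa1: "\<phi> 1 ?a = \<tau>" using simp_map_nat[OF \<phi> d a] pa unfolding \<tau>_def sx(1) by simp
      have o: "ob (op_cat ?S) \<tau> i = ?c" if "i \<le> 1" for i
        unfolding \<tau>_def ob_nerve_act[OF d that] using that by (cases "i = 0") (auto simp: One_nat_def le_Suc_eq)
      have t01: "\<tau> 0 1 = \<sigma> 0 0" unfolding \<tau>_def using nerve_act_nth[OF d, of 0 1 \<sigma>] by (simp add: One_nat_def)
      have xe: "sact (pob Sol ?c) 1 [0] e' = pmap Sol (\<tau> 0 1) 0 x"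
        unfolding t01 using D0.SolS.chain_id[OF sx(2) order_refl sx(3)] e'(3) by simp
      have t_end: "nerve_act [i] \<tau> = \<sigma>" if "i \<le> 1" for i
      proof -
        have "nerve_act [i] \<tau> = nerve_act (did 0) \<sigma>"
          unfolding \<tau>_def nerve_act_comp[OF d sing_in[OF that]] dcomp_sing did_0
          using that by (cases "i = 0") (auto simp: One_nat_def le_Suc_eq)
        then show ?thesis using sset_id[OF is_sset_nerve sx(2)] by simp
      qed
      note E = D0.SolS.unstr_edge[OF t, unfolded o[OF zero_le_one] o[OF order_refl], OF sx(3) e'(1) xe]
      let ?s = "(\<tau>, [x, e'])" and ?x = "sact (pob Sol ?c) 1 [1] e'"
      have end0: "sact (unstr ?S Sol) 1 [0] ?s = s" using E(2) t_end[of 0] sx(1) by simp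
      have end1: "sact (unstr ?S Sol) 1 [1] ?s = (\<sigma>, [?x])" using E(3) t_end[of 1] by simp
      have "p ?c 0 ?x = D0.Gc ?c"
        using simp_map_nat[OF D0.r_map[OF c] sing_in[of 1 1] e'(1)] e'(2) e(3) by simp
      then have W0: "(sact Q 1 [i] ?a, (\<sigma>, [?x])) \<in> ?W0" for i
        unfolding D0.on_background_def using D0.background_iff[OF sx(2), of ?x] by simp
      have Qv: "sact Q 1 [i] ?a = a" if "i \<le> 1" for i
        using sact_vertex[OF Qs d a that] sset_id[OF Qs a] that by (cases "i = 0") (auto simp: One_nat_def le_Suc_eq did_0)
      have P1: "(?a, ?s) \<in> sx ?P 1" unfolding pullback_sx using a1 E(1) pa1 by simp
      have v0: "sact ?P 1 [0] (?a, ?s) \<in> ?W1" using asW end0 Qv[of 0] by simp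
      have v1': "sact ?P 1 [1] (?a, ?s) \<in> ?W0" using W0[of 1] end1 by simp
      have v1: "sact ?P 1 [1] (?a, ?s) \<in> ?W1" by (rule W_sub[OF sset_act[OF P sing_in P1] v1']) simp
      let ?e = "((?a, unstr_map ?S (\<lambda>c n x. q c n (p c n x)) 1 ?s), ?s)"
      have mem: "?e \<in> sx ?T1 1" unfolding sx1 full_sub_sx all_le_1 using P1 v0 v1 by simp
      have T1: "is_sset ?T1" by (rule left_fibrationD(1)[OF lf1])
      have e0: "sact ?T1 1 [0] ?e \<in> sx ?T1 0" by (rule sset_act[OF T1 sing_in mem]) simp
      have "sact ?T1 1 [0] ?e = z"
        using e0 unfolding sact1 sx1 ze b end0 using Qv[of 0] by simp
      moreover have "sact ?T1 1 [1] ?e \<in> V"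
        using v1' unfolding sact1 pullback_sact V_iff .
      moreover have "mdl_proj pQ 1 ?e = sact NCop 0 [0, 0] (mdl_proj pQ 0 z)"
        unfolding ze mdl_proj_def prod.case by (rule simp_map_nat[OF left_fibrationD(3)[OF Q] d a])
      ultimately show ?thesis using mem by blast
    qed
    have proj: "mdl_proj pQ n (?m n z) = mdl_proj pQ n z" for n z
      by (cases z; cases "fst z") (simp add: mdl_map_def mdl_proj_def)
    show ?thesis
    proof (intro conjI allI impI)
      show "left_fibration ?T0 NCop (mdl_proj pQ)" by (rule lf0)
      show "left_fibration ?T1 NCop (mdl_proj pQ)" by (rule lf1)
      fix F\<^sub>0 F\<^sub>1 :: "('u, 's) prestack" and e\<^sub>0 e\<^sub>1
      assume "is_mdl M R0 Sol Fix\<^sub>0 p G\<^sub>0 Q pQ \<phi> F\<^sub>0 e\<^sub>0 \<and>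
        is_mdl M R0 Sol Fix\<^sub>1 (\<lambda>c n x. q c n (p c n x)) G\<^sub>1 Q pQ \<phi> F\<^sub>1 e\<^sub>1"
      then have F: "F\<^sub>0 \<in> sx PCart 0" "F\<^sub>1 \<in> sx PCart 0"
        "classifies NCop (vmap F\<^sub>0) ?T0 (mdl_proj pQ) e\<^sub>0" "classifies NCop (vmap F\<^sub>1) ?T1 (mdl_proj pQ) e\<^sub>1"
        unfolding is_mdl_def by blast+
      show "\<exists>w. equivalence PCart w \<and> sact PCart 1 [0] w = F\<^sub>0 \<and> sact PCart 1 [1] w = F\<^sub>1 \<and>
          presents NCop ?T0 (mdl_proj pQ) e\<^sub>0 ?T1 (mdl_proj pQ) e\<^sub>1 ?m w"
        by (rule full_dense_map_presents_equivalence[OF is_sset_nerve F ms proj bij dense])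
    qed
  qed
  show ?thesis
    using stab main[OF presents_actionD] by blast
qed

end
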